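(* Let $m\ge3$ be an integer and $0<\alpha<1$. Define $g_0(\theta)=-\theta^{-\alpha}$ for $0<\theta<\frac{\pi}{m}$, and extend $g_0$ first by oddness to $-\frac{\pi}{m}<\theta<0$ and then by $m$-fold symmetry (i.e. $\frac{2\pi}{m}$-periodically) to $\mathbb S$. Then the unique solution $g$ of $$\partial_tg+2G\,\partial_\theta g=0,\qquad (4+\partial_{\theta\theta})G=g,\qquad g(0,\cdot)=g_0,$$ has a maximal time interval of existence of the form $(-\infty,T^* )$ with $T^*<+\infty$.
   Context: $\mathbb S=\mathbb R/2\pi\mathbb Z$. For $g$ odd and $\frac{2\pi}{m}$-periodic in $\theta$, $G$ denotes the unique odd, $\frac{2\pi}{m}$-periodic solution of $4G+\partial_{\theta\theta}G=g$. A solution on a time interval $I\ni0$ is a function $g(t,\theta)$, odd and $\frac{2\pi}{m}$-periodic in $\theta$, with $\theta^\alpha g(t,\theta)$ bounded in $L^\infty(0,\frac{\pi}{m})$ locally uniformly in $t\in I$, which is transported by the flow of $2G$: $g(t,\chi(t,\theta))=g_0(\theta)$ where $\frac{d}{dt}\chi(t,\theta)=2G(t,\chi(t,\theta))$, $\chi(0,\theta)=\theta$. Local existence and uniqueness of such solutions is known; the maximal interval of existence is the largest interval $I$ on which the solution exists. *)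

theory Defs
  imports "HOL-Analysis.Analysis"
begin

text \<open>Functions on the circle are represented by their \<open>2*pi\<close>-periodic lifts to the real line.\<close>

definition odd_symmetric :: "nat \<Rightarrow> (real \<Rightarrow> real) \<Rightarrow> bool" where
  "odd_symmetric m f \<longleftrightarrow>
     (\<forall>x. f (- x) = - f x) \<and> (\<forall>x. f (x + 2 * pi / real m) = f x)"

text \<open>
  Below, \<open>x\<close> is the representative of \<open>\<theta>\<close> modulo \<open>2*pi/m\<close> in \<open>[-pi/m, pi/m)\<close>. Oddness and
  periodicity force the value 0 at the multiples of \<open>pi/m\<close>.
\<close>

definition odd_symmetric_ext :: "nat \<Rightarrow> (real \<Rightarrow> real) \<Rightarrow> real \<Rightarrow> real" where
  "odd_symmetric_ext m f \<theta> =
     (let p = 2 * pi / real m; x = \<theta> - p * of_int (round (\<theta> / p))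
      in if 0 < x \<and> x < pi / real m then f x
         else if - (pi / real m) < x \<and> x < 0 then - f (- x)
         else 0)"

text \<open>
  \<open>G\<close> is an odd, \<open>2*pi/m\<close>-periodic solution of \<open>4 G + G'' = g\<close>. As \<open>g\<close> is merely locally
  integrable, \<open>G\<close> is a strong solution: \<open>G\<close> is differentiable and its derivative \<open>D\<close> is locally
  absolutely continuous with weak derivative \<open>g - 4 G\<close>.
\<close>

definition is_stream :: "nat \<Rightarrow> (real \<Rightarrow> real) \<Rightarrow> (real \<Rightarrow> real) \<Rightarrow> bool" where
  "is_stream m g G \<longleftrightarrow>
     odd_symmetric m G \<and>
     (\<forall>a b. g absolutely_integrable_on {a..b}) \<and>
     (\<exists>D. (\<forall>x. (G has_real_derivative D x) (at x)) \<and>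
          (\<forall>a b. a \<le> b \<longrightarrow> ((\<lambda>x. g x - 4 * G x) has_integral (D b - D a)) {a..b}))"

text \<open>
  \<open>g t\<close> is the solution at time \<open>t\<close>, as a function of the angle. It is unconstrained for
  \<open>t \<notin> I\<close>. Time derivatives at endpoints of \<open>I\<close> are one-sided.
\<close>

definition is_solution ::
    "nat \<Rightarrow> real \<Rightarrow> (real \<Rightarrow> real) \<Rightarrow> real set \<Rightarrow> (real \<Rightarrow> real \<Rightarrow> real) \<Rightarrow> bool" where
  "is_solution m \<alpha> g0 I g \<longleftrightarrow>
     is_interval I \<and> 0 \<in> I \<and>
     (\<forall>t\<in>I. odd_symmetric m (g t) \<and> g t \<in> borel_measurable lebesgue) \<and>
     (\<forall>K. compact K \<and> K \<subseteq> I \<longrightarrow>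
        (\<exists>C. \<forall>t\<in>K. AE \<theta> in lebesgue.
           0 < \<theta> \<and> \<theta> < pi / real m \<longrightarrow> \<bar>\<theta> powr \<alpha> * g t \<theta>\<bar> \<le> C)) \<and>
     (\<exists>G \<Phi>.
        (\<forall>t\<in>I. is_stream m (g t) (G t)) \<and>
        (\<forall>\<theta>. \<Phi> 0 \<theta> = \<theta>) \<and>
        (\<forall>\<theta>. \<forall>t\<in>I. ((\<lambda>s. \<Phi> s \<theta>) has_real_derivative 2 * G t (\<Phi> t \<theta>)) (at t within I)) \<and>
        (\<forall>\<theta>. \<forall>t\<in>I. g t (\<Phi> t \<theta>) = g0 \<theta>))"

text \<open>
  \<open>I\<close> is the largest interval on which a solution with initial datum \<open>g0\<close> exists, and
  \<open>g\<close> is the unique solution.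
\<close>

definition is_maximal_solution ::
    "nat \<Rightarrow> real \<Rightarrow> (real \<Rightarrow> real) \<Rightarrow> real set \<Rightarrow> (real \<Rightarrow> real \<Rightarrow> real) \<Rightarrow> bool" where
  "is_maximal_solution m \<alpha> g0 I g \<longleftrightarrow>
     is_solution m \<alpha> g0 I g \<and>
     (\<forall>J h. is_solution m \<alpha> g0 J h \<longrightarrow> J \<subseteq> I \<and> (\<forall>t\<in>J. h t = g t))"

lemma odd_symmetric_ext_eq:
  assumes "0 < \<theta>" "\<theta> < pi / real m"
  shows "odd_symmetric_ext m f \<theta> = f \<theta>"
proof -
  have m: "real m > 0" using assms by (cases "m = 0") auto
  have "round (\<theta> / (2 * pi / real m)) = 0"
    using assms m by (intro round_unique') (auto simp: field_simps)
  then show ?thesis using assms by (simp add: odd_symmetric_ext_def)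
qed

lemma odd_symmetric_ext:
  assumes "m > 0"
  shows "odd_symmetric m (odd_symmetric_ext m f)"
proof -
  define p where "p = 2 * pi / real m"
  have p: "p > 0" and pm: "pi / real m = p / 2" using assms by (auto simp: p_def)
  define r where "r \<theta> = \<theta> - p * of_int (round (\<theta> / p))" for \<theta>
  have E: "odd_symmetric_ext m f \<theta> = (if 0 < r \<theta> \<and> r \<theta> < p / 2 then f (r \<theta>)
      else if - (p / 2) < r \<theta> \<and> r \<theta> < 0 then - f (- r \<theta>) else 0)" for \<theta>
    by (simp add: odd_symmetric_ext_def Let_def r_def p_def)
  have per: "r (\<theta> + p) = r \<theta>" for \<theta>
  proof -
    have "round ((\<theta> + p) / p) = round (\<theta> / p) + 1"
    proof -
      have "(\<theta> + p) / p + 1 / 2 = \<theta> / p + 1 / 2 + 1" using p by (simp add: field_simps)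
      then show ?thesis unfolding round_def by (simp only: one_add_floor)
    qed
    then show ?thesis by (simp add: r_def algebra_simps)
  qed
  have bnd: "- (p / 2) \<le> r \<theta> \<and> r \<theta> < p / 2" for \<theta>
  proof -
    have "of_int (round (\<theta> / p)) \<le> \<theta> / p + 1 / 2" "\<theta> / p - 1 / 2 < of_int (round (\<theta> / p))"
      unfolding round_def by linarith+
    then show ?thesis using p by (auto simp: r_def field_simps)
  qed
  have odd: "r (- \<theta>) = - r \<theta> \<or> (r (- \<theta>) = - (p / 2) \<and> r \<theta> = - (p / 2))" for \<theta>
  proof (cases "r \<theta> = - (p / 2)")
    case True
    then have "\<theta> / p = of_int (round (\<theta> / p)) - 1 / 2"
      using p by (simp add: r_def field_simps)
    then have "- \<theta> / p + 1 / 2 = of_int (1 - round (\<theta> / p))" by simp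
    then have "round (- \<theta> / p) = 1 - round (\<theta> / p)"
      unfolding round_def by (metis floor_of_int)
    then have "r (- \<theta>) = - r \<theta> - p"
      unfolding r_def by (simp only: of_int_diff of_int_1 right_diff_distrib mult_1_right)
    then show ?thesis using True by simp
  next
    case False
    then have lt: "- (p / 2) < r \<theta>" "r \<theta> < p / 2" using bnd[of \<theta>] by auto
    have "\<theta> / p = r \<theta> / p + of_int (round (\<theta> / p))" using p by (simp add: r_def field_simps)
    moreover have "\<bar>r \<theta> / p\<bar> < 1 / 2" using lt p by (auto simp: abs_less_iff field_simps)
    ultimately have "\<bar>- \<theta> / p - of_int (- round (\<theta> / p))\<bar> < 1 / 2"
      unfolding minus_divide_left[symmetric] of_int_minus by linarith
    then have "round (- \<theta> / p) = - round (\<theta> / p)"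
      by (rule round_unique')
    then show ?thesis by (simp add: r_def)
  qed
  show ?thesis
    unfolding odd_symmetric_def p_def[symmetric]
  proof (intro conjI allI)
    fix x
    show "odd_symmetric_ext m f (- x) = - odd_symmetric_ext m f x"
      using odd[of x] p unfolding E by auto
    show "odd_symmetric_ext m f (x + p) = odd_symmetric_ext m f x"
      unfolding E per ..
  qed
qed

end

theory Submission
  imports Defs
begin

text \<open>
  Put \<open>L = pi / m\<close>. By oddness and periodicity the equation lives on \<open>[0, L]\<close>, with \<open>G\<close> vanishing at both
  ends, and \<open>2 L < pi\<close> makes the Green function of \<open>- (4 + d\<^sup>2)\<close> on this interval nonnegative. If
  \<open>\<Phi> t\<close> denotes the flow, the vorticity is \<open>g t (\<Phi> t z) = - (z powr (- \<alpha>))\<close>, so that the flow determines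
  \<open>g t\<close>. Writing \<open>z powr (- \<alpha>)\<close> as a superposition of indicator functions (\<open>stream_eq_stream_of\<close>)
  expresses \<open>G t\<close> through \<open>\<Phi> t\<close> itself, without inverting or differentiating the flow, and the
  problem becomes an autonomous ordinary differential equation for \<open>\<Phi>\<close>.

  Its right-hand side is locally Lipschitz for the weighted norm \<open>sup \<bar>\<Phi> z\<bar> / z\<close>
  (\<open>cut_field_lipschitz\<close>): the density \<open>\<alpha> * z powr (- \<alpha> - 1)\<close> of the superposition is integrable against
  \<open>z\<close> because \<open>\<alpha> < 1\<close>. This yields uniqueness, local existence, and continuation as long as the
  weighted norm stays bounded. The vorticity is negative on \<open>(0, L)\<close>, so \<open>G\<close> is nonnegative there and
  points move away from \<open>0\<close> as time increases. Backward in time therefore \<open>\<Phi> t z \<le> z\<close>, and the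
  solution exists for all negative times (\<open>lagrangian_backward\<close>).

  Forward in time the mechanism is self-reinforcing. If every point has been pushed by \<open>\<kappa>\<close> in the
  coordinate \<open>ln (x / (L - x))\<close>, then vorticity of size \<open>exp (\<alpha> * \<kappa>)\<close> has reached the bulk of the
  sector, and the Green function gives \<open>G x \<ge> c * exp (\<alpha> * \<kappa>) * x * (L - x)\<close> (\<open>stream_of_lower\<close>), so that
  one more unit of push takes time at most proportional to \<open>exp (- \<alpha> * \<kappa>)\<close>. These times are summable, so
  no solution survives beyond a finite time (\<open>lagrangian_blow_up\<close>). The maximal interval is open on
  the right by the continuation criterion. Finally \<open>solution_lagrangian\<close> and \<open>lagrangian_solution\<close>
  translate between solutions in the sense of \<open>is_solution\<close> and flows.
\<close>

section \<open>Differential inequalities and Lipschitz equations\<close>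

text \<open>
  The segment \<open>closed_segment 0 t\<close> treats forward and backward estimates at once, for either sign of \<open>t\<close>.
\<close>
lemma increment_le_majorant:
  fixes f :: "real \<Rightarrow> 'a::real_normed_vector"
  assumes f: "\<And>s. s \<in> closed_segment 0 t \<Longrightarrow>
      (f has_vector_derivative f' s) (at s within closed_segment 0 t)"
    and \<phi>: "\<And>r. (\<phi> has_real_derivative \<phi>' r) (at r)"
    and bound: "\<And>s. s \<in> closed_segment 0 t \<Longrightarrow> norm (f' s) \<le> \<phi>' \<bar>s\<bar>"
  shows "norm (f t - f 0) \<le> \<phi> \<bar>t\<bar> - \<phi> 0"
proof (cases "t = 0")
  case False
  define \<sigma> where "\<sigma> = sgn t"
  have \<sigma>: "\<bar>\<sigma>\<bar> = 1" "\<sigma> * \<bar>t\<bar> = t" using False by (auto simp: \<sigma>_def sgn_real_def)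
  have seg: "\<sigma> * r \<in> closed_segment 0 t" if "r \<in> {0..\<bar>t\<bar>}" for r
    using that by (auto simp: \<sigma>_def sgn_real_def closed_segment_eq_real_ivl)
  define g where "g r = f (\<sigma> * r)" for r
  have g: "(g has_vector_derivative \<sigma> *\<^sub>R f' (\<sigma> * r)) (at r within {0..\<bar>t\<bar>})" if "r \<in> {0..\<bar>t\<bar>}" for r
  proof -
    have "((*) \<sigma> has_vector_derivative \<sigma>) (at r within {0..\<bar>t\<bar>})"
      by (auto intro!: derivative_eq_intros)
    moreover have "(f has_vector_derivative f' (\<sigma> * r)) (at (\<sigma> * r) within (*) \<sigma> ` {0..\<bar>t\<bar>})"
      using f[OF seg[OF that]] by (rule has_vector_derivative_within_subset) (use seg in auto)
    ultimately have "(f \<circ> (*) \<sigma> has_vector_derivative \<sigma> *\<^sub>R f' (\<sigma> * r)) (at r within {0..\<bar>t\<bar>})"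
      by (rule vector_diff_chain_within)
    then show ?thesis by (simp add: g_def[abs_def] o_def)
  qed
  have "norm (g \<bar>t\<bar> - g 0) \<le> \<phi> \<bar>t\<bar> - \<phi> 0"
  proof (rule differentiable_bound_general[where f' = "\<lambda>r. \<sigma> *\<^sub>R f' (\<sigma> * r)" and \<phi>' = \<phi>'])
    show "0 < \<bar>t\<bar>" using False by simp
    show "continuous_on {0..\<bar>t\<bar>} g"
      unfolding continuous_on_eq_continuous_within using g has_vector_derivative_continuous by blast
    show "continuous_on {0..\<bar>t\<bar>} \<phi>"
      using \<phi> by (meson DERIV_isCont continuous_at_imp_continuous_on)
    fix r assume r: "0 < r" "r < \<bar>t\<bar>"
    then show "(g has_vector_derivative \<sigma> *\<^sub>R f' (\<sigma> * r)) (at r)"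
      using g[of r] by (simp add: at_within_Icc_at)
    show "(\<phi> has_vector_derivative \<phi>' r) (at r)"
      using \<phi> by (simp add: has_real_derivative_iff_has_vector_derivative)
    have "\<bar>\<sigma> * r\<bar> = r" using r \<sigma> by (simp add: abs_mult)
    then show "norm (\<sigma> *\<^sub>R f' (\<sigma> * r)) \<le> \<phi>' r"
      using bound[OF seg[of r]] r \<sigma> by simp
  qed
  then show ?thesis by (simp add: g_def \<sigma>)
qed simp

lemma closed_segment_0_subset:
  fixes s t :: real
  assumes "s \<in> closed_segment 0 t"
  shows "closed_segment 0 s \<subseteq> closed_segment 0 t"
  using assms by (auto simp: closed_segment_eq_real_ivl split: if_splits)

lemma closed_segment_0_subset_interval:
  fixes t :: real
  assumes "is_interval J" "0 \<in> J" "t \<in> J"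
  shows "closed_segment 0 t \<subseteq> J"
  using assms by (simp add: closed_segment_subset is_interval_convex)

text \<open>
  Iterating the hypothesis turns a uniform bound \<open>B\<close> into \<open>B (C \<bar>s\<bar>)^n / n!\<close> for every \<open>n\<close>.
  Unlike a Gronwall argument for the supremum over the family, this asks for no regularity of that
  supremum in time.
\<close>
lemma vanishing_family:
  fixes d :: "real \<Rightarrow> 'i \<Rightarrow> real"
  assumes deriv: "\<And>s i. s \<in> closed_segment 0 t \<Longrightarrow> i \<in> A \<Longrightarrow>
      ((\<lambda>r. d r i) has_real_derivative d' s i) (at s within closed_segment 0 t)"
    and init: "\<And>i. i \<in> A \<Longrightarrow> d 0 i = 0"
    and bounded: "\<And>s i. s \<in> closed_segment 0 t \<Longrightarrow> i \<in> A \<Longrightarrow> \<bar>d s i\<bar> \<le> B"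
    and lip: "\<And>s i b. s \<in> closed_segment 0 t \<Longrightarrow> i \<in> A \<Longrightarrow> (\<And>j. j \<in> A \<Longrightarrow> \<bar>d s j\<bar> \<le> b) \<Longrightarrow>
      \<bar>d' s i\<bar> \<le> C * b"
    and s: "s \<in> closed_segment 0 t" and i: "i \<in> A"
  shows "d s i = 0"
proof -
  have iter: "\<bar>d s i\<bar> \<le> B * (C * \<bar>s\<bar>) ^ n / fact n" if "s \<in> closed_segment 0 t" "i \<in> A" for n s i
    using that
  proof (induction n arbitrary: s i)
    case 0
    then show ?case using bounded by simp
  next
    case (Suc n)
    define \<phi> where "\<phi> r = B * C ^ Suc n * r ^ Suc n / fact (Suc n)" for r
    have sub: "closed_segment 0 s \<subseteq> closed_segment 0 t"
      using Suc.prems by (intro closed_segment_0_subset)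
    have "norm (d s i - d 0 i) \<le> \<phi> \<bar>s\<bar> - \<phi> 0"
    proof (rule increment_le_majorant)
      fix r assume r: "r \<in> closed_segment 0 s"
      show "((\<lambda>r. d r i) has_vector_derivative d' r i) (at r within closed_segment 0 s)"
        using deriv[of r i] r sub Suc.prems
        by (auto simp: has_real_derivative_iff_has_vector_derivative
            intro: has_vector_derivative_within_subset)
      have "\<bar>d' r i\<bar> \<le> C * (B * (C * \<bar>r\<bar>) ^ n / fact n)"
        using r sub Suc by (intro lip) auto
      then show "norm (d' r i) \<le> B * C ^ Suc n * \<bar>r\<bar> ^ n / fact n"
        by (simp add: power_mult_distrib mult_ac)
    next
      fix r
      have "(\<phi> has_real_derivative B * C ^ Suc n * (real (Suc n) * r ^ n) / fact (Suc n)) (at r)"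
        unfolding \<phi>_def[abs_def] by (auto intro!: derivative_eq_intros simp del: power_Suc fact_Suc)
      then show "(\<phi> has_real_derivative B * C ^ Suc n * r ^ n / fact n) (at r)"
        by (rule back_subst[where P = "\<lambda>D. (\<phi> has_real_derivative D) (at r)"])
          (simp add: fact_Suc del: of_nat_Suc power_Suc)
    qed
    then show ?case
      using init[OF Suc.prems(2)] by (simp add: \<phi>_def power_mult_distrib mult_ac)
  qed
  have "(\<lambda>n. B * ((C * \<bar>s\<bar>) ^ n /\<^sub>R fact n)) \<longlonglongrightarrow> B * 0"
    by (intro tendsto_mult_left summable_LIMSEQ_zero summable_exp_generic)
  then have "(\<lambda>n. B * (C * \<bar>s\<bar>) ^ n / fact n) \<longlonglongrightarrow> 0"
    by (simp add: field_simps)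
  then have "\<bar>d s i\<bar> \<le> 0"
    using iter[OF s i] by (intro LIMSEQ_le_const) auto
  then show ?thesis by simp
qed

text \<open>
  Along the segment \<open>w\<^sup>2 exp (2 C \<bar>s\<bar>)\<close> increases and \<open>w\<^sup>2 exp (- 2 C \<bar>s\<bar>)\<close> decreases. Hence \<open>w\<close> cannot
  change sign, and the bounds on \<open>w\<^sup>2\<close> pass to \<open>w\<close>.
\<close>
lemma gronwall_two_sided:
  fixes w :: "real \<Rightarrow> real"
  assumes deriv: "\<And>s. s \<in> closed_segment 0 t \<Longrightarrow>
      (w has_real_derivative w' s) (at s within closed_segment 0 t)"
    and lip: "\<And>s. s \<in> closed_segment 0 t \<Longrightarrow> \<bar>w' s\<bar> \<le> C * \<bar>w s\<bar>"
    and nonneg0: "0 \<le> w 0"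
  shows "w t \<le> exp (C * \<bar>t\<bar>) * w 0" "w 0 \<le> exp (C * \<bar>t\<bar>) * w t"
proof -
  define \<sigma> where "\<sigma> = sgn t"
  have seg: "\<sigma> * r \<in> closed_segment 0 t" if "r \<in> {0..\<bar>t\<bar>}" for r
    using that by (auto simp: \<sigma>_def sgn_real_def closed_segment_eq_real_ivl)
  define v where "v r = w (\<sigma> * r)" for r
  have v: "(v has_real_derivative w' (\<sigma> * r) * \<sigma>) (at r within {0..\<bar>t\<bar>})" if "r \<in> {0..\<bar>t\<bar>}" for r
  proof -
    have "((*) \<sigma> has_real_derivative \<sigma>) (at r within {0..\<bar>t\<bar>})"
      by (auto intro!: derivative_eq_intros)
    moreover have "(w has_real_derivative w' (\<sigma> * r)) (at (\<sigma> * r) within (*) \<sigma> ` {0..\<bar>t\<bar>})"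
      using deriv[OF seg[OF that]] by (rule DERIV_subset) (use seg in auto)
    ultimately have "(w \<circ> (*) \<sigma> has_real_derivative w' (\<sigma> * r) * \<sigma>) (at r within {0..\<bar>t\<bar>})"
      by (metis DERIV_image_chain)
    then show ?thesis by (simp add: v_def[abs_def] o_def)
  qed
  have lipv: "\<bar>w' (\<sigma> * r) * \<sigma>\<bar> \<le> C * \<bar>v r\<bar>" if "r \<in> {0..\<bar>t\<bar>}" for r
  proof -
    have "\<bar>w' (\<sigma> * r) * \<sigma>\<bar> \<le> \<bar>w' (\<sigma> * r)\<bar>"
      by (auto simp: \<sigma>_def sgn_real_def abs_mult)
    then show ?thesis using lip[OF seg[OF that]] by (simp add: v_def)
  qed
  have sq: "\<bar>2 * v r * (w' (\<sigma> * r) * \<sigma>)\<bar> \<le> 2 * C * (v r)\<^sup>2" if "r \<in> {0..\<bar>t\<bar>}" for r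
  proof -
    have "\<bar>v r\<bar> * \<bar>w' (\<sigma> * r) * \<sigma>\<bar> \<le> \<bar>v r\<bar> * (C * \<bar>v r\<bar>)"
      using lipv[OF that] by (intro mult_left_mono) auto
    also have "\<dots> = C * (v r)\<^sup>2" by (simp add: power2_eq_square)
    finally show ?thesis by (simp add: abs_mult)
  qed
  have contv: "continuous_on {0..\<bar>t\<bar>} v"
    unfolding continuous_on_eq_continuous_within using v DERIV_continuous by blast
  have mono_gen: "(v 0)\<^sup>2 \<le> exp (2 * C * r) * (v r)\<^sup>2 \<and> (v r)\<^sup>2 \<le> exp (2 * C * r) * (v 0)\<^sup>2"
    if r: "r \<in> {0..\<bar>t\<bar>}" for r
  proof -
    have sub: "x \<in> {0..\<bar>t\<bar>}" if "x \<in> {0..r}" for x using that r by auto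
    have d1: "((\<lambda>x. exp (k * x) * (v x)\<^sup>2) has_real_derivative
        exp (k * x) * (k * (v x)\<^sup>2 + 2 * v x * (w' (\<sigma> * x) * \<sigma>))) (at x within {0..r})"
      if "x \<in> {0..r}" for k x
    proof -
      have "(v has_real_derivative w' (\<sigma> * x) * \<sigma>) (at x within {0..r})"
        using v[OF sub[OF that]] by (rule DERIV_subset) (use r in auto)
      then show ?thesis
        by (auto intro!: derivative_eq_intros simp: algebra_simps power2_eq_square)
    qed
    have "exp (2 * C * 0) * (v 0)\<^sup>2 \<le> exp (2 * C * r) * (v r)\<^sup>2"
    proof (rule DERIV_nonneg_imp_increasing_open[of 0 r])
      show "0 \<le> r" using r by simp
      show "continuous_on {0..r} (\<lambda>x. exp (2 * C * x) * (v x)\<^sup>2)"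
        by (intro continuous_intros continuous_on_subset[OF contv]) (use r in auto)
      fix x assume x: "0 < x" "x < r"
      have "0 \<le> exp (2 * C * x) * (2 * C * (v x)\<^sup>2 + 2 * v x * (w' (\<sigma> * x) * \<sigma>))"
        using sq[of x] x r by (intro mult_nonneg_nonneg) auto
      then show "\<exists>y. ((\<lambda>x. exp (2 * C * x) * (v x)\<^sup>2) has_real_derivative y) (at x) \<and> 0 \<le> y"
        using d1[of x "2 * C"] x by (auto simp: at_within_Icc_at)
    qed
    moreover have "exp (- (2 * C) * r) * (v r)\<^sup>2 \<le> exp (- (2 * C) * 0) * (v 0)\<^sup>2"
    proof (rule DERIV_nonpos_imp_decreasing_open[of 0 r])
      show "0 \<le> r" using r by simp
      show "continuous_on {0..r} (\<lambda>x. exp (- (2 * C) * x) * (v x)\<^sup>2)"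
        by (intro continuous_intros continuous_on_subset[OF contv]) (use r in auto)
      fix x assume x: "0 < x" "x < r"
      have "exp (- (2 * C) * x) * (- (2 * C) * (v x)\<^sup>2 + 2 * v x * (w' (\<sigma> * x) * \<sigma>)) \<le> 0"
        using sq[of x] x r by (intro mult_nonneg_nonpos) auto
      then show "\<exists>y. ((\<lambda>x. exp (- (2 * C) * x) * (v x)\<^sup>2) has_real_derivative y) (at x) \<and> y \<le> 0"
        using d1[of x "- (2 * C)"] x by (auto simp: at_within_Icc_at)
    qed
    ultimately show ?thesis by (simp add: exp_minus field_simps)
  qed
  have v0: "v 0 = w 0" "v \<bar>t\<bar> = w t" by (auto simp: v_def \<sigma>_def sgn_real_def)
  have nonneg: "0 \<le> w t"
  proof (rule ccontr)
    assume "\<not> 0 \<le> w t"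
    then have neg: "v \<bar>t\<bar> < 0" by (simp add: v0)
    then obtain r where r: "0 \<le> r" "r \<le> \<bar>t\<bar>" "v r = 0"
      using IVT2'[of v "\<bar>t\<bar>" 0 0] contv nonneg0 v0 by auto
    then have "(v 0)\<^sup>2 \<le> 0" using mono_gen[of r] by auto
    then have "v 0 = 0" by simp
    then show False using mono_gen[of "\<bar>t\<bar>"] neg by auto
  qed
  have root: "a \<le> exp (C * \<bar>t\<bar>) * b" if "a\<^sup>2 \<le> exp (2 * C * \<bar>t\<bar>) * b\<^sup>2" "0 \<le> b" for a b
  proof (rule power2_le_imp_le)
    have "exp (2 * C * \<bar>t\<bar>) = (exp (C * \<bar>t\<bar>))\<^sup>2" by (simp add: exp_double[symmetric] mult_ac)
    then show "a\<^sup>2 \<le> (exp (C * \<bar>t\<bar>) * b)\<^sup>2" using that by (simp add: power_mult_distrib)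
  qed (use that in auto)
  show "w t \<le> exp (C * \<bar>t\<bar>) * w 0" "w 0 \<le> exp (C * \<bar>t\<bar>) * w t"
    using mono_gen[of "\<bar>t\<bar>"] nonneg nonneg0 by (auto intro!: root simp: v0)
qed

lemma gronwall_zero:
  fixes w :: "real \<Rightarrow> real"
  assumes "\<And>s. s \<in> closed_segment 0 t \<Longrightarrow> (w has_real_derivative w' s) (at s within closed_segment 0 t)"
    and "\<And>s. s \<in> closed_segment 0 t \<Longrightarrow> \<bar>w' s\<bar> \<le> C * \<bar>w s\<bar>" and "w 0 = 0"
  shows "w t = 0"
proof -
  have "0 \<le> w 0" using assms(3) by simp
  from gronwall_two_sided[OF assms(1,2) this] have "w t \<le> 0" "0 \<le> exp (C * \<bar>t\<bar>) * w t"
    using assms(3) by auto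
  then show ?thesis by (simp add: zero_le_mult_iff)
qed

lemma antiderivative_exists:
  fixes f :: "real \<Rightarrow> 'a::banach"
  assumes "continuous_on UNIV f"
  shows "\<exists>P. P 0 = 0 \<and> (\<forall>t. (P has_vector_derivative f t) (at t))"
proof -
  let ?P = "\<lambda>t. integral {0..t} f - integral {t..0} f"
  have "(?P has_vector_derivative f t) (at t)" for t
  proof -
    define a b where "a = - \<bar>t\<bar> - 1" and "b = \<bar>t\<bar> + 1"
    have int: "f integrable_on {x..y}" for x y
      by (intro integrable_continuous_real continuous_on_subset[OF assms]) auto
    have "((\<lambda>x. integral {a..x} f) has_vector_derivative f t) (at t within {a..b})"
      by (intro integral_has_vector_derivative continuous_on_subset[OF assms]) (auto simp: a_def b_def)
    then have anti: "((\<lambda>x. integral {a..x} f - integral {a..0} f) has_vector_derivative f t) (at t)"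
      by (subst (asm) at_within_Icc_at) (auto simp: a_def b_def intro!: derivative_eq_intros)
    have eq: "integral {a..x} f - integral {a..0} f = ?P x" if x: "x \<in> {a<..<b}" for x
    proof (cases "0 \<le> x")
      case True
      have "integral {a..0} f + integral {0..x} f = integral {a..x} f"
        using True x by (intro Henstock_Kurzweil_Integration.integral_combine int) (auto simp: a_def)
      moreover have "integral {x..0} f = 0" using True by (cases "x = 0") auto
      ultimately show ?thesis by (simp add: algebra_simps)
    next
      case False
      have "integral {a..x} f + integral {x..0} f = integral {a..0} f"
        using False x by (intro Henstock_Kurzweil_Integration.integral_combine int) (auto simp: a_def)
      then show ?thesis using False by (simp add: algebra_simps)
    qed
    have "t \<in> {a<..<b}" by (auto simp: a_def b_def)
    then show ?thesis
      by (rule has_vector_derivative_transform_within_open[OF anti open_greaterThanLessThan _ eq])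
  qed
  then show ?thesis by (intro exI[of _ ?P]) simp
qed

text \<open>
  A weight \<open>exp (- \<mu> \<bar>t\<bar>)\<close> with \<open>\<mu>\<close> at least twice the Lipschitz constant makes the Picard operator a
  contraction on the whole line at once, so that short-time solutions need not be glued.
\<close>
theorem lipschitz_ode_solution_exists:
  fixes V :: "'a::banach \<Rightarrow> 'a"
  assumes lip: "\<And>x y. norm (V x - V y) \<le> K * norm (x - y)"
  shows "\<exists>y. y 0 = x0 \<and> (\<forall>t. (y has_vector_derivative V (y t)) (at t))"
proof -
  define \<mu> where "\<mu> = 2 * (\<bar>K\<bar> + 1)"
  have lam: "0 < \<mu>" and K\<mu>: "\<bar>K\<bar> / \<mu> \<le> 1/2" by (auto simp: \<mu>_def field_simps)
  have lip': "norm (V x - V y) \<le> \<bar>K\<bar> * norm (x - y)" for x y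
    by (rule order_trans[OF lip]) (auto intro: mult_right_mono)
  have contV: "continuous_on UNIV V"
  proof -
    have "\<bar>K\<bar>-lipschitz_on UNIV V"
      using lip' by (auto simp: lipschitz_on_def dist_norm)
    then show ?thesis by (rule lipschitz_on_continuous_on)
  qed
  define Y where "Y w t = x0 + exp (\<mu> * \<bar>t\<bar>) *\<^sub>R apply_bcontfun w t" for w :: "real \<Rightarrow>\<^sub>C 'a" and t
  have contY: "continuous_on UNIV (\<lambda>t. V (Y w t))" for w
    unfolding Y_def
    by (intro continuous_on_compose2[OF contV] continuous_intros) auto
  obtain P where P0: "\<And>w. P w 0 = 0"
    and P: "\<And>w t. (P w has_vector_derivative V (Y w t)) (at t)"
    using antiderivative_exists[OF contY] by metis
  have contP: "continuous_on UNIV (P w)" for w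
    using P by (meson continuous_at_imp_continuous_on has_vector_derivative_continuous)
  have major: "norm (f t) \<le> B / \<mu> * exp (\<mu> * \<bar>t\<bar>)"
    if "f 0 = 0" "\<And>s. (f has_vector_derivative f' s) (at s)"
      "\<And>s. norm (f' s) \<le> B * exp (\<mu> * \<bar>s\<bar>)" "0 \<le> B" for f f' :: "real \<Rightarrow> 'a" and B t
  proof -
    have "norm (f t - f 0) \<le> B / \<mu> * exp (\<mu> * \<bar>t\<bar>) - B / \<mu> * exp (\<mu> * 0)"
    proof (rule increment_le_majorant)
      fix r
      show "((\<lambda>r. B / \<mu> * exp (\<mu> * r)) has_real_derivative B * exp (\<mu> * r)) (at r)"
        using lam by (auto intro!: derivative_eq_intros)
    qed (use that in \<open>auto intro: has_vector_derivative_at_within\<close>)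
    then have "norm (f t) \<le> B / \<mu> * exp (\<mu> * \<bar>t\<bar>) - B / \<mu>" using that by simp
    moreover have "0 \<le> B / \<mu>" using that lam by simp
    ultimately show ?thesis by linarith
  qed
  have P_bound: "norm (P w t) \<le> (norm (V x0) + \<bar>K\<bar> * norm w) / \<mu> * exp (\<mu> * \<bar>t\<bar>)" for w t
  proof (rule major[OF P0 P])
    fix s
    have "norm (V (Y w s)) \<le> norm (V x0) + norm (V (Y w s) - V x0)"
      by (metis add.commute diff_add_cancel norm_triangle_ineq)
    also have "\<dots> \<le> norm (V x0) + \<bar>K\<bar> * (exp (\<mu> * \<bar>s\<bar>) * norm w)"
    proof -
      have "norm (V (Y w s) - V x0) \<le> \<bar>K\<bar> * norm (Y w s - x0)" by (rule lip')
      also have "norm (Y w s - x0) \<le> exp (\<mu> * \<bar>s\<bar>) * norm w"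
        by (simp add: Y_def norm_bounded)
      finally show ?thesis by (simp add: mult_left_mono)
    qed
    also have "\<dots> \<le> (norm (V x0) + \<bar>K\<bar> * norm w) * exp (\<mu> * \<bar>s\<bar>)"
    proof -
      have "1 \<le> exp (\<mu> * \<bar>s\<bar>)" using lam by simp
      then have "norm (V x0) * 1 \<le> norm (V x0) * exp (\<mu> * \<bar>s\<bar>)"
        by (rule mult_left_mono) simp
      then show ?thesis by (simp add: algebra_simps)
    qed
    finally show "norm (V (Y w s)) \<le> (norm (V x0) + \<bar>K\<bar> * norm w) * exp (\<mu> * \<bar>s\<bar>)" .
  qed simp
  define S where "S w = Bcontfun (\<lambda>t. exp (- \<mu> * \<bar>t\<bar>) *\<^sub>R P w t)" for w
  have S: "apply_bcontfun (S w) t = exp (- \<mu> * \<bar>t\<bar>) *\<^sub>R P w t" for w t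
  proof -
    have "(\<lambda>t. exp (- \<mu> * \<bar>t\<bar>) *\<^sub>R P w t) \<in> bcontfun"
    proof (rule bcontfun_normI)
      show "continuous_on UNIV (\<lambda>t. exp (- \<mu> * \<bar>t\<bar>) *\<^sub>R P w t)"
        by (intro continuous_intros contP)
      fix t
      show "norm (exp (- \<mu> * \<bar>t\<bar>) *\<^sub>R P w t) \<le> (norm (V x0) + \<bar>K\<bar> * norm w) / \<mu>"
        using P_bound[of w t] by (simp add: exp_minus field_simps)
    qed
    then show ?thesis by (simp add: S_def Bcontfun_inverse)
  qed
  have contr: "dist (S w) (S w') \<le> 1/2 * dist w w'" for w w'
  proof -
    have D: "norm (P w t - P w' t) \<le> \<bar>K\<bar> * norm (w - w') / \<mu> * exp (\<mu> * \<bar>t\<bar>)" for t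
    proof (rule major[where f = "\<lambda>t. P w t - P w' t" and f' = "\<lambda>t. V (Y w t) - V (Y w' t)"])
      fix s
      show "((\<lambda>t. P w t - P w' t) has_vector_derivative V (Y w s) - V (Y w' s)) (at s)"
        by (intro derivative_intros P)
      have "norm (V (Y w s) - V (Y w' s)) \<le> \<bar>K\<bar> * norm (Y w s - Y w' s)" by (rule lip')
      also have "Y w s - Y w' s = exp (\<mu> * \<bar>s\<bar>) *\<^sub>R apply_bcontfun (w - w') s"
        by (simp add: Y_def algebra_simps)
      also have "\<bar>K\<bar> * norm \<dots> \<le> \<bar>K\<bar> * (exp (\<mu> * \<bar>s\<bar>) * norm (w - w'))"
        using norm_bounded[of "w - w'" s] by (intro mult_left_mono) simp_all
      finally show "norm (V (Y w s) - V (Y w' s)) \<le> \<bar>K\<bar> * norm (w - w') * exp (\<mu> * \<bar>s\<bar>)"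
        by (simp add: mult_ac)
    qed (auto simp: P0)
    have "norm (S w - S w') \<le> \<bar>K\<bar> / \<mu> * norm (w - w')"
    proof (rule norm_bound)
      fix t
      have "apply_bcontfun (S w - S w') t = exp (- \<mu> * \<bar>t\<bar>) *\<^sub>R (P w t - P w' t)"
        by (simp add: S algebra_simps)
      then have "norm (apply_bcontfun (S w - S w') t) = exp (- \<mu> * \<bar>t\<bar>) * norm (P w t - P w' t)"
        by simp
      also have "\<dots> \<le> exp (- \<mu> * \<bar>t\<bar>) * (\<bar>K\<bar> * norm (w - w') / \<mu> * exp (\<mu> * \<bar>t\<bar>))"
        by (intro mult_left_mono D) simp
      also have "\<dots> = \<bar>K\<bar> / \<mu> * norm (w - w')" by (simp add: exp_minus)
      finally show "norm (apply_bcontfun (S w - S w') t) \<le> \<bar>K\<bar> / \<mu> * norm (w - w')" .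
    qed
    also have "\<dots> \<le> 1/2 * norm (w - w')" using K\<mu> by (rule mult_right_mono) simp
    finally show ?thesis by (simp add: dist_norm)
  qed
  obtain w where w: "S w = w"
    using banach_fix_type[of "1/2" S] contr by auto
  have YP: "Y w t = x0 + P w t" for t
  proof -
    have "exp (\<mu> * \<bar>t\<bar>) *\<^sub>R apply_bcontfun (S w) t = P w t"
      unfolding S by (simp add: exp_minus)
    then show ?thesis by (simp add: Y_def w)
  qed
  have "(Y w has_vector_derivative V (Y w t)) (at t)" for t
    using has_vector_derivative_add[OF has_vector_derivative_const P[of w t], of x0]
    by (simp add: YP[abs_def])
  then show ?thesis using YP P0 by (intro exI[of _ "Y w"]) simp
qed

section \<open>The Lagrangian form of the stream function\<close>

locale sector =
  fixes L \<alpha> :: real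
  assumes L_pos: "0 < L" and L_less: "L < pi / 2" and alpha_pos: "0 < \<alpha>" and alpha_less: "\<alpha> < 1"
begin

definition \<sigma> :: real where "\<sigma> = sin (2 * L)"

text \<open>
  The Green function of \<open>- (4 + d\<^sup>2)\<close> on \<open>[0, L]\<close> with zero boundary values.
\<close>
definition green :: "real \<Rightarrow> real \<Rightarrow> real" where
  "green x y = sin (2 * min x y) * sin (2 * (L - max x y)) / (2 * \<sigma>)"

text \<open>
  The stream function, at \<open>x\<close>, of the vorticity that equals \<open>- 1\<close> on \<open>[0, c]\<close> and vanishes on the rest of
  the sector.
\<close>
definition green_mass :: "real \<Rightarrow> real \<Rightarrow> real" where
  "green_mass x c = integral {0..c} (green x)"

text \<open>
  The density for which \<open>z powr (- \<alpha>)\<close> equals \<open>L powr (- \<alpha>)\<close> plus the integral of \<open>wt\<close> over \<open>[z, L]\<close>.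
\<close>
definition wt :: "real \<Rightarrow> real" where "wt z = \<alpha> * z powr (- \<alpha> - 1)"

text \<open>
  The stream function at the time when the flow map is \<open>F\<close>: the level set \<open>{\<zeta>. \<zeta> < z}\<close> of the initial
  datum has been carried to \<open>[0, F z)\<close>, and \<open>wt\<close> superposes these levels.
\<close>
definition stream_of :: "(real \<Rightarrow> real) \<Rightarrow> real \<Rightarrow> real" where
  "stream_of F x = L powr (- \<alpha>) * green_mass x L + integral {0..L} (\<lambda>z. wt z * green_mass x (F z))"

lemma sigma_pos: "0 < \<sigma>"
  unfolding \<sigma>_def using L_pos L_less by (intro sin_gt_zero) auto

lemma sin_double_bounds:
  assumes "0 \<le> w" "w \<le> L"
  shows "0 \<le> sin (2 * w)" "sin (2 * w) \<le> 2 * w" "sin (2 * w) \<le> 1"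
  using assms L_less by (auto intro!: sin_ge_zero sin_x_le_x)

text \<open>
  The sine is concave on \<open>[0, 2 L]\<close>, so it lies above its chord.
\<close>
lemma sin_double_lower:
  assumes "0 \<le> w" "w \<le> L"
  shows "w / L * \<sigma> \<le> sin (2 * w)"
proof -
  have convex: "convex_on {0..2 * L} (\<lambda>x. - sin x)"
  proof (rule f''_ge0_imp_convex[where f' = "\<lambda>x. - cos x" and f'' = sin])
    show "convex {0..2 * L}" by simp
    fix x :: real assume x: "x \<in> {0..2 * L}"
    show "((\<lambda>x. - sin x) has_real_derivative - cos x) (at x)"
      "((\<lambda>x. - cos x) has_real_derivative sin x) (at x)"
      by (auto intro!: derivative_eq_intros)
    show "0 \<le> sin x" using x L_less by (intro sin_ge_zero) auto
  qed
  have "- sin ((1 - w / L) * 0 + w / L * (2 * L)) \<le> (1 - w / L) * (- sin 0) + w / L * (- sin (2 * L))"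
    using convex_onD[OF convex, of "w / L" 0 "2 * L"] assms L_pos by simp
  moreover have "w / L * (2 * L) = 2 * w" using L_pos by simp
  ultimately show ?thesis by (simp add: \<sigma>_def)
qed

lemma sin_double_lipschitz: "\<bar>sin (2 * a) - sin (2 * b)\<bar> \<le> 2 * \<bar>a - b\<bar>" for a b :: real
proof -
  have "norm (sin (2 * a) - sin (2 * b)) \<le> 1 * norm (2 * a - 2 * b)"
    by (rule field_differentiable_bound[of UNIV sin cos]) (simp_all add: DERIV_sin)
  moreover have "\<bar>2 * a - 2 * b\<bar> = 2 * \<bar>a - b\<bar>" by (auto simp: abs_if)
  ultimately show ?thesis by simp
qed

context
  fixes x y :: real
  assumes x: "x \<in> {0..L}" and y: "y \<in> {0..L}"
begin

lemma green_nonneg: "0 \<le> green x y"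
  unfolding green_def using x y sigma_pos
  by (intro divide_nonneg_pos mult_nonneg_nonneg sin_double_bounds) auto

lemma green_le: "green x y \<le> x / \<sigma>"
proof -
  have "sin (2 * min x y) * sin (2 * (L - max x y)) \<le> (2 * x) * 1"
  proof (rule mult_mono)
    have "sin (2 * min x y) \<le> 2 * min x y" using x y by (intro sin_double_bounds) auto
    then show "sin (2 * min x y) \<le> 2 * x" by simp
  qed (use x y in \<open>auto intro!: sin_double_bounds(1,3) simp del: right_diff_distrib_numeral\<close>)
  then show ?thesis using sigma_pos by (simp add: green_def field_simps)
qed

text \<open>
  Both factors lie above their chords, and \<open>min (x / L) (y / L) \<ge> (x / L) * (y / L)\<close>.
\<close>
lemma green_lower: "\<sigma> / (2 * L ^ 4) * (x * (L - x)) * (y * (L - y)) \<le> green x y"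
proof -
  have prod_le_min: "a * b / L \<le> min a b" if "a \<in> {0..L}" "b \<in> {0..L}" for a b
    using that L_pos mult_left_mono[of b L a] mult_right_mono[of a L b] by (auto simp: field_simps)
  have "(x * y / L / L * \<sigma>) * ((L - x) * (L - y) / L / L * \<sigma>)
      \<le> sin (2 * min x y) * sin (2 * (L - max x y))"
  proof (rule mult_mono)
    have "x * y / L / L * \<sigma> \<le> min x y / L * \<sigma>"
      using prod_le_min[of x y] x y L_pos sigma_pos by (intro mult_right_mono divide_right_mono) auto
    also have "\<dots> \<le> sin (2 * min x y)" using x y by (intro sin_double_lower) auto
    finally show "x * y / L / L * \<sigma> \<le> sin (2 * min x y)" .
    have "(L - x) * (L - y) / L / L * \<sigma> \<le> (L - max x y) / L * \<sigma>"
      using prod_le_min[of "L - x" "L - y"] x y L_pos sigma_pos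
      by (intro mult_right_mono divide_right_mono) (auto simp: max_def min_def split: if_splits)
    also have "\<dots> \<le> sin (2 * (L - max x y))" using x y by (intro sin_double_lower) auto
    finally show "(L - x) * (L - y) / L / L * \<sigma> \<le> sin (2 * (L - max x y))" .
  qed (use x y L_pos sigma_pos in \<open>auto intro!: sin_double_bounds\<close>)
  then have "(x * y / L / L * \<sigma>) * ((L - x) * (L - y) / L / L * \<sigma>) / (2 * \<sigma>) \<le> green x y"
    unfolding green_def using sigma_pos by (intro divide_right_mono) auto
  moreover have "(x * y / L / L * \<sigma>) * ((L - x) * (L - y) / L / L * \<sigma>) / (2 * \<sigma>)
      = \<sigma> / (2 * L ^ 4) * (x * (L - x)) * (y * (L - y))"
    using sigma_pos L_pos by (simp add: power4_eq_xxxx mult_ac)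
  ultimately show ?thesis by simp
qed

end

lemma green_lipschitz:
  assumes x: "x \<in> {0..L}" and x': "x' \<in> {0..L}" and y: "y \<in> {0..L}"
  shows "\<bar>green x y - green x' y\<bar> \<le> 2 / \<sigma> * \<bar>x - x'\<bar>"
proof -
  let ?a = "sin (2 * min x y)" and ?a' = "sin (2 * min x' y)"
  let ?b = "sin (2 * (L - max x y))" and ?b' = "sin (2 * (L - max x' y))"
  have "\<bar>?a - ?a'\<bar> \<le> 2 * \<bar>x - x'\<bar>"
    using sin_double_lipschitz[of "min x y" "min x' y"] by (auto simp: min_def split: if_splits)
  moreover have "\<bar>?b - ?b'\<bar> \<le> 2 * \<bar>x - x'\<bar>"
    using sin_double_lipschitz[of "L - max x y" "L - max x' y"] by (auto simp: max_def abs_minus_commute split: if_splits)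
  moreover have "\<bar>?a * ?b - ?a' * ?b'\<bar> \<le> \<bar>?a - ?a'\<bar> * 1 + 1 * \<bar>?b - ?b'\<bar>"
  proof -
    have "?a * ?b - ?a' * ?b' = (?a - ?a') * ?b + ?a' * (?b - ?b')" by (simp add: algebra_simps)
    also have "\<bar>\<dots>\<bar> \<le> \<bar>?a - ?a'\<bar> * \<bar>?b\<bar> + \<bar>?a'\<bar> * \<bar>?b - ?b'\<bar>"
      unfolding abs_mult[symmetric] by (rule abs_triangle_ineq)
    also have "\<dots> \<le> \<bar>?a - ?a'\<bar> * 1 + 1 * \<bar>?b - ?b'\<bar>"
      by (intro add_mono mult_mono) auto
    finally show ?thesis .
  qed
  ultimately have "\<bar>?a * ?b - ?a' * ?b'\<bar> \<le> 4 * \<bar>x - x'\<bar>" by linarith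
  then have "\<bar>?a * ?b - ?a' * ?b'\<bar> / (2 * \<sigma>) \<le> 4 * \<bar>x - x'\<bar> / (2 * \<sigma>)"
    by (rule divide_right_mono) (use sigma_pos in simp)
  moreover have "\<bar>green x y - green x' y\<bar> = \<bar>?a * ?b - ?a' * ?b'\<bar> / (2 * \<sigma>)"
    unfolding green_def diff_divide_distrib[symmetric] abs_divide using sigma_pos by simp
  ultimately show ?thesis by simp
qed

lemma green_boundary: "y \<in> {0..L} \<Longrightarrow> green 0 y = 0" "y \<in> {0..L} \<Longrightarrow> green L y = 0"
  by (auto simp: green_def min_def max_def)

lemma continuous_on_green: "continuous_on S (green x)"
  unfolding green_def[abs_def] using sigma_pos by (intro continuous_intros) auto

lemma green_integrable: "green x integrable_on {a..b}"
  by (intro integrable_continuous_real continuous_on_green)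

lemma green_mass_boundary [simp]: "green_mass x 0 = 0"
  "c \<le> L \<Longrightarrow> green_mass 0 c = 0" "c \<le> L \<Longrightarrow> green_mass L c = 0"
  unfolding green_mass_def by (auto intro!: integral_unique has_integral_is_0 green_boundary)

lemma green_mass_nonneg:
  assumes "x \<in> {0..L}" "c \<le> L"
  shows "0 \<le> green_mass x c"
  unfolding green_mass_def using assms
  by (intro Henstock_Kurzweil_Integration.integral_nonneg green_integrable green_nonneg) auto

text \<open>
  The factor \<open>x\<close> reflects that \<open>green x\<close> vanishes at \<open>x = 0\<close>; it is needed for estimates of the
  velocity relative to the distance from \<open>0\<close>.
\<close>
lemma green_mass_lipschitz_mass:
  assumes x: "x \<in> {0..L}" and c: "c \<in> {0..L}" and c': "c' \<in> {0..L}"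
  shows "\<bar>green_mass x c - green_mass x c'\<bar> \<le> x / \<sigma> * \<bar>c - c'\<bar>"
proof -
  have ord: "\<bar>green_mass x c' - green_mass x c\<bar> \<le> x / \<sigma> * (c' - c)"
    if "c \<in> {0..L}" "c' \<in> {0..L}" "c \<le> c'" for c c'
  proof -
    have "integral {0..c} (green x) + integral {c..c'} (green x) = integral {0..c'} (green x)"
      using that by (intro Henstock_Kurzweil_Integration.integral_combine green_integrable) auto
    moreover have "norm (integral {c..c'} (green x)) \<le> integral {c..c'} (\<lambda>_. x / \<sigma>)"
      using that x green_le green_nonneg
      by (intro integral_norm_bound_integral green_integrable) (auto simp: abs_of_nonneg)
    ultimately show ?thesis using that by (simp add: green_mass_def mult_ac)
  qed
  show ?thesis
    using ord[of c c'] ord[of c' c] c c' by (cases "c \<le> c'") (auto simp: abs_minus_commute)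
qed

lemma green_mass_lipschitz_point:
  assumes x: "x \<in> {0..L}" and x': "x' \<in> {0..L}" and c: "c \<in> {0..L}"
  shows "\<bar>green_mass x c - green_mass x' c\<bar> \<le> 2 / \<sigma> * c * \<bar>x - x'\<bar>"
proof -
  have "green_mass x c - green_mass x' c = integral {0..c} (\<lambda>y. green x y - green x' y)"
    unfolding green_mass_def
    by (intro Henstock_Kurzweil_Integration.integral_diff[symmetric] green_integrable)
  also have "norm \<dots> \<le> integral {0..c} (\<lambda>y. 2 / \<sigma> * \<bar>x - x'\<bar>)"
    using x x' c green_lipschitz
    by (intro integral_norm_bound_integral integrable_diff green_integrable) auto
  finally show ?thesis using c by (simp add: mult_ac)
qed

text \<open>
  Integrate \<open>green_lower\<close>: the primitive \<open>L c\<^sup>2 / 2 - c\<^sup>3 / 3\<close> is at least \<open>L c\<^sup>2 / 6\<close>.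
\<close>
lemma green_mass_lower:
  assumes x: "x \<in> {0..L}" and c: "c \<in> {0..L}"
  shows "\<sigma> / (12 * L ^ 3) * (x * (L - x)) * c\<^sup>2 \<le> green_mass x c"
proof -
  let ?K = "\<sigma> / (2 * L ^ 4) * (x * (L - x))"
  have K: "0 \<le> ?K" using x L_pos sigma_pos by auto
  have "((\<lambda>y. ?K * (y * (L - y))) has_integral
      ?K * (L * c\<^sup>2 / 2 - c ^ 3 / 3) - ?K * (L * 0\<^sup>2 / 2 - 0 ^ 3 / 3)) {0..c}"
  proof (rule fundamental_theorem_of_calculus)
    fix y :: real assume "y \<in> {0..c}"
    have "((\<lambda>c. L * c\<^sup>2 / 2 - c ^ 3 / 3) has_real_derivative L * (2 * y) / 2 - 3 * y\<^sup>2 / 3)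
        (at y within {0..c})"
      by (auto intro!: derivative_eq_intros simp: power2_eq_square)
    then have "((\<lambda>c. ?K * (L * c\<^sup>2 / 2 - c ^ 3 / 3)) has_real_derivative ?K * (L * (2 * y) / 2 - 3 * y\<^sup>2 / 3))
        (at y within {0..c})"
      by (rule DERIV_cmult)
    also have "L * (2 * y) / 2 - 3 * y\<^sup>2 / 3 = y * (L - y)"
      by (simp add: power2_eq_square algebra_simps)
    finally show "((\<lambda>c. ?K * (L * c\<^sup>2 / 2 - c ^ 3 / 3)) has_vector_derivative ?K * (y * (L - y)))
        (at y within {0..c})"
      by (simp add: has_real_derivative_iff_has_vector_derivative)
  qed (use c in auto)
  then have int: "((\<lambda>y. ?K * (y * (L - y))) has_integral ?K * (L * c\<^sup>2 / 2 - c ^ 3 / 3)) {0..c}"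
    by simp
  have "?K * (L * c\<^sup>2 / 2 - c ^ 3 / 3) \<le> green_mass x c"
    unfolding green_mass_def
    using has_integral_le[OF int integrable_integral[OF green_integrable]] green_lower[OF x] c by auto
  moreover have "?K * (L * c\<^sup>2 / 6) \<le> ?K * (L * c\<^sup>2 / 2 - c ^ 3 / 3)"
  proof (rule mult_left_mono[OF _ K])
    have "c * c\<^sup>2 \<le> L * c\<^sup>2" using c by (intro mult_right_mono) auto
    then have "c ^ 3 \<le> L * c\<^sup>2" by (simp add: power3_eq_cube power2_eq_square)
    then show "L * c\<^sup>2 / 6 \<le> L * c\<^sup>2 / 2 - c ^ 3 / 3" by simp
  qed
  moreover have "?K * (L * c\<^sup>2 / 6) = \<sigma> / (12 * L ^ 3) * (x * (L - x)) * c\<^sup>2"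
    using L_pos by (simp add: power4_eq_xxxx power3_eq_cube)
  ultimately show ?thesis by simp
qed

definition wt_moment :: real where "wt_moment = \<alpha> * (L powr (1 - \<alpha>) / (1 - \<alpha>))"

lemma wt_nonneg: "0 \<le> wt z"
  using alpha_pos by (simp add: wt_def)

lemma wt_moment_has_integral: "((\<lambda>z. wt z * z) has_integral wt_moment) {0..L}"
proof -
  have "((\<lambda>z. z powr (- \<alpha>)) has_integral L powr (- \<alpha> + 1) / (- \<alpha> + 1)) {0..L}"
    using alpha_less L_pos by (intro has_integral_powr_from_0) auto
  then have int: "((\<lambda>z. \<alpha> * z powr (- \<alpha>)) has_integral wt_moment) {0..L}"
    unfolding wt_moment_def by (intro has_integral_mult_right) (simp add: add.commute)
  have "\<alpha> * z powr (- \<alpha>) = wt z * z" if "z \<in> {0..L}" for z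
    using that by (cases "z = 0") (auto simp: wt_def powr_diff)
  then show ?thesis by (rule has_integral_eq[OF _ int])
qed

lemma wt_moment_nonneg: "0 \<le> wt_moment"
  using alpha_pos alpha_less by (simp add: wt_moment_def)

text \<open>
  As \<open>\<alpha> < 1\<close>, linear decay at \<open>0\<close> compensates the singularity \<open>z powr (- \<alpha> - 1)\<close>.
\<close>
lemma wt_integrable:
  assumes cont: "continuous_on {0<..L} f" and bound: "\<And>z. z \<in> {0<..L} \<Longrightarrow> \<bar>f z\<bar> \<le> B * z"
  shows "(\<lambda>z. wt z * f z) absolutely_integrable_on {0..L}"
    and "\<bar>integral {0..L} (\<lambda>z. wt z * f z)\<bar> \<le> B * wt_moment"
proof -
  have neg: "negligible {z. z \<in> {0..L} - {0<..L} \<and> h z \<noteq> 0}"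
    "negligible {z. z \<in> {0<..L} - {0..L} \<and> h z \<noteq> 0}" for h :: "real \<Rightarrow> real"
    by (rule negligible_subset[of "{0}"]; auto)+
  have le: "\<bar>wt z * f z\<bar> \<le> B * (wt z * z)" if "z \<in> {0<..L}" for z
    using mult_left_mono[OF bound[OF that] wt_nonneg[of z]] wt_nonneg[of z]
    by (simp add: abs_mult mult_ac)
  have le': "\<bar>wt z * f z\<bar> \<le> B * (wt z * z)" if "z \<in> {0..L}" for z
    using le[of z] that by (cases "z = 0") (auto simp: wt_def)
  have int: "(\<lambda>z. B * (wt z * z)) integrable_on {0..L}"
    using wt_moment_has_integral by (intro integrable_on_mult_right) blast
  have "(\<lambda>z. wt z * f z) absolutely_integrable_on {0<..L}"
  proof (rule measurable_bounded_by_integrable_imp_absolutely_integrable)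
    have "continuous_on {0<..L} (\<lambda>z. wt z * f z)"
      unfolding wt_def by (intro continuous_intros cont) auto
    then show "(\<lambda>z. wt z * f z) \<in> borel_measurable (lebesgue_on {0<..L})"
      by (intro continuous_imp_measurable_on_sets_lebesgue) auto
    show "(\<lambda>z. B * (wt z * z)) integrable_on {0<..L}"
      using int neg by (rule integrable_spike_set)
  qed (use le in auto)
  then show abs_int: "(\<lambda>z. wt z * f z) absolutely_integrable_on {0..L}"
    by (rule absolutely_integrable_spike_set[OF _ neg(2) neg(1)])
  have "norm (integral {0..L} (\<lambda>z. wt z * f z)) \<le> integral {0..L} (\<lambda>z. B * (wt z * z))"
    using abs_int int le' by (intro integral_norm_bound_integral) (auto dest: set_lebesgue_integral_eq_integral)
  also have "\<dots> = B * wt_moment"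
    using wt_moment_has_integral by (intro integral_unique has_integral_mult_right)
  finally show "\<bar>integral {0..L} (\<lambda>z. wt z * f z)\<bar> \<le> B * wt_moment" by simp
qed

definition admissible :: "real \<Rightarrow> (real \<Rightarrow> real) \<Rightarrow> bool" where
  "admissible R F \<longleftrightarrow> continuous_on {0..L} F \<and> (\<forall>z\<in>{0..L}. 0 \<le> F z \<and> F z \<le> L \<and> F z \<le> R * z)"

lemma admissibleD:
  assumes "admissible R F" "z \<in> {0..L}"
  shows "F z \<in> {0..L}" "F z \<le> R * z"
  using assms by (auto simp: admissible_def)

lemma continuous_on_green_mass: "x \<in> {0..L} \<Longrightarrow> continuous_on {0..L} (green_mass x)"
  using green_mass_lipschitz_mass sigma_pos
  by (intro lipschitz_on_continuous_on[of "x / \<sigma>"] lipschitz_onI) (auto simp: dist_real_def)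

lemma continuous_on_green_mass_comp:
  assumes "admissible R F" "x \<in> {0..L}"
  shows "continuous_on {0<..L} (\<lambda>z. green_mass x (F z))"
  using assms admissibleD[OF assms(1)] continuous_on_green_mass
  by (intro continuous_on_compose2[of "{0..L}" "green_mass x" "{0<..L}" F])
    (auto simp: admissible_def intro: continuous_on_subset)

lemma stream_of_integrable:
  assumes F: "admissible R F" and x: "x \<in> {0..L}"
  shows "(\<lambda>z. wt z * green_mass x (F z)) absolutely_integrable_on {0..L}"
proof (rule wt_integrable(1)[where B = "x / \<sigma> * R"])
  fix z assume z: "z \<in> {0<..L}"
  have Fz: "F z \<in> {0..L}" "F z \<le> R * z" using admissibleD[OF F, of z] z by auto
  have "\<bar>green_mass x (F z)\<bar> \<le> x / \<sigma> * F z"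
    using green_mass_lipschitz_mass[OF x, of "F z" 0] Fz L_pos by simp
  also have "\<dots> \<le> x / \<sigma> * (R * z)" using Fz x sigma_pos by (intro mult_left_mono) auto
  finally show "\<bar>green_mass x (F z)\<bar> \<le> x / \<sigma> * R * z" by (simp add: mult_ac)
qed (rule continuous_on_green_mass_comp[OF F x])

lemmas stream_of_integrable' = set_lebesgue_integral_eq_integral(1)[OF stream_of_integrable]

lemma stream_of_nonneg:
  assumes "admissible R F" "x \<in> {0..L}"
  shows "0 \<le> stream_of F x"
  unfolding stream_of_def
  using stream_of_integrable'[OF assms] admissibleD[OF assms(1)] assms(2)
  by (intro add_nonneg_nonneg mult_nonneg_nonneg Henstock_Kurzweil_Integration.integral_nonneg
      green_mass_nonneg wt_nonneg) auto

lemma stream_of_boundary: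
  assumes "admissible R F"
  shows "stream_of F 0 = 0" "stream_of F L = 0"
  unfolding stream_of_def using admissibleD[OF assms] by (auto intro!: integral_unique has_integral_is_0)

definition point_const :: "real \<Rightarrow> real" where
  "point_const R = 2 / \<sigma> * (L powr (- \<alpha>) * L + R * wt_moment)"

lemma stream_of_lipschitz_point:
  assumes F: "admissible R F" and x: "x \<in> {0..L}" and x': "x' \<in> {0..L}"
  shows "\<bar>stream_of F x - stream_of F x'\<bar> \<le> point_const R * \<bar>x - x'\<bar>"
proof -
  let ?d = "\<lambda>z. green_mass x (F z) - green_mass x' (F z)"
  have "integral {0..L} (\<lambda>z. wt z * green_mass x (F z)) - integral {0..L} (\<lambda>z. wt z * green_mass x' (F z))
      = integral {0..L} (\<lambda>z. wt z * ?d z)"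
    unfolding right_diff_distrib
    by (intro Henstock_Kurzweil_Integration.integral_diff[symmetric] stream_of_integrable'[OF F] x x')
  moreover have "\<bar>integral {0..L} (\<lambda>z. wt z * ?d z)\<bar> \<le> (2 / \<sigma> * R * \<bar>x - x'\<bar>) * wt_moment"
  proof (rule wt_integrable(2))
    show "continuous_on {0<..L} ?d"
      by (intro continuous_intros continuous_on_green_mass_comp[OF F] x x')
    fix z assume z: "z \<in> {0<..L}"
    have Fz: "F z \<in> {0..L}" "F z \<le> R * z" using admissibleD[OF F, of z] z by auto
    have "\<bar>?d z\<bar> \<le> 2 / \<sigma> * F z * \<bar>x - x'\<bar>"
      using Fz by (intro green_mass_lipschitz_point x x')
    also have "\<dots> \<le> 2 / \<sigma> * (R * z) * \<bar>x - x'\<bar>"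
      using Fz sigma_pos by (intro mult_right_mono mult_left_mono) auto
    finally show "\<bar>?d z\<bar> \<le> 2 / \<sigma> * R * \<bar>x - x'\<bar> * z" by (simp add: mult_ac)
  qed
  moreover have "\<bar>L powr (- \<alpha>) * green_mass x L - L powr (- \<alpha>) * green_mass x' L\<bar>
      \<le> L powr (- \<alpha>) * (2 / \<sigma> * L * \<bar>x - x'\<bar>)"
  proof -
    have "\<bar>green_mass x L - green_mass x' L\<bar> \<le> 2 / \<sigma> * L * \<bar>x - x'\<bar>"
      using L_pos by (intro green_mass_lipschitz_point x x') auto
    then have "L powr (- \<alpha>) * \<bar>green_mass x L - green_mass x' L\<bar>
        \<le> L powr (- \<alpha>) * (2 / \<sigma> * L * \<bar>x - x'\<bar>)"
      by (rule mult_left_mono) simp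
    then show ?thesis unfolding right_diff_distrib[symmetric] abs_mult by simp
  qed
  ultimately show ?thesis
    unfolding stream_of_def point_const_def
    by (simp add: algebra_simps)
qed

lemma stream_of_lipschitz_flow:
  assumes F: "admissible R F" and F': "admissible R F'" and x: "x \<in> {0..L}"
    and close: "\<And>z. z \<in> {0..L} \<Longrightarrow> \<bar>F z - F' z\<bar> \<le> b * z"
  shows "\<bar>stream_of F x - stream_of F' x\<bar> \<le> x / \<sigma> * b * wt_moment"
proof -
  let ?d = "\<lambda>z. green_mass x (F z) - green_mass x (F' z)"
  have "stream_of F x - stream_of F' x = integral {0..L} (\<lambda>z. wt z * ?d z)"
    unfolding stream_of_def right_diff_distrib
    by (subst Henstock_Kurzweil_Integration.integral_diff)
      (use F F' x in \<open>auto intro: stream_of_integrable'\<close>)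
  moreover have "\<bar>integral {0..L} (\<lambda>z. wt z * ?d z)\<bar> \<le> (x / \<sigma> * b) * wt_moment"
  proof (rule wt_integrable(2))
    show "continuous_on {0<..L} ?d"
      by (intro continuous_intros continuous_on_green_mass_comp[OF F] continuous_on_green_mass_comp[OF F'] x)
    fix z assume z: "z \<in> {0<..L}"
    then have "F z \<in> {0..L}" "F' z \<in> {0..L}" using admissibleD[OF F] admissibleD[OF F'] by auto
    then have "\<bar>?d z\<bar> \<le> x / \<sigma> * \<bar>F z - F' z\<bar>" by (intro green_mass_lipschitz_mass x)
    also have "\<dots> \<le> x / \<sigma> * (b * z)" using close[of z] z x sigma_pos by (intro mult_left_mono) auto
    finally show "\<bar>?d z\<bar> \<le> x / \<sigma> * b * z" by (simp add: mult_ac)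
  qed
  ultimately show ?thesis by simp
qed

text \<open>
  Clamping positions to \<open>[0, min L (R z)]\<close> is \<open>1\<close>-Lipschitz and makes the vector field globally Lipschitz
  for the weighted norm, without changing it on the flow maps of interest.
\<close>
definition cut :: "real \<Rightarrow> real \<Rightarrow> real \<Rightarrow> real" where
  "cut R z x = max 0 (min x (min L (R * z)))"

definition cut_field :: "real \<Rightarrow> (real \<Rightarrow> real) \<Rightarrow> real \<Rightarrow> real" where
  "cut_field R F z = 2 * stream_of (\<lambda>z. cut R z (F z)) (cut R z (F z))"

lemma cut_lipschitz: "\<bar>cut R z x - cut R z x'\<bar> \<le> \<bar>x - x'\<bar>"
  by (auto simp: cut_def min_def max_def)

lemma cut_bounds:
  assumes "0 \<le> R" "0 \<le> z"
  shows "0 \<le> cut R z x" "cut R z x \<le> L" "cut R z x \<le> R * z"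
  using assms L_pos by (auto simp: cut_def min_def max_def)

lemma cut_eq: "0 \<le> x \<Longrightarrow> x \<le> L \<Longrightarrow> x \<le> R * z \<Longrightarrow> cut R z x = x"
  by (auto simp: cut_def)

lemma cut_admissible:
  assumes "0 \<le> R" "continuous_on {0..L} F"
  shows "admissible R (\<lambda>z. cut R z (F z))"
  unfolding admissible_def using assms cut_bounds
  by (auto simp: cut_def[abs_def] intro!: continuous_intros)

lemma admissible_cut_eq: "admissible R F \<Longrightarrow> z \<in> {0..L} \<Longrightarrow> cut R z (F z) = F z"
  by (intro cut_eq) (auto simp: admissible_def)

lemma stream_of_cong:
  assumes "\<And>z. z \<in> {0..L} \<Longrightarrow> F z = F' z"
  shows "stream_of F x = stream_of F' x"
  unfolding stream_of_def using assms by (auto intro!: integral_cong)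

lemma admissible_cut_field:
  "admissible R F \<Longrightarrow> z \<in> {0..L} \<Longrightarrow> cut_field R F z = 2 * stream_of F (F z)"
  unfolding cut_field_def using stream_of_cong[of "\<lambda>z. cut R z (F z)" F]
  by (simp add: admissible_cut_eq)

definition field_const :: "real \<Rightarrow> real" where
  "field_const R = 2 * (point_const R + R / \<sigma> * wt_moment)"

lemma point_const_nonneg: "0 \<le> R \<Longrightarrow> 0 \<le> point_const R"
  using sigma_pos wt_moment_nonneg L_pos by (simp add: point_const_def)

lemma cut_field_nonneg:
  assumes "0 \<le> R" "continuous_on {0..L} F" "z \<in> {0..L}"
  shows "0 \<le> cut_field R F z"
  unfolding cut_field_def using assms cut_bounds[of R z]
  by (auto intro!: stream_of_nonneg[OF cut_admissible])

lemma cut_field_le: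
  assumes "0 \<le> R" "continuous_on {0..L} F" "z \<in> {0..L}"
  shows "\<bar>cut_field R F z\<bar> \<le> 2 * point_const R * R * z"
proof -
  note adm = cut_admissible[OF assms(1,2)]
  have "\<bar>stream_of (\<lambda>z. cut R z (F z)) (cut R z (F z))\<bar> \<le> point_const R * cut R z (F z)"
    using stream_of_lipschitz_point[OF adm, of "cut R z (F z)" 0] assms cut_bounds[of R z] L_pos
    by (simp add: stream_of_boundary[OF adm])
  also have "\<dots> \<le> point_const R * (R * z)"
    using assms cut_bounds[of R z] by (intro mult_left_mono point_const_nonneg) auto
  finally show ?thesis by (simp add: cut_field_def)
qed

text \<open>
  Moving the evaluation point costs \<open>point_const\<close>; changing the flow map inside \<open>stream_of\<close> costs
  \<open>wt_moment / \<sigma>\<close> times the position, which is at most \<open>R z\<close>. Both errors are proportional to \<open>b z\<close>.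
\<close>
lemma cut_field_lipschitz:
  assumes R: "0 \<le> R" and F: "continuous_on {0..L} F" and F': "continuous_on {0..L} F'"
    and z: "z \<in> {0..L}" and close: "\<And>z. z \<in> {0..L} \<Longrightarrow> \<bar>F z - F' z\<bar> \<le> b * z"
  shows "\<bar>cut_field R F z - cut_field R F' z\<bar> \<le> field_const R * b * z"
proof -
  let ?c = "\<lambda>z. cut R z (F z)" and ?c' = "\<lambda>z. cut R z (F' z)"
  have close': "\<bar>?c z - ?c' z\<bar> \<le> b * z" if "z \<in> {0..L}" for z
    using cut_lipschitz[of R z "F z" "F' z"] close[OF that] by linarith
  have in_L: "?c z \<in> {0..L}" "?c' z \<in> {0..L}" using z R cut_bounds[of R z] by auto
  have bz: "0 \<le> b * z" using close[OF z] by linarith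
  have "\<bar>stream_of ?c (?c z) - stream_of ?c (?c' z)\<bar> \<le> point_const R * \<bar>?c z - ?c' z\<bar>"
    by (rule stream_of_lipschitz_point[OF cut_admissible[OF R F] in_L])
  also have "\<dots> \<le> point_const R * (b * z)"
    using close'[OF z] by (intro mult_left_mono point_const_nonneg R)
  finally have 1: "\<bar>stream_of ?c (?c z) - stream_of ?c (?c' z)\<bar> \<le> point_const R * (b * z)" .
  have b: "0 \<le> b * wt_moment"
  proof -
    have "0 \<le> b * L" using close[of L] L_pos by auto
    then have "0 \<le> b" using L_pos by (simp add: zero_le_mult_iff)
    then show ?thesis using wt_moment_nonneg by simp
  qed
  have "\<bar>stream_of ?c (?c' z) - stream_of ?c' (?c' z)\<bar> \<le> ?c' z / \<sigma> * b * wt_moment"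
    by (rule stream_of_lipschitz_flow[OF cut_admissible[OF R F] cut_admissible[OF R F'] in_L(2) close'])
  also have "\<dots> \<le> R * z / \<sigma> * (b * wt_moment)"
    unfolding mult.assoc using cut_bounds(3)[of R z "F' z"] R z sigma_pos b
    by (intro mult_right_mono divide_right_mono) auto
  finally have "\<bar>stream_of ?c (?c z) - stream_of ?c' (?c' z)\<bar> \<le> point_const R * (b * z) + R * z / \<sigma> * (b * wt_moment)"
    using 1 by linarith
  moreover have "field_const R * b * z = 2 * (point_const R * (b * z) + R * z / \<sigma> * (b * wt_moment))"
    by (simp add: field_const_def algebra_simps)
  moreover have "\<bar>2 * p - 2 * q\<bar> \<le> 2 * r" if "\<bar>p - q\<bar> \<le> r" for p q r :: real
    using that by (auto simp: abs_if split: if_splits)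
  ultimately show ?thesis unfolding cut_field_def by metis
qed

end

section \<open>The Lagrangian flow\<close>

instance bcontfun :: (metric_space, banach) banach ..

context sector
begin

text \<open>
  A bi-Lipschitz homeomorphism of \<open>[0, L]\<close> fixing the endpoints. Together the conditions force \<open>F\<close> to be strictly
  increasing, and the condition is symmetric in \<open>F\<close> and its inverse.
\<close>
definition flow_map :: "real \<Rightarrow> (real \<Rightarrow> real) \<Rightarrow> bool" where
  "flow_map C F \<longleftrightarrow> F 0 = 0 \<and> F L = L \<and>
     (\<forall>a b. 0 \<le> a \<and> a \<le> b \<and> b \<le> L \<longrightarrow> b - a \<le> C * (F b - F a) \<and> F b - F a \<le> C * (b - a))"

lemma flow_map_const_ge_1: "flow_map C F \<Longrightarrow> 1 \<le> C"
  using L_pos by (force simp: flow_map_def dest: spec[of _ 0] spec[of _ L])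

lemma flow_map_strict_mono:
  assumes F: "flow_map C F" and "0 \<le> a" "a < b" "b \<le> L"
  shows "F a < F b"
proof -
  have "b - a \<le> C * (F b - F a)" using assms by (simp add: flow_map_def)
  then have "0 < C * (F b - F a)" using assms by linarith
  then show ?thesis using flow_map_const_ge_1[OF F] by (simp add: zero_less_mult_iff)
qed

lemma flow_map_less_iff:
  assumes "flow_map C F" "a \<in> {0..L}" "b \<in> {0..L}"
  shows "F a < F b \<longleftrightarrow> a < b"
  using flow_map_strict_mono[OF assms(1), of a b] flow_map_strict_mono[OF assms(1), of b a] assms(2,3)
  by (cases a b rule: linorder_cases) auto

lemma flow_map_continuous:
  assumes F: "flow_map C F"
  shows "continuous_on {0..L} F"
proof -
  have ord: "\<bar>F a - F b\<bar> \<le> C * \<bar>a - b\<bar>" if "a \<in> {0..L}" "b \<in> {0..L}" "a \<le> b" for a b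
  proof -
    have "F a \<le> F b" using that flow_map_less_iff[OF F, of b a] by (auto simp: not_less[symmetric])
    moreover have "F b - F a \<le> C * (b - a)" using F that by (auto simp: flow_map_def)
    ultimately show ?thesis using that by auto
  qed
  have "\<bar>F a - F b\<bar> \<le> C * \<bar>a - b\<bar>" if "a \<in> {0..L}" "b \<in> {0..L}" for a b
    using ord[OF that] ord[OF that(2,1)] by (cases "a \<le> b") (auto simp: abs_minus_commute)
  then have "C-lipschitz_on {0..L} F"
    using flow_map_const_ge_1[OF F] by (intro lipschitz_onI) (auto simp: dist_real_def)
  then show ?thesis by (rule lipschitz_on_continuous_on)
qed

lemma flow_map_admissible:
  assumes F: "flow_map C F" and "C \<le> R"
  shows "admissible R F"
  unfolding admissible_def
proof (intro conjI ballI flow_map_continuous[OF F])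
  fix z assume z: "z \<in> {0..L}"
  have "F z \<le> C * z" using F z by (force simp: flow_map_def)
  also have "\<dots> \<le> R * z" using assms z by (intro mult_right_mono) auto
  finally show "F z \<le> R * z" .
  show "0 \<le> F z" "F z \<le> L"
    using flow_map_less_iff[OF F z, of 0] flow_map_less_iff[OF F _ z, of L] F z L_pos
    by (auto simp: flow_map_def not_less)
qed

lemma flow_map_of_trajectories:
  assumes deriv: "\<And>s z. s \<in> closed_segment 0 t \<Longrightarrow> z \<in> {0..L} \<Longrightarrow>
      ((\<lambda>s. \<Phi> s z) has_real_derivative v s z) (at s within closed_segment 0 t)"
    and lip: "\<And>s z z'. s \<in> closed_segment 0 t \<Longrightarrow> z \<in> {0..L} \<Longrightarrow> z' \<in> {0..L} \<Longrightarrow>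
      \<bar>v s z - v s z'\<bar> \<le> A * \<bar>\<Phi> s z - \<Phi> s z'\<bar>"
    and init: "\<And>z. z \<in> {0..L} \<Longrightarrow> \<Phi> 0 z = z"
    and ends: "\<Phi> s 0 = 0" "\<Phi> s L = L"
    and A: "0 \<le> A" and s: "s \<in> closed_segment 0 t"
  shows "flow_map (exp (A * \<bar>t\<bar>)) (\<Phi> s)"
  unfolding flow_map_def
proof (intro conjI allI impI ends)
  fix a b assume ab: "0 \<le> a \<and> a \<le> b \<and> b \<le> L"
  note sub = closed_segment_0_subset[OF s]
  have dw: "((\<lambda>s. \<Phi> s b - \<Phi> s a) has_real_derivative v r b - v r a) (at r within closed_segment 0 s)"
    if "r \<in> closed_segment 0 s" for r
    using that sub ab by (intro DERIV_diff DERIV_subset[OF deriv sub]) auto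
  have lw: "\<bar>v r b - v r a\<bar> \<le> A * \<bar>\<Phi> r b - \<Phi> r a\<bar>" if "r \<in> closed_segment 0 s" for r
    using that sub ab by (intro lip) auto
  have "0 \<le> \<Phi> 0 b - \<Phi> 0 a" using init ab by auto
  note w = gronwall_two_sided[where w = "\<lambda>s. \<Phi> s b - \<Phi> s a", OF dw lw this]
  have "\<bar>s\<bar> \<le> \<bar>t\<bar>" using s by (auto simp: closed_segment_eq_real_ivl split: if_splits)
  then have e: "exp (A * \<bar>s\<bar>) \<le> exp (A * \<bar>t\<bar>)" using A by (simp add: mult_left_mono)
  have w0: "\<Phi> 0 b - \<Phi> 0 a = b - a" "0 \<le> b - a" using init ab by auto
  have pos: "0 \<le> \<Phi> s b - \<Phi> s a"
  proof (rule ccontr)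
    assume "\<not> ?thesis"
    then have "exp (A * \<bar>s\<bar>) * (\<Phi> s b - \<Phi> s a) < 0" by (intro mult_pos_neg) auto
    then show False using w w0 by linarith
  qed
  show "b - a \<le> exp (A * \<bar>t\<bar>) * (\<Phi> s b - \<Phi> s a)"
    using w(2) mult_right_mono[OF e pos] w0 by linarith
  show "\<Phi> s b - \<Phi> s a \<le> exp (A * \<bar>t\<bar>) * (b - a)"
    using w(1) mult_right_mono[OF e w0(2)] w0 by simp
qed

text \<open>
  The equation for the flow alone. The Lipschitz constants are bounded on compact time intervals; this is the
  Lagrangian counterpart of the local bound on \<open>\<theta> powr \<alpha> * g t \<theta>\<close>.
\<close>
definition lagrangian :: "real set \<Rightarrow> (real \<Rightarrow> real \<Rightarrow> real) \<Rightarrow> bool" where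
  "lagrangian J \<Phi> \<longleftrightarrow> is_interval J \<and> 0 \<in> J \<and> (\<forall>z\<in>{0..L}. \<Phi> 0 z = z) \<and>
     (\<forall>t\<in>J. \<exists>C. \<forall>s\<in>closed_segment 0 t. flow_map C (\<Phi> s)) \<and>
     (\<forall>z\<in>{0..L}. \<forall>t\<in>J. ((\<lambda>s. \<Phi> s z) has_real_derivative 2 * stream_of (\<Phi> t) (\<Phi> t z)) (at t within J))"

definition cut_flow :: "real \<Rightarrow> real set \<Rightarrow> (real \<Rightarrow> real \<Rightarrow> real) \<Rightarrow> bool" where
  "cut_flow R S \<Phi> \<longleftrightarrow> (\<forall>z\<in>{0..L}. \<Phi> 0 z = z) \<and>
     (\<forall>s\<in>S. \<Phi> s 0 = 0 \<and> continuous_on {0..L} (\<Phi> s)) \<and>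
     (\<forall>z\<in>{0..L}. \<forall>s\<in>S. ((\<lambda>s. \<Phi> s z) has_real_derivative cut_field R (\<Phi> s) z) (at s within S))"

lemma cut_flow_subset: "cut_flow R S \<Phi> \<Longrightarrow> S' \<subseteq> S \<Longrightarrow> cut_flow R S' \<Phi>"
  unfolding cut_flow_def by (blast intro: DERIV_subset)

lemma lagrangian_cut_flow:
  assumes \<Phi>: "lagrangian J \<Phi>" and t: "t \<in> J"
    and C: "\<And>s. s \<in> closed_segment 0 t \<Longrightarrow> flow_map C (\<Phi> s)" and R: "C \<le> R"
  shows "cut_flow R (closed_segment 0 t) \<Phi>"
proof -
  have sub: "closed_segment 0 t \<subseteq> J"
    using \<Phi> t by (intro closed_segment_0_subset_interval) (auto simp: lagrangian_def)
  have "((\<lambda>s. \<Phi> s z) has_real_derivative cut_field R (\<Phi> s) z) (at s within closed_segment 0 t)"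
    if s: "s \<in> closed_segment 0 t" and z: "z \<in> {0..L}" for s z
  proof -
    have "cut_field R (\<Phi> s) z = 2 * stream_of (\<Phi> s) (\<Phi> s z)"
      by (rule admissible_cut_field[OF flow_map_admissible[OF C[OF s] R] z])
    then show ?thesis
      using \<Phi> s z sub by (auto simp: lagrangian_def intro!: DERIV_subset[OF _ sub])
  qed
  moreover have "\<Phi> s 0 = 0 \<and> continuous_on {0..L} (\<Phi> s)" if "s \<in> closed_segment 0 t" for s
    using C[OF that] flow_map_continuous[OF C[OF that]] by (simp add: flow_map_def)
  ultimately show ?thesis
    using \<Phi> by (simp add: cut_flow_def lagrangian_def)
qed

lemma continuous_on_cut_field:
  assumes R: "0 \<le> R" and F: "continuous_on {0..L} F"
  shows "continuous_on {0..L} (cut_field R F)"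
proof -
  let ?c = "\<lambda>z. cut R z (F z)"
  note adm = cut_admissible[OF R F]
  have "(point_const R)-lipschitz_on {0..L} (stream_of ?c)"
    using stream_of_lipschitz_point[OF adm] point_const_nonneg[OF R]
    by (intro lipschitz_onI) (auto simp: dist_real_def)
  then have "continuous_on {0..L} (stream_of ?c)" by (rule lipschitz_on_continuous_on)
  then have "continuous_on {0..L} (\<lambda>z. stream_of ?c (?c z))"
    by (rule continuous_on_compose2) (use adm in \<open>auto simp: admissible_def\<close>)
  then show ?thesis unfolding cut_field_def by (intro continuous_intros)
qed

text \<open>
  In the unknown \<open>u (1/z) = \<Phi> z / z\<close> the weighted norm of \<open>\<Phi>\<close> is the supremum norm of \<open>u\<close>. The
  substitution \<open>z \<mapsto> 1/z\<close> moves the singular endpoint \<open>z = 0\<close> to infinity, so that bounded continuous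
  functions on the line form a suitable Banach space.
\<close>
lemma cut_flow_exists:
  assumes R: "0 \<le> R"
  shows "\<exists>\<Phi>. cut_flow R UNIV \<Phi>"
proof -
  define \<rho> where "\<rho> s = max s (1 / L)" for s :: real
  have \<rho>: "0 < \<rho> s" "1 / \<rho> s \<in> {0<..L}" for s
  proof -
    have ge: "1 / L \<le> \<rho> s" by (simp add: \<rho>_def)
    then show pos: "0 < \<rho> s" using L_pos by (auto intro: less_le_trans[of 0 "1/L"])
    have "1 \<le> L * \<rho> s" using ge L_pos by (simp add: field_simps)
    then show "1 / \<rho> s \<in> {0<..L}" using pos by (simp add: divide_le_eq)
  qed
  have \<rho>_inv: "\<rho> (1 / z) = 1 / z" if "z \<in> {0<..L}" for z
    using that by (auto simp: \<rho>_def max_def field_simps)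
  define F where "F u z = z * apply_bcontfun u (1 / z)" for u :: "real \<Rightarrow>\<^sub>C real" and z
  have F_le: "\<bar>F u z\<bar> \<le> norm u * \<bar>z\<bar>" for u z
    unfolding F_def abs_mult using norm_bounded[of u "1 / z"]
    by (simp add: mult.commute[of "\<bar>z\<bar>"] mult_right_mono)
  have contF: "continuous_on {0..L} (F u)" for u
    unfolding continuous_on_eq_continuous_within
  proof
    fix z assume z: "z \<in> {0..L}"
    show "continuous (at z within {0..L}) (F u)"
    proof (cases "z = 0")
      case True
      have "((\<lambda>z. norm u * \<bar>z\<bar>) \<longlongrightarrow> norm u * \<bar>0\<bar>) (at 0 within {0..L})"
        by (intro tendsto_intros)
      then have "(F u \<longlongrightarrow> 0) (at 0 within {0..L})"
        using F_le by (intro Lim_null_comparison[of "F u" "\<lambda>z. norm u * \<bar>z\<bar>"]) auto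
      then show ?thesis using True by (simp add: continuous_within F_def)
    next
      case False
      have "continuous_on {0<..} (F u)"
        unfolding F_def by (intro continuous_intros continuous_on_compose2[OF continuous_on_apply_bcontfun]) auto
      then have "continuous (at z) (F u)"
        using False z by (simp add: continuous_on_eq_continuous_at)
      then show ?thesis by (rule continuous_at_imp_continuous_at_within)
    qed
  qed
  define V where "V u = Bcontfun (\<lambda>s. \<rho> s * cut_field R (F u) (1 / \<rho> s))" for u
  have V: "apply_bcontfun (V u) s = \<rho> s * cut_field R (F u) (1 / \<rho> s)" for u s
  proof -
    have "(\<lambda>s. \<rho> s * cut_field R (F u) (1 / \<rho> s)) \<in> bcontfun"
    proof (rule bcontfun_normI)
      have \<rho>0: "\<rho> s \<noteq> 0" for s using \<rho>(1)[of s] by simp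
      have "continuous_on UNIV \<rho>" unfolding \<rho>_def by (intro continuous_intros)
      then show "continuous_on UNIV (\<lambda>s. \<rho> s * cut_field R (F u) (1 / \<rho> s))"
        using \<rho>(2) \<rho>0
        by (intro continuous_intros continuous_on_compose2[OF continuous_on_cut_field[OF R contF]])
          (auto simp: less_imp_le)
      fix s
      have "\<bar>cut_field R (F u) (1 / \<rho> s)\<bar> \<le> 2 * point_const R * R * (1 / \<rho> s)"
        using \<rho>(2)[of s] by (intro cut_field_le R contF) auto
      then have "\<rho> s * \<bar>cut_field R (F u) (1 / \<rho> s)\<bar> \<le> \<rho> s * (2 * point_const R * R * (1 / \<rho> s))"
        using \<rho>(1)[of s] by (intro mult_left_mono) auto
      then show "norm (\<rho> s * cut_field R (F u) (1 / \<rho> s)) \<le> 2 * point_const R * R"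
        using \<rho>(1)[of s] by (simp add: abs_mult)
    qed
    then show ?thesis by (simp add: V_def Bcontfun_inverse)
  qed
  have "norm (V u - V u') \<le> field_const R * norm (u - u')" for u u'
  proof (rule norm_bound)
    fix s
    have close: "\<bar>F u z - F u' z\<bar> \<le> norm (u - u') * z" if "z \<in> {0..L}" for z
    proof -
      have "F u z - F u' z = F (u - u') z" by (simp add: F_def algebra_simps)
      then show ?thesis using F_le[of "u - u'" z] that by simp
    qed
    have "\<bar>cut_field R (F u) (1 / \<rho> s) - cut_field R (F u') (1 / \<rho> s)\<bar>
        \<le> field_const R * norm (u - u') * (1 / \<rho> s)"
      using \<rho>(2)[of s] by (intro cut_field_lipschitz R contF close) auto
    then have "\<rho> s * \<bar>cut_field R (F u) (1 / \<rho> s) - cut_field R (F u') (1 / \<rho> s)\<bar>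
        \<le> \<rho> s * (field_const R * norm (u - u') * (1 / \<rho> s))"
      using \<rho>(1)[of s] by (intro mult_left_mono) auto
    moreover have "apply_bcontfun (V u - V u') s
        = \<rho> s * (cut_field R (F u) (1 / \<rho> s) - cut_field R (F u') (1 / \<rho> s))"
      by (simp add: V algebra_simps)
    ultimately show "norm (apply_bcontfun (V u - V u') s) \<le> field_const R * norm (u - u')"
      using \<rho>(1)[of s] by (simp add: abs_mult)
  qed
  from lipschitz_ode_solution_exists[of V, OF this, of "const_bcontfun 1"]
  obtain y where y0: "y 0 = const_bcontfun 1" and y: "\<And>t. (y has_vector_derivative V (y t)) (at t)"
    by blast
  have eval: "bounded_linear (\<lambda>u::real \<Rightarrow>\<^sub>C real. apply_bcontfun u s)" for s
    by (rule bounded_linear_intro[where K = 1]) (use norm_bounded in \<open>auto simp del: real_norm_def\<close>)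
  have "((\<lambda>s. F (y s) z) has_real_derivative cut_field R (F (y t)) z) (at t)" if z: "z \<in> {0..L}" for z t
  proof (cases "z = 0")
    case True
    have "cut_field R (F (y t)) 0 = 0"
      using R L_pos cut_bounds[of R 0 "F (y t) 0"] stream_of_boundary[OF cut_admissible[OF R contF]]
      by (simp add: cut_field_def)
    then show ?thesis using True by (simp add: F_def)
  next
    case False
    then have z': "z \<in> {0<..L}" using z by auto
    have "((\<lambda>s. apply_bcontfun (y s) (1 / z)) has_vector_derivative apply_bcontfun (V (y t)) (1 / z)) (at t)"
      by (rule bounded_linear.has_vector_derivative[OF eval y])
    then have "((\<lambda>s. apply_bcontfun (y s) (1 / z)) has_real_derivative 1 / z * cut_field R (F (y t)) z) (at t)"
      using \<rho>_inv[OF z'] by (simp add: has_real_derivative_iff_has_vector_derivative V)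
    then have "((\<lambda>s. F (y s) z) has_real_derivative z * (1 / z * cut_field R (F (y t)) z)) (at t)"
      unfolding F_def by (rule DERIV_cmult)
    then show ?thesis using False by simp
  qed
  then have "cut_flow R UNIV (\<lambda>t. F (y t))"
    unfolding cut_flow_def using contF y0 by (auto simp: F_def const_bcontfun.rep_eq)
  then show ?thesis by blast
qed

lemma cut_flow_increment:
  assumes \<Phi>: "cut_flow R S \<Phi>" and R: "0 \<le> R" and S: "is_interval S" and z: "z \<in> {0..L}"
    and ab: "a \<in> S" "b \<in> S"
  shows "\<bar>\<Phi> a z - \<Phi> b z\<bar> \<le> 2 * point_const R * R * z * \<bar>a - b\<bar>"
proof -
  have "norm (\<Phi> a z - \<Phi> b z) \<le> 2 * point_const R * R * z * norm (a - b)"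
  proof (rule field_differentiable_bound[where S = S and f = "\<lambda>s. \<Phi> s z"])
    fix s assume "s \<in> S"
    then show "((\<lambda>s. \<Phi> s z) has_field_derivative cut_field R (\<Phi> s) z) (at s within S)"
      "norm (cut_field R (\<Phi> s) z) \<le> 2 * point_const R * R * z"
      using \<Phi> z cut_field_le[OF R _ z] by (auto simp: cut_flow_def)
  qed (use S ab is_interval_convex in auto)
  then show ?thesis by simp
qed

text \<open>
  The family \<open>(\<Phi> s z - \<Psi> s z) / z\<close>, indexed by \<open>z > 0\<close>, vanishes initially and satisfies the hypothesis
  of \<open>vanishing_family\<close> by the weighted Lipschitz estimate.
\<close>
lemma cut_flow_unique:
  assumes R: "0 \<le> R" and \<Phi>: "cut_flow R (closed_segment 0 t) \<Phi>" and \<Psi>: "cut_flow R (closed_segment 0 t) \<Psi>"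
    and s: "s \<in> closed_segment 0 t" and z: "z \<in> {0..L}"
  shows "\<Phi> s z = \<Psi> s z"
proof (cases "z = 0")
  case True
  then show ?thesis using \<Phi> \<Psi> s by (simp add: cut_flow_def)
next
  case False
  let ?S = "closed_segment 0 t"
  let ?K = "2 * point_const R * R"
  have "(\<Phi> s z - \<Psi> s z) / z = 0"
  proof (rule vanishing_family[where d = "\<lambda>s z. (\<Phi> s z - \<Psi> s z) / z" and A = "{0<..L}" and t = t
        and d' = "\<lambda>s z. (cut_field R (\<Phi> s) z - cut_field R (\<Psi> s) z) / z"
        and B = "2 * ?K * \<bar>t\<bar>" and C = "field_const R"])
    show "s \<in> ?S" "z \<in> {0<..L}" using s z False by auto
    fix z assume z: "z \<in> {0<..L}"
    then have z': "z \<in> {0..L}" by auto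
    show "(\<Phi> 0 z - \<Psi> 0 z) / z = 0" using \<Phi> \<Psi> z' by (simp add: cut_flow_def)
    fix s assume s: "s \<in> ?S"
    show "((\<lambda>r. (\<Phi> r z - \<Psi> r z) / z) has_real_derivative
        (cut_field R (\<Phi> s) z - cut_field R (\<Psi> s) z) / z) (at s within ?S)"
      using \<Phi> \<Psi> s z' by (intro DERIV_cdivide DERIV_diff) (auto simp: cut_flow_def)
    have "\<bar>\<Phi> s z - \<Phi> 0 z\<bar> \<le> ?K * z * \<bar>s - 0\<bar>" "\<bar>\<Psi> s z - \<Psi> 0 z\<bar> \<le> ?K * z * \<bar>s - 0\<bar>"
      using s z' R by (intro cut_flow_increment[OF \<Phi>] cut_flow_increment[OF \<Psi>];
          simp add: is_interval_convex_1)+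
    moreover have "\<Phi> 0 z = \<Psi> 0 z" using \<Phi> \<Psi> z' by (simp add: cut_flow_def)
    moreover have "?K * z * \<bar>s - 0\<bar> \<le> ?K * z * \<bar>t\<bar>"
      using s z R point_const_nonneg[OF R]
      by (intro mult_left_mono) (auto simp: closed_segment_eq_real_ivl split: if_splits)
    ultimately have "\<bar>\<Phi> s z - \<Psi> s z\<bar> \<le> 2 * (?K * z * \<bar>t\<bar>)" by linarith
    then show "\<bar>(\<Phi> s z - \<Psi> s z) / z\<bar> \<le> 2 * ?K * \<bar>t\<bar>"
      using z by (simp add: abs_divide field_simps)
    fix b assume b: "\<And>z. z \<in> {0<..L} \<Longrightarrow> \<bar>(\<Phi> s z - \<Psi> s z) / z\<bar> \<le> b"
    have "\<bar>\<Phi> s z - \<Psi> s z\<bar> \<le> b * z" if "z \<in> {0..L}" for z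
    proof (cases "z = 0")
      case True
      then show ?thesis using \<Phi> \<Psi> s by (simp add: cut_flow_def)
    next
      case False
      then show ?thesis using b[of z] that by (simp add: abs_divide field_simps)
    qed
    then have "\<bar>cut_field R (\<Phi> s) z - cut_field R (\<Psi> s) z\<bar> \<le> field_const R * b * z"
      using \<Phi> \<Psi> s by (intro cut_field_lipschitz R z') (auto simp: cut_flow_def)
    then show "\<bar>(cut_field R (\<Phi> s) z - cut_field R (\<Psi> s) z) / z\<bar> \<le> field_const R * b"
      using z by (simp add: abs_divide field_simps)
  qed
  then show ?thesis using False by simp
qed

lemma lagrangian_unique:
  assumes \<Phi>: "lagrangian J \<Phi>" and \<Psi>: "lagrangian J' \<Psi>" and t: "t \<in> J" "t \<in> J'" and z: "z \<in> {0..L}"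
  shows "\<Phi> t z = \<Psi> t z"
proof -
  obtain C where C: "\<And>s. s \<in> closed_segment 0 t \<Longrightarrow> flow_map C (\<Phi> s)"
    using \<Phi> t unfolding lagrangian_def by blast
  obtain C' where C': "\<And>s. s \<in> closed_segment 0 t \<Longrightarrow> flow_map C' (\<Psi> s)"
    using \<Psi> t unfolding lagrangian_def by blast
  have "0 \<le> max C C'" using flow_map_const_ge_1[OF C, of 0] by auto
  then show ?thesis
    by (rule cut_flow_unique[OF _ lagrangian_cut_flow[OF \<Phi> t(1) C] lagrangian_cut_flow[OF \<Psi> t(2) C']])
      (use z in auto)
qed

text \<open>
  As long as the cutoff is inactive, Gronwall's inequality against the constant trajectories \<open>0\<close> and
  \<open>L\<close> confines the flow to the sector, and against each other it gives the bi-Lipschitz bounds.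
\<close>
lemma cut_flow_lagrangian:
  assumes R: "0 \<le> R" and \<Phi>: "cut_flow R J \<Phi>" and J: "is_interval J" "0 \<in> J"
    and below: "\<And>s z. s \<in> J \<Longrightarrow> z \<in> {0..L} \<Longrightarrow> \<Phi> s z \<le> R * z"
  shows "lagrangian J \<Phi>"
proof -
  let ?A = "2 * point_const R"
  have A: "0 \<le> ?A" using point_const_nonneg[OF R] by simp
  have init: "\<Phi> 0 z = z" if "z \<in> {0..L}" for z using \<Phi> that by (auto simp: cut_flow_def)
  have zero: "\<Phi> s 0 = 0" if "s \<in> J" for s using \<Phi> that by (auto simp: cut_flow_def)
  have adm: "admissible R (\<lambda>z. cut R z (\<Phi> s z))" if "s \<in> J" for s
    using \<Phi> R that by (intro cut_admissible) (auto simp: cut_flow_def)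
  have lip: "\<bar>2 * stream_of (\<lambda>z. cut R z (\<Phi> s z)) x - 2 * stream_of (\<lambda>z. cut R z (\<Phi> s z)) x'\<bar> \<le> ?A * \<bar>x - x'\<bar>"
    if "s \<in> J" "x \<in> {0..L}" "x' \<in> {0..L}" for s x x'
    using stream_of_lipschitz_point[OF adm[OF that(1)] that(2,3)] by (auto simp: abs_if split: if_splits)
  have cut_in: "cut R z (\<Phi> s z) \<in> {0..L}" if "z \<in> {0..L}" for s z
    using cut_bounds[OF R, of z] that by auto
  have deriv: "((\<lambda>s. \<Phi> s z) has_real_derivative cut_field R (\<Phi> s) z) (at s within closed_segment 0 t)"
    if "z \<in> {0..L}" "t \<in> J" "s \<in> closed_segment 0 t" for s t z
    using \<Phi> that closed_segment_0_subset_interval[OF J that(2)]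
    by (intro DERIV_subset[OF _ closed_segment_0_subset_interval[OF J that(2)]])
      (auto simp: cut_flow_def)
  have confined: "0 \<le> \<Phi> t z \<and> \<Phi> t z \<le> L \<and> (z = L \<longrightarrow> \<Phi> t z = L)" if z: "z \<in> {0..L}" and t: "t \<in> J" for z t
  proof -
    note sub = closed_segment_0_subset_interval[OF J t]
    have *: "\<bar>cut_field R (\<Phi> s) z\<bar> \<le> ?A * \<bar>\<Phi> s z\<bar>" "\<bar>cut_field R (\<Phi> s) z\<bar> \<le> ?A * \<bar>L - \<Phi> s z\<bar>"
      if s: "s \<in> closed_segment 0 t" for s
    proof -
      have sJ: "s \<in> J" using s sub by auto
      have cut: "cut R z (\<Phi> s z) = max 0 (min (\<Phi> s z) L)"
        using below[OF sJ z] by (auto simp: cut_def)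
      have "\<bar>cut_field R (\<Phi> s) z\<bar> \<le> ?A * \<bar>cut R z (\<Phi> s z) - 0\<bar>"
        using lip[OF sJ cut_in[OF z], of 0 s] L_pos stream_of_boundary[OF adm[OF sJ]]
        by (simp add: cut_field_def)
      also have "\<dots> \<le> ?A * \<bar>\<Phi> s z\<bar>" using A L_pos by (intro mult_left_mono) (auto simp: cut)
      finally show "\<bar>cut_field R (\<Phi> s) z\<bar> \<le> ?A * \<bar>\<Phi> s z\<bar>" .
      have "\<bar>cut_field R (\<Phi> s) z\<bar> \<le> ?A * \<bar>cut R z (\<Phi> s z) - L\<bar>"
        using lip[OF sJ cut_in[OF z], of L s] L_pos stream_of_boundary[OF adm[OF sJ]]
        by (simp add: cut_field_def)
      also have "\<dots> \<le> ?A * \<bar>L - \<Phi> s z\<bar>" using A L_pos by (intro mult_left_mono) (auto simp: cut)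
      finally show "\<bar>cut_field R (\<Phi> s) z\<bar> \<le> ?A * \<bar>L - \<Phi> s z\<bar>" .
    qed
    have nonneg: "0 \<le> a" if "b \<le> exp c * a" "0 \<le> b" for a b c :: real
      using order_trans[OF that(2,1)] by (simp add: zero_le_mult_iff)
    have "\<Phi> 0 z \<le> exp (?A * \<bar>t\<bar>) * \<Phi> t z"
      by (rule gronwall_two_sided(2)[OF deriv[OF z t] *(1)]) (use init z in auto)
    then have 1: "0 \<le> \<Phi> t z" by (rule nonneg) (use init z in auto)
    have dL: "((\<lambda>s. L - \<Phi> s z) has_real_derivative - cut_field R (\<Phi> s) z) (at s within closed_segment 0 t)"
      if "s \<in> closed_segment 0 t" for s
      using DERIV_diff[OF DERIV_const deriv[OF z t that], of L] by simp
    have "\<bar>- cut_field R (\<Phi> s) z\<bar> \<le> ?A * \<bar>L - \<Phi> s z\<bar>" if "s \<in> closed_segment 0 t" for s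
      using *(2)[OF that] by simp
    moreover have "0 \<le> L - \<Phi> 0 z" using init[OF z] z by simp
    ultimately have "L - \<Phi> 0 z \<le> exp (?A * \<bar>t\<bar>) * (L - \<Phi> t z)" "L - \<Phi> t z \<le> exp (?A * \<bar>t\<bar>) * (L - \<Phi> 0 z)"
      using gronwall_two_sided[where w = "\<lambda>s. L - \<Phi> s z", OF dL] by blast+
    moreover from this(1) have "0 \<le> L - \<Phi> t z" by (rule nonneg) (use init z in auto)
    ultimately show ?thesis using 1 init[OF z] by auto
  qed
  have uncut: "cut R z (\<Phi> s z) = \<Phi> s z" if "s \<in> J" "z \<in> {0..L}" for s z
    using confined[OF that(2,1)] below[OF that] by (intro cut_eq) auto
  have adm': "admissible R (\<Phi> s)" if "s \<in> J" for s
    using \<Phi> that confined below by (auto simp: admissible_def cut_flow_def)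
  have field: "cut_field R (\<Phi> s) z = 2 * stream_of (\<Phi> s) (\<Phi> s z)" if "s \<in> J" "z \<in> {0..L}" for s z
    using admissible_cut_field[OF adm'] that by simp
  have "flow_map (exp (?A * \<bar>t\<bar>)) (\<Phi> s)" if t: "t \<in> J" and s: "s \<in> closed_segment 0 t" for s t
  proof (rule flow_map_of_trajectories[OF deriv[OF _ t] _ init])
    note sub = closed_segment_0_subset_interval[OF J t]
    show "\<Phi> s 0 = 0" "\<Phi> s L = L" using zero confined[of L s] sub s L_pos by auto
    fix r z z' assume r: "r \<in> closed_segment 0 t" and z: "z \<in> {0..L}" "z' \<in> {0..L}"
    then have "r \<in> J" using sub by auto
    then show "\<bar>cut_field R (\<Phi> r) z - cut_field R (\<Phi> r) z'\<bar> \<le> ?A * \<bar>\<Phi> r z - \<Phi> r z'\<bar>"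
      using lip[of r "\<Phi> r z" "\<Phi> r z'"] confined z uncut by (simp add: cut_field_def)
  qed (use A s in auto)
  then show ?thesis
    unfolding lagrangian_def using J init \<Phi> field by (auto simp: cut_flow_def)
qed

text \<open>
  The velocity is nonnegative, so at negative times a trajectory lies below its position at time \<open>0\<close>.
\<close>
lemma cut_flow_backward:
  assumes R: "1 \<le> R" and \<Phi>: "cut_flow R UNIV \<Phi>" and t: "t \<le> 0" and z: "z \<in> {0..L}"
  shows "\<Phi> t z \<le> R * z"
proof -
  have "\<Phi> t z \<le> \<Phi> 0 z"
  proof (rule DERIV_nonneg_imp_nondecreasing[OF t])
    fix s assume "t \<le> s" "s \<le> 0"
    show "\<exists>y. ((\<lambda>s. \<Phi> s z) has_real_derivative y) (at s) \<and> 0 \<le> y"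
      using \<Phi> z R by (intro exI[of _ "cut_field R (\<Phi> s) z"]) (auto simp: cut_flow_def intro!: cut_field_nonneg)
  qed
  also have "\<dots> = 1 * z" using \<Phi> z by (simp add: cut_flow_def)
  also have "\<dots> \<le> R * z" using R z by (intro mult_right_mono) auto
  finally show ?thesis .
qed

text \<open>
  The flow agrees up to time \<open>\<tau>\<close> with the cut flow whose parameter exceeds its Lipschitz constant by \<open>1\<close>.
  The cut flow moves with relative speed at most \<open>K\<close>, hence it stays below the cutoff for a time
  \<open>1 / (K + 1)\<close> longer.
\<close>
lemma lagrangian_extend:
  assumes \<Phi>: "lagrangian J \<Phi>" and \<tau>: "\<tau> \<in> J" "0 \<le> \<tau>"
  shows "\<exists>\<delta>>0. \<exists>\<Psi>. lagrangian {..\<tau> + \<delta>} \<Psi>"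
proof -
  have seg: "closed_segment 0 \<tau> = {0..\<tau>}" using \<tau> by (simp add: closed_segment_eq_real_ivl)
  obtain C where C: "\<And>s. s \<in> closed_segment 0 \<tau> \<Longrightarrow> flow_map C (\<Phi> s)"
    using \<Phi> \<tau> unfolding lagrangian_def by blast
  have C1: "1 \<le> C" using flow_map_const_ge_1[OF C, of 0] by auto
  define R where "R = C + 1"
  have R: "0 \<le> R" "1 \<le> R" "C \<le> R" using C1 by (auto simp: R_def)
  obtain \<Psi> where \<Psi>: "cut_flow R UNIV \<Psi>" using cut_flow_exists[OF R(1)] by blast
  have eq: "\<Phi> s z = \<Psi> s z" if "s \<in> {0..\<tau>}" "z \<in> {0..L}" for s z
    using that unfolding seg[symmetric]
    by (intro cut_flow_unique[OF R(1) lagrangian_cut_flow[OF \<Phi> \<tau>(1) C R(3)] cut_flow_subset[OF \<Psi>]]) auto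
  define K where "K = 2 * point_const R * R"
  have K: "0 \<le> K" using point_const_nonneg[OF R(1)] R by (simp add: K_def)
  define \<delta> where "\<delta> = 1 / (K + 1)"
  have \<delta>: "0 < \<delta>" "K * \<delta> \<le> 1" using K by (auto simp: \<delta>_def field_simps)
  have upto: "\<Psi> s z \<le> C * z" if "s \<in> {0..\<tau>}" "z \<in> {0..L}" for s z
    using admissibleD(2)[OF flow_map_admissible[OF C order_refl]] that eq seg by metis
  have "\<Psi> s z \<le> R * z" if s: "s \<le> \<tau> + \<delta>" and z: "z \<in> {0..L}" for s z
  proof -
    consider "s \<le> 0" | "s \<in> {0..\<tau>}" | "\<tau> < s" by fastforce
    then show ?thesis
    proof cases
      case 1
      then show ?thesis using cut_flow_backward[OF R(2) \<Psi>] z by auto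
    next
      case 2
      have "C * z \<le> R * z" using R z by (intro mult_right_mono) auto
      then show ?thesis using upto[OF 2 z] by linarith
    next
      case 3
      have "\<bar>\<Psi> s z - \<Psi> \<tau> z\<bar> \<le> K * z * \<bar>s - \<tau>\<bar>"
        unfolding K_def by (rule cut_flow_increment[OF \<Psi> R(1) _ z]) auto
      also have "\<dots> \<le> K * z * \<delta>" using 3 s z K by (intro mult_left_mono) auto
      also have "\<dots> = (K * \<delta>) * z" by simp
      also have "\<dots> \<le> 1 * z" using \<delta> z by (intro mult_right_mono) auto
      finally show ?thesis using upto[of \<tau> z] \<tau> z by (simp add: R_def algebra_simps)
    qed
  qed
  then have "lagrangian {..\<tau> + \<delta>} \<Psi>"
    using \<tau> \<delta> by (intro cut_flow_lagrangian[OF R(1) cut_flow_subset[OF \<Psi>]]) auto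
  then show ?thesis using \<delta> by blast
qed

lemma lagrangian_backward: "\<exists>\<Phi>. lagrangian {..0} \<Phi>"
proof -
  obtain \<Phi> where \<Phi>: "cut_flow 1 UNIV \<Phi>" using cut_flow_exists[of 1] by auto
  have "lagrangian {..0} \<Phi>"
    using cut_flow_backward[OF _ \<Phi>] by (intro cut_flow_lagrangian[of 1] cut_flow_subset[OF \<Phi>]) auto
  then show ?thesis by blast
qed

end

section \<open>Blow-up and the maximal flow\<close>

lemma increment_ge_slope:
  fixes f :: "real \<Rightarrow> real"
  assumes deriv: "\<And>s. s \<in> {a..b} \<Longrightarrow> (f has_real_derivative f' s) (at s within {a..b})"
    and slope: "\<And>s. s \<in> {a..b} \<Longrightarrow> A \<le> f' s" and "a \<le> b"
  shows "f a + A * (b - a) \<le> f b"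
proof -
  have "f a - A * a \<le> f b - A * b"
  proof (rule DERIV_nonneg_imp_increasing_open[OF \<open>a \<le> b\<close>])
    show "continuous_on {a..b} (\<lambda>s. f s - A * s)"
      by (intro continuous_intros DERIV_continuous_on[OF deriv])
    fix s assume s: "a < s" "s < b"
    then have "(f has_real_derivative f' s) (at s)"
      using deriv[of s] by (simp add: at_within_Icc_at)
    then have "((\<lambda>s. f s - A * s) has_real_derivative f' s - A) (at s)"
      by (auto intro!: derivative_eq_intros)
    then show "\<exists>y. ((\<lambda>s. f s - A * s) has_real_derivative y) (at s) \<and> 0 \<le> y"
      using slope[of s] s by (intro exI[of _ "f' s - A"]) auto
  qed
  then show ?thesis by (simp add: algebra_simps)
qed

context sector
begin

lemma flow_map_interior:
  assumes "flow_map C F" "z \<in> {0<..<L}"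
  shows "F z \<in> {0<..<L}"
  using flow_map_strict_mono[OF assms(1), of 0 z] flow_map_strict_mono[OF assms(1), of z L] assms
  by (auto simp: flow_map_def)

text \<open>
  In this coordinate a velocity \<open>S * x * (L - x)\<close> becomes the constant \<open>L * S\<close>.
\<close>
definition logit :: "real \<Rightarrow> real" where "logit x = ln x - ln (L - x)"

lemma logit_deriv:
  assumes "x \<in> {0<..<L}"
  shows "(logit has_real_derivative L / (x * (L - x))) (at x)"
proof -
  have "(logit has_real_derivative 1 / x - (- 1) / (L - x)) (at x)"
    unfolding logit_def[abs_def] using assms by (auto intro!: derivative_eq_intros)
  also have "1 / x - (- 1) / (L - x) = L / (x * (L - x))"
    using assms by (simp add: field_simps)
  finally show ?thesis .
qed

definition growth_const :: real where
  "growth_const = \<sigma> / (12 * L ^ 3) * (L / 5)\<^sup>2 * (\<alpha> / 2 * (L / 2) powr (- \<alpha>))"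

lemma growth_const_pos: "0 < growth_const"
  using sigma_pos L_pos alpha_pos by (simp add: growth_const_def)

text \<open>
  Once the flow has pushed every point by \<open>\<kappa>\<close> in the logistic coordinate, the points
  \<open>z \<approx> L * exp (- \<kappa>)\<close> have reached the bulk of the sector. They carry vorticity
  \<open>z powr (- \<alpha>) \<approx> exp (\<alpha> * \<kappa>)\<close>, and the Green function turns this into a lower
  bound for the stream function.
\<close>
lemma stream_of_lower:
  assumes F: "flow_map C F" and pushed: "\<And>z. z \<in> {0<..<L} \<Longrightarrow> logit z + \<kappa> \<le> logit (F z)"
    and \<kappa>: "0 \<le> \<kappa>" and x: "x \<in> {0..L}"
  shows "growth_const * exp (\<alpha> * \<kappa>) * (x * (L - x)) \<le> stream_of F x"
proof -
  \<comment> \<open>On \<open>[a, b]\<close> the product \<open>q z\<close> is at least \<open>L / 4\<close>, which forces \<open>F z \<ge> L / 5\<close>.\<close>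
  define q where "q = exp \<kappa>"
  have q: "1 \<le> q" using \<kappa> by (simp add: q_def)
  define a b where "a = L / (4 * q)" and "b = L / (2 * q)"
  have ab: "0 < a" "a < b" "b \<le> L / 2" "b - a = b / 2"
    using q L_pos by (auto simp: a_def b_def field_simps)
  have adm: "admissible C F" by (rule flow_map_admissible[OF F order_refl])
  have bulk: "L / 5 \<le> F z" if z: "z \<in> {a..b}" for z
  proof -
    have z': "z \<in> {0<..<L}" using z ab L_pos by auto
    have Fz: "F z \<in> {0<..<L}" by (rule flow_map_interior[OF F z'])
    have "exp (logit z + \<kappa>) \<le> exp (logit (F z))" using pushed[OF z'] by simp
    then have "q * (z / (L - z)) \<le> F z / (L - F z)"
      using z' Fz by (simp add: logit_def q_def exp_add exp_diff mult.commute)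
    moreover have "1 / 4 \<le> q * (z / (L - z))"
    proof -
      have "q * a \<le> q * z" using z q by (intro mult_left_mono) auto
      moreover have "q * a = L / 4" using q by (simp add: a_def)
      ultimately show ?thesis using z' by (simp add: field_simps)
    qed
    ultimately have "1 / 4 \<le> F z / (L - F z)" by linarith
    then show ?thesis using Fz by (simp add: field_simps)
  qed
  have mass: "\<sigma> / (12 * L ^ 3) * (x * (L - x)) * (L / 5)\<^sup>2 \<le> green_mass x (F z)" if z: "z \<in> {a..b}" for z
  proof -
    have z': "z \<in> {0..L}" using z ab L_pos by auto
    have "\<sigma> / (12 * L ^ 3) * (x * (L - x)) * (L / 5)\<^sup>2 \<le> \<sigma> / (12 * L ^ 3) * (x * (L - x)) * (F z)\<^sup>2"
      using bulk[OF z] x sigma_pos L_pos by (intro mult_left_mono power_mono) auto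
    also have "\<dots> \<le> green_mass x (F z)" by (rule green_mass_lower[OF x admissibleD(1)[OF adm z']])
    finally show ?thesis .
  qed
  have weight: "\<alpha> * b powr (- \<alpha> - 1) \<le> wt z" if "z \<in> {a..b}" for z
    unfolding wt_def using that ab alpha_pos by (intro mult_left_mono powr_mono2') auto
  let ?m = "\<sigma> / (12 * L ^ 3) * (x * (L - x)) * (L / 5)\<^sup>2"
  have int: "(\<lambda>z. wt z * green_mass x (F z)) integrable_on {0..L}" by (rule stream_of_integrable'[OF adm x])
  have sub: "{a..b} \<subseteq> {0..L}" using ab L_pos by auto
  have m: "0 \<le> ?m" using x sigma_pos L_pos by auto
  have nonneg: "0 \<le> wt z * green_mass x (F z)" if "z \<in> {0..L}" for z
    using admissibleD[OF adm that] x by (intro mult_nonneg_nonneg wt_nonneg green_mass_nonneg) auto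
  have "(b - a) * (\<alpha> * b powr (- \<alpha> - 1) * ?m) = integral {a..b} (\<lambda>_. \<alpha> * b powr (- \<alpha> - 1) * ?m)"
    using ab by simp
  also have "\<dots> \<le> integral {a..b} (\<lambda>z. wt z * green_mass x (F z))"
    using weight mass wt_nonneg m
    by (intro integral_le integrable_on_subinterval[OF int sub] mult_mono) auto
  also have "\<dots> \<le> integral {0..L} (\<lambda>z. wt z * green_mass x (F z))"
    by (intro integral_subset_le sub int integrable_on_subinterval[OF int sub] ballI nonneg)
  also have "\<dots> \<le> stream_of F x"
    unfolding stream_of_def using x by (simp add: green_mass_nonneg)
  finally have "(b - a) * (\<alpha> * b powr (- \<alpha> - 1) * ?m) \<le> stream_of F x" .
  then have "(b - a) * (\<alpha> * b powr (- \<alpha> - 1)) * ?m \<le> stream_of F x"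
    by (simp only: mult.assoc)
  moreover have "(b - a) * (\<alpha> * b powr (- \<alpha> - 1)) = \<alpha> / 2 * (L / 2) powr (- \<alpha>) * exp (\<alpha> * \<kappa>)"
  proof -
    have "(b - a) * (\<alpha> * b powr (- \<alpha> - 1)) = \<alpha> / 2 * (b * b powr (- \<alpha> - 1))" using ab by simp
    also have "b * b powr (- \<alpha> - 1) = b powr (- \<alpha>)" using ab by (simp add: powr_diff)
    also have "b powr (- \<alpha>) = (L / 2) powr (- \<alpha>) * q powr \<alpha>"
      using q L_pos by (simp add: b_def powr_divide powr_mult powr_minus field_simps)
    also have "q powr \<alpha> = exp (\<alpha> * \<kappa>)" by (simp add: q_def powr_def)
    finally show ?thesis by simp
  qed
  moreover have "growth_const * exp (\<alpha> * \<kappa>) * (x * (L - x))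
      = \<alpha> / 2 * (L / 2) powr (- \<alpha>) * exp (\<alpha> * \<kappa>) * ?m"
    by (simp add: growth_const_def)
  ultimately show ?thesis by (simp only:)
qed

lemma logit_flow_deriv:
  assumes \<Phi>: "lagrangian J \<Phi>" and s: "s \<in> J" and z: "z \<in> {0<..<L}"
  shows "((\<lambda>s. logit (\<Phi> s z)) has_real_derivative
    L / (\<Phi> s z * (L - \<Phi> s z)) * (2 * stream_of (\<Phi> s) (\<Phi> s z))) (at s within J)"
proof (rule DERIV_chain2[OF logit_deriv])
  show "\<Phi> s z \<in> {0<..<L}"
    using \<Phi> s flow_map_interior[OF _ z] unfolding lagrangian_def by blast
  show "((\<lambda>s. \<Phi> s z) has_real_derivative 2 * stream_of (\<Phi> s) (\<Phi> s z)) (at s within J)"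
    using \<Phi> s z by (auto simp: lagrangian_def)
qed

lemma push_grows:
  assumes \<Phi>: "lagrangian J \<Phi>" and J: "{t0..t1} \<subseteq> J" "t0 \<le> t1" and \<kappa>: "0 \<le> \<kappa>"
    and pushed: "\<And>z. z \<in> {0<..<L} \<Longrightarrow> logit z + \<kappa> \<le> logit (\<Phi> t0 z)" and z: "z \<in> {0<..<L}"
  shows "logit z + \<kappa> + 2 * L * growth_const * exp (\<alpha> * \<kappa>) * (t1 - t0) \<le> logit (\<Phi> t1 z)"
proof -
  have flow: "\<exists>C. flow_map C (\<Phi> s)" if "s \<in> J" for s
    using \<Phi> that unfolding lagrangian_def by blast
  have inside: "\<Phi> s z \<in> {0<..<L}" if "s \<in> J" "z \<in> {0<..<L}" for s z
    using flow[OF that(1)] flow_map_interior[OF _ that(2)] by blast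
  have mono: "logit z + \<kappa> \<le> logit (\<Phi> s z)" if s: "s \<in> {t0..t1}" and z: "z \<in> {0<..<L}" for s z
  proof -
    have "logit (\<Phi> t0 z) + 0 * (s - t0) \<le> logit (\<Phi> s z)"
    proof (rule increment_ge_slope)
      fix r assume r: "r \<in> {t0..s}"
      then have rJ: "r \<in> J" using s J by auto
      show "((\<lambda>s. logit (\<Phi> s z)) has_real_derivative
          L / (\<Phi> r z * (L - \<Phi> r z)) * (2 * stream_of (\<Phi> r) (\<Phi> r z))) (at r within {t0..s})"
        using s J by (intro DERIV_subset[OF logit_flow_deriv[OF \<Phi> rJ z]]) auto
      obtain C where C: "flow_map C (\<Phi> r)" using flow[OF rJ] by blast
      have "0 \<le> stream_of (\<Phi> r) (\<Phi> r z)"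
        using inside[OF rJ z] by (intro stream_of_nonneg[OF flow_map_admissible[OF C order_refl]]) auto
      then show "0 \<le> L / (\<Phi> r z * (L - \<Phi> r z)) * (2 * stream_of (\<Phi> r) (\<Phi> r z))"
        using inside[OF rJ z] L_pos by auto
    qed (use s in auto)
    then show ?thesis using pushed[OF z] by linarith
  qed
  have "logit (\<Phi> t0 z) + 2 * L * growth_const * exp (\<alpha> * \<kappa>) * (t1 - t0) \<le> logit (\<Phi> t1 z)"
  proof (rule increment_ge_slope[OF _ _ J(2)])
    fix r assume r: "r \<in> {t0..t1}"
    then have rJ: "r \<in> J" using J by auto
    show "((\<lambda>s. logit (\<Phi> s z)) has_real_derivative
        L / (\<Phi> r z * (L - \<Phi> r z)) * (2 * stream_of (\<Phi> r) (\<Phi> r z))) (at r within {t0..t1})"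
      by (rule DERIV_subset[OF logit_flow_deriv[OF \<Phi> rJ z] J(1)])
    obtain C where C: "flow_map C (\<Phi> r)" using flow[OF rJ] by blast
    note x = inside[OF rJ z]
    have "growth_const * exp (\<alpha> * \<kappa>) * (\<Phi> r z * (L - \<Phi> r z)) \<le> stream_of (\<Phi> r) (\<Phi> r z)"
      using x by (intro stream_of_lower[OF C mono[OF r] \<kappa>]) auto
    then have "L / (\<Phi> r z * (L - \<Phi> r z)) * (2 * (growth_const * exp (\<alpha> * \<kappa>) * (\<Phi> r z * (L - \<Phi> r z))))
        \<le> L / (\<Phi> r z * (L - \<Phi> r z)) * (2 * stream_of (\<Phi> r) (\<Phi> r z))"
      using x L_pos by (intro mult_left_mono) auto
    then show "2 * L * growth_const * exp (\<alpha> * \<kappa>) \<le> L / (\<Phi> r z * (L - \<Phi> r z)) * (2 * stream_of (\<Phi> r) (\<Phi> r z))"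
      using x by simp
  qed
  then show ?thesis using pushed[OF z] by linarith
qed

text \<open>
  Passing from push \<open>n\<close> to push \<open>n + 1\<close> takes time at most proportional to \<open>exp (- \<alpha> * n)\<close>, and these
  times are summable: at the sum of the series every point would have been pushed to \<open>L\<close>.
\<close>
theorem lagrangian_blow_up:
  shows "\<exists>T0. \<forall>J \<Phi>. lagrangian J \<Phi> \<longrightarrow> (\<forall>t\<in>J. t < T0)"
proof -
  define r where "r = exp (- \<alpha>)"
  have r: "0 < r" "r < 1" using alpha_pos by (auto simp: r_def)
  define \<delta> where "\<delta> = 1 / (2 * L * growth_const)"
  have \<delta>: "0 < \<delta>" using L_pos growth_const_pos by (simp add: \<delta>_def)
  define T0 where "T0 = \<delta> / (1 - r)"
  \<comment> \<open>The partial sums of \<open>\<delta> * r ^ n\<close>; by time \<open>\<tau> n\<close> every point has been pushed by \<open>n\<close>.\<close>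
  define \<tau> where "\<tau> n = \<delta> * (1 - r ^ n) / (1 - r)" for n :: nat
  have \<tau>0: "\<tau> 0 = 0" by (simp add: \<tau>_def)
  have \<tau>_Suc: "\<tau> (Suc n) - \<tau> n = \<delta> * r ^ n" for n
  proof -
    have "\<tau> (Suc n) - \<tau> n = \<delta> * r ^ n * (1 - r) / (1 - r)"
      unfolding \<tau>_def diff_divide_distrib[symmetric] by (simp add: algebra_simps)
    then show ?thesis using r by simp
  qed
  have \<tau>_bounds: "0 \<le> \<tau> n" "\<tau> n \<le> T0" for n
    using r \<delta> by (auto simp: \<tau>_def T0_def power_le_one divide_right_mono)
  have False if \<Phi>: "lagrangian J \<Phi>" and t: "t \<in> J" "T0 \<le> t" for J \<Phi> t
  proof -
    have J: "{0..T0} \<subseteq> J"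
      using \<Phi> t unfolding lagrangian_def is_interval_1 by (meson atLeastAtMost_iff order_trans subsetI)
    have T0J: "T0 \<in> J" "0 \<in> J" using J \<tau>_bounds[of 0] \<tau>0 by auto
    have step: "logit z + real n \<le> logit (\<Phi> (\<tau> n) z)" if "z \<in> {0<..<L}" for n z
      using that
    proof (induction n arbitrary: z)
      case 0
      then show ?case using \<Phi> by (simp add: \<tau>0 lagrangian_def)
    next
      case (Suc n)
      have le: "\<tau> n \<le> \<tau> (Suc n)" using \<tau>_Suc[of n] \<delta> r by (smt (verit) mult_nonneg_nonneg zero_le_power)
      have "logit z + real n + 2 * L * growth_const * exp (\<alpha> * real n) * (\<tau> (Suc n) - \<tau> n)
          \<le> logit (\<Phi> (\<tau> (Suc n)) z)"
        using J \<tau>_bounds(1)[of n] \<tau>_bounds(2)[of "Suc n"] le Suc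
        by (intro push_grows[OF \<Phi>]) auto
      moreover have "2 * L * growth_const * exp (\<alpha> * real n) * (\<tau> (Suc n) - \<tau> n) = 1"
      proof -
        have "exp (\<alpha> * real n) * r ^ n = 1"
          by (simp add: r_def exp_of_nat_mult[symmetric] exp_add[symmetric] mult.commute)
        then show ?thesis
          unfolding \<tau>_Suc using L_pos growth_const_pos by (simp add: \<delta>_def field_simps)
      qed
      ultimately show ?case by simp
    qed
    have half: "L / 2 \<in> {0<..<L}" using L_pos by auto
    have "logit (L / 2) + real n \<le> logit (\<Phi> T0 (L / 2))" for n
    proof -
      have "logit (L / 2) + real n + 2 * L * growth_const * exp (\<alpha> * real n) * (T0 - \<tau> n)
          \<le> logit (\<Phi> T0 (L / 2))"
        using J \<tau>_bounds[of n] step half by (intro push_grows[OF \<Phi>]) auto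
      moreover have "0 \<le> 2 * L * growth_const * exp (\<alpha> * real n) * (T0 - \<tau> n)"
        using \<tau>_bounds[of n] L_pos growth_const_pos by simp
      ultimately show ?thesis by linarith
    qed
    moreover obtain n :: nat where "logit (\<Phi> T0 (L / 2)) - logit (L / 2) < real n"
      using reals_Archimedean2 by blast
    ultimately show False by (metis add.commute diff_less_eq not_less)
  qed
  then show ?thesis by (meson not_less)
qed

lemma flow_map_cong:
  assumes "\<And>z. z \<in> {0..L} \<Longrightarrow> F z = F' z"
  shows "flow_map C F \<longleftrightarrow> flow_map C F'"
  using assms L_pos by (auto simp: flow_map_def)

text \<open>
  The flows on half-lines agree where they overlap, so their union is a flow; its half-line is open on the
  right because every flow can be continued.
\<close>
theorem maximal_lagrangian_exists:
  "\<exists>T \<Phi>. lagrangian {..<T} \<Phi> \<and> (\<forall>J \<Psi>. lagrangian J \<Psi> \<longrightarrow> J \<subseteq> {..<T})"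
proof -
  define A where "A = {\<tau>. \<exists>\<Phi>. lagrangian {..\<tau>} \<Phi>}"
  define T where "T = Sup A"
  have A0: "0 \<in> A" using lagrangian_backward by (simp add: A_def)
  have bdd: "bdd_above A"
    using lagrangian_blow_up unfolding A_def bdd_above_def by (fastforce intro: less_imp_le)
  have ext: "t < T" if "lagrangian J \<Psi>" "t \<in> J" "0 \<le> t" for J \<Psi> t
  proof -
    have "\<exists>\<delta>>0. t + \<delta> \<in> A" using lagrangian_extend[OF that] by (simp add: A_def)
    then obtain \<delta> where \<delta>: "0 < \<delta>" "t + \<delta> \<in> A" by blast
    then have "t + \<delta> \<le> T" unfolding T_def using bdd by (intro cSup_upper)
    then show ?thesis using \<delta> by simp
  qed
  have T_pos: "0 < T" using lagrangian_backward ext[of "{..0}" _ 0] by auto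
  have "\<exists>\<tau> \<Psi>. t < \<tau> \<and> 0 \<le> \<tau> \<and> lagrangian {..\<tau>} \<Psi>" if "t < T" for t
  proof -
    have "max t 0 < T" using that T_pos by simp
    then obtain \<tau> where \<tau>: "\<tau> \<in> A" "max t 0 < \<tau>"
      unfolding T_def using less_cSup_iff[of A "max t 0"] A0 bdd by blast
    then obtain \<Psi> where "lagrangian {..\<tau>} \<Psi>" by (auto simp: A_def)
    then show ?thesis using \<tau> by (intro exI[of _ \<tau>] exI[of _ \<Psi>]) auto
  qed
  then obtain \<tau> \<Psi> where \<tau>: "\<And>t. t < T \<Longrightarrow> t < \<tau> t" and \<Psi>: "\<And>t. t < T \<Longrightarrow> lagrangian {..\<tau> t} (\<Psi> t)"
    and \<tau>0: "\<And>t. t < T \<Longrightarrow> 0 \<le> \<tau> t"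
    by metis
  have \<tau>T: "\<tau> t < T" if "t < T" for t
    using ext[OF \<Psi>[OF that], of "\<tau> t"] \<tau>0[OF that] by auto
  define \<Phi> where "\<Phi> t = \<Psi> t t" for t
  have eq: "\<Phi> s z = \<Psi> t s z" if "t < T" "s \<le> \<tau> t" "z \<in> {0..L}" for s t z
  proof -
    have "s < T" using that \<tau>T[of t] by simp
    then show ?thesis
      unfolding \<Phi>_def using that \<tau>[of s] by (intro lagrangian_unique[OF \<Psi> \<Psi>]) auto
  qed
  have "lagrangian {..<T} \<Phi>"
    unfolding lagrangian_def
  proof (intro conjI ballI)
    show "0 \<in> {..<T}" using T_pos by simp
    show "\<Phi> 0 z = z" if "z \<in> {0..L}" for z
      using \<Psi>[OF T_pos] that by (simp add: \<Phi>_def lagrangian_def)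
    fix t assume "t \<in> {..<T}"
    then have t: "t < T" by simp
    obtain C where C: "\<And>s. s \<in> closed_segment 0 t \<Longrightarrow> flow_map C (\<Psi> t s)"
      using \<Psi>[OF t] \<tau>[OF t] unfolding lagrangian_def by (meson atMost_iff less_imp_le)
    have "flow_map C (\<Phi> s)" if s: "s \<in> closed_segment 0 t" for s
    proof -
      have "s \<le> \<tau> t" using s \<tau>[OF t] \<tau>0[OF t] by (auto simp: closed_segment_eq_real_ivl split: if_splits)
      then show ?thesis using C[OF s] flow_map_cong[of "\<Phi> s" "\<Psi> t s"] eq[OF t] by blast
    qed
    then show "\<exists>C. \<forall>s\<in>closed_segment 0 t. flow_map C (\<Phi> s)" by blast
    fix z assume z: "z \<in> {0..L}"
    have "((\<lambda>s. \<Psi> t s z) has_real_derivative 2 * stream_of (\<Psi> t t) (\<Psi> t t z)) (at t within {..\<tau> t})"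
      using \<Psi>[OF t] \<tau>[OF t] z by (auto simp: lagrangian_def)
    then have "((\<lambda>s. \<Psi> t s z) has_real_derivative 2 * stream_of (\<Phi> t) (\<Phi> t z)) (at t)"
      using \<tau>[OF t] by (subst (asm) at_within_interior) (auto simp: \<Phi>_def)
    then have "((\<lambda>s. \<Phi> s z) has_real_derivative 2 * stream_of (\<Phi> t) (\<Phi> t z)) (at t)"
      by (rule has_field_derivative_transform_within_open[where S = "{..<\<tau> t}"])
        (use eq[OF t _ z] \<tau>[OF t] in auto)
    then show "((\<lambda>s. \<Phi> s z) has_real_derivative 2 * stream_of (\<Phi> t) (\<Phi> t z)) (at t within {..<T})"
      by (rule has_field_derivative_at_within)
  qed (auto simp: is_interval_1)
  moreover have "J \<subseteq> {..<T}" if "lagrangian J \<Psi>" for J \<Psi>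
    using ext[OF that] T_pos by (meson lessThan_iff not_less order_less_trans subsetI less_le_trans linear)
  ultimately show ?thesis by blast
qed

end

section \<open>Stream functions of integrable vorticities\<close>

definition indefinite_integral :: "(real \<Rightarrow> real) \<Rightarrow> (real \<Rightarrow> real) \<Rightarrow> bool" where
  "indefinite_integral g \<Gamma> \<longleftrightarrow> (\<forall>a b. a \<le> b \<longrightarrow> (g has_integral (\<Gamma> b - \<Gamma> a)) {a..b})"

lemma indefinite_integralD: "indefinite_integral g \<Gamma> \<Longrightarrow> a \<le> b \<Longrightarrow> (g has_integral (\<Gamma> b - \<Gamma> a)) {a..b}"
  by (simp add: indefinite_integral_def)

lemma indefinite_integral_eq:
  assumes "indefinite_integral g \<Gamma>" "a \<le> b"
  shows "\<Gamma> b = \<Gamma> a + integral {a..b} g"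
  using integral_unique[OF indefinite_integralD[OF assms]] by simp

lemma indefinite_integral_exists:
  assumes "\<And>a b. g integrable_on {a..b}"
  shows "\<exists>\<Gamma>. \<Gamma> 0 = 0 \<and> indefinite_integral g \<Gamma>"
proof -
  define \<Gamma> where "\<Gamma> x = integral {0..x} g - integral {x..0} g" for x
  have combine: "integral {a..c} g + integral {c..b} g = integral {a..b} g" if "a \<le> c" "c \<le> b" for a b c
    using that assms by (intro Henstock_Kurzweil_Integration.integral_combine)
  have "\<Gamma> b - \<Gamma> a = integral {a..b} g" if "a \<le> b" for a b
  proof -
    have zero: "integral {0..x} g = 0" if "x \<le> 0" for x using that by (cases "x = 0") auto
    have zero': "integral {x..0} g = 0" if "0 \<le> x" for x using that by (cases "x = 0") auto
    consider "0 \<le> a" | "a \<le> 0" "0 \<le> b" | "b \<le> 0" by linarith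
    then show ?thesis
      by cases (use that combine[of 0 a b] combine[of a 0 b] combine[of a b 0] zero zero' in
          \<open>simp_all add: \<Gamma>_def\<close>)
  qed
  then have "indefinite_integral g \<Gamma>"
    using assms by (auto simp: indefinite_integral_def has_integral_integral)
  then show ?thesis by (intro exI[of _ \<Gamma>]) (simp add: \<Gamma>_def)
qed

lemma indefinite_integral_continuous:
  assumes "indefinite_integral g \<Gamma>"
  shows "continuous_on S \<Gamma>"
proof -
  have "isCont \<Gamma> x" for x
  proof -
    have "g integrable_on {x - 1..x + 1}" using indefinite_integralD[OF assms, of "x - 1" "x + 1"] by auto
    then have "continuous_on {x - 1..x + 1} (\<lambda>u. \<Gamma> (x - 1) + integral {x - 1..u} g)"
      by (intro continuous_intros indefinite_integral_continuous_1)
    moreover have "\<Gamma> (x - 1) + integral {x - 1..u} g = \<Gamma> u" if "u \<in> {x - 1..x + 1}" for u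
      using indefinite_integral_eq[OF assms, of "x - 1" u] that by simp
    ultimately have "continuous_on {x - 1..x + 1} \<Gamma>" by (rule continuous_on_eq)
    then show ?thesis by (rule continuous_on_interior) simp
  qed
  then show ?thesis by (simp add: continuous_at_imp_continuous_on)
qed

lemma indefinite_integral_deriv:
  assumes \<Gamma>: "indefinite_integral g \<Gamma>" and U: "open U" "x \<in> U" "continuous_on U g"
  shows "(\<Gamma> has_real_derivative g x) (at x)"
proof -
  obtain e where e: "0 < e" "cball x e \<subseteq> U" using U open_contains_cball by blast
  define a b where "a = x - e" and "b = x + e"
  have sub: "{a..b} \<subseteq> U" using e by (auto simp: a_def b_def cball_eq_atLeastAtMost)
  have x: "x \<in> {a<..<b}" using e by (auto simp: a_def b_def)
  have "((\<lambda>u. integral {a..u} g) has_real_derivative g x) (at x within {a..b})"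
    using x by (intro integral_has_real_derivative continuous_on_subset[OF U(3) sub]) auto
  then have "((\<lambda>u. integral {a..u} g) has_real_derivative g x) (at x)"
    using x by (simp add: at_within_Icc_at)
  then have "((\<lambda>u. \<Gamma> a + integral {a..u} g) has_real_derivative g x) (at x)"
    by (auto intro!: derivative_eq_intros)
  then show ?thesis
    by (rule has_field_derivative_transform_within_open[where S = "{a<..<b}"])
      (use x in \<open>auto simp: indefinite_integral_eq[OF \<Gamma>, symmetric]\<close>)
qed

lemma antiderivative_indefinite_integral:
  assumes "\<And>x. (P has_real_derivative f x) (at x)"
  shows "indefinite_integral f P"
  unfolding indefinite_integral_def
proof (intro allI impI fundamental_theorem_of_calculus)
  fix a b x :: real
  show "(P has_vector_derivative f x) (at x within {a..b})"
    using assms[of x] by (simp add: has_real_derivative_iff_has_vector_derivative has_vector_derivative_at_within)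
qed

text \<open>
  The energy \<open>w'\<^sup>2 + 4 w\<^sup>2\<close> is conserved.
\<close>
lemma oscillator_unique:
  fixes w w' :: "real \<Rightarrow> real"
  assumes w: "\<And>x. (w has_real_derivative w' x) (at x)" and w': "\<And>x. (w' has_real_derivative - 4 * w x) (at x)"
    and init: "w a = 0" "w' a = 0"
  shows "w x = 0"
proof -
  have "((\<lambda>x. (w' x)\<^sup>2 + 4 * (w x)\<^sup>2) has_real_derivative 0) (at x)" for x
    by (rule derivative_eq_intros w w' refl | simp add: algebra_simps)+
  then have "(w' x)\<^sup>2 + 4 * (w x)\<^sup>2 = (w' a)\<^sup>2 + 4 * (w a)\<^sup>2" by (intro DERIV_isconst_all) auto
  also have "\<dots> = 0" using init by simp
  finally have "(w x)\<^sup>2 \<le> 0" using zero_le_power2[of "w' x"] by linarith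
  then show ?thesis by simp
qed

lemma continuous_antiderivative:
  fixes f :: "real \<Rightarrow> real"
  assumes "continuous_on UNIV f"
  shows "\<exists>P. P 0 = 0 \<and> (\<forall>x. (P has_real_derivative f x) (at x))"
  using antiderivative_exists[OF assms] by (simp add: has_real_derivative_iff_has_vector_derivative)

locale symmetric_sector = sector +
  fixes m :: nat
  assumes L_eq: "L = pi / real m"
begin

lemma odd_symmetric_iff: "odd_symmetric m f \<longleftrightarrow> (\<forall>x. f (- x) = - f x) \<and> (\<forall>x. f (x + 2 * L) = f x)"
  by (simp add: odd_symmetric_def L_eq)

context
  fixes f :: "real \<Rightarrow> real"
  assumes f: "odd_symmetric m f"
begin

lemma odd_symmetric_minus: "f (- x) = - f x"
  using f by (simp add: odd_symmetric_iff)

lemma odd_symmetric_shift: "f (x + 2 * L * of_int k) = f x"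
proof (induction k rule: int_induct[where k = 0])
  case (step1 k)
  have "f (x + 2 * L * of_int (k + 1)) = f (x + 2 * L * of_int k + 2 * L)" by (simp add: algebra_simps)
  then show ?case using step1 f by (simp add: odd_symmetric_iff)
next
  case (step2 k)
  have "f (x + 2 * L * of_int (k - 1)) = f (x + 2 * L * of_int (k - 1) + 2 * L)"
    using f by (simp add: odd_symmetric_iff)
  then show ?case using step2 by (simp add: algebra_simps)
qed simp

lemma odd_symmetric_reflect: "f (2 * L * of_int k - x) = - f x"
  using odd_symmetric_shift[of "- x" k] odd_symmetric_minus[of x] by simp

lemma odd_symmetric_ends: "f 0 = 0" "f L = 0"
proof -
  show "f 0 = 0" using odd_symmetric_minus[of 0] by simp
  have "f L = f (- L)" using odd_symmetric_shift[of "- L" 1] by simp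
  then show "f L = 0" using odd_symmetric_minus[of L] by simp
qed

end

text \<open>Oddness and periodicity fold the line onto one sector.\<close>
lemma fold_to_sector:
  obtains r k where "r \<in> {0..L}" "x = r + 2 * L * of_int k"
  | r k where "r \<in> {0..L}" "x = - r + 2 * L * of_int k"
proof -
  define k where "k = round (x / (2 * L))"
  have "\<bar>of_int k - x / (2 * L)\<bar> \<le> 1 / 2" unfolding k_def by (rule of_int_round_abs_le)
  then have "2 * L * \<bar>of_int k - x / (2 * L)\<bar> \<le> 2 * L * (1 / 2)"
    using L_pos by (intro mult_left_mono) auto
  moreover have "2 * L * \<bar>of_int k - x / (2 * L)\<bar> = \<bar>2 * L * of_int k - x\<bar>"
    using L_pos by (simp add: abs_mult_pos' algebra_simps)
  ultimately have "\<bar>x - 2 * L * of_int k\<bar> \<le> L" by simp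
  then show thesis
    using that(1)[of "x - 2 * L * of_int k" k] that(2)[of "2 * L * of_int k - x" k] by fastforce
qed

lemma odd_symmetric_eqI:
  assumes f: "odd_symmetric m f" and g: "odd_symmetric m g"
    and eq: "\<And>x. x \<in> {0<..<L} \<Longrightarrow> f x = g x"
  shows "f = g"
proof
  fix x
  have sec: "f r = g r" if "r \<in> {0..L}" for r
    using that eq[of r] odd_symmetric_ends[OF f] odd_symmetric_ends[OF g]
    by (cases "r = 0 \<or> r = L") auto
  show "f x = g x"
    by (cases x rule: fold_to_sector)
      (auto simp: sec odd_symmetric_shift[OF f] odd_symmetric_shift[OF g] odd_symmetric_reflect[OF f]
        odd_symmetric_reflect[OF g])
qed

lemma is_streamE:
  assumes "is_stream m g G"
  obtains D where "odd_symmetric m G" "\<And>x. (G has_real_derivative D x) (at x)"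
    "indefinite_integral (\<lambda>x. g x - 4 * G x) D"
  using assms by (auto simp: is_stream_def indefinite_integral_def)

text \<open>
  A double primitive \<open>H\<close> of \<open>g\<close> carries all the roughness: the remainder \<open>G - H\<close> solves
  \<open>4 R + R'' = - 4 H\<close> with a continuous right-hand side, classically by variation of constants.
\<close>
theorem stream_exists:
  assumes g: "odd_symmetric m g" and int: "\<And>a b. g absolutely_integrable_on {a..b}"
  shows "\<exists>G. is_stream m g G"
proof -
  obtain \<Gamma> where \<Gamma>0: "\<Gamma> 0 = 0" and \<Gamma>: "indefinite_integral g \<Gamma>"
    using indefinite_integral_exists[of g] int absolutely_integrable_on_def by metis
  have \<Gamma>_even: "\<Gamma> (- x) = \<Gamma> x" for x
  proof -
    have pos: "\<Gamma> (- x) = \<Gamma> x" if "0 \<le> x" for x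
    proof -
      have "(g has_integral (\<Gamma> 0 - \<Gamma> (- x))) {- x..0}" using that by (intro indefinite_integralD[OF \<Gamma>]) auto
      then have "((\<lambda>y. g (- y)) has_integral (\<Gamma> 0 - \<Gamma> (- x))) {- 0..- (- x)}"
        by (subst has_integral_reflect_real)
      then have "((\<lambda>y. - g y) has_integral (\<Gamma> 0 - \<Gamma> (- x))) {0..x}" by (simp add: odd_symmetric_minus[OF g])
      moreover have "((\<lambda>y. - g y) has_integral - (\<Gamma> x - \<Gamma> 0)) {0..x}"
        using that by (intro has_integral_neg indefinite_integralD[OF \<Gamma>])
      ultimately have "\<Gamma> 0 - \<Gamma> (- x) = - (\<Gamma> x - \<Gamma> 0)" by (rule has_integral_unique)
      then show ?thesis using \<Gamma>0 by simp
    qed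
    show ?thesis using pos[of x] pos[of "- x"] by (cases "0 \<le> x") auto
  qed
  have \<Gamma>_per: "\<Gamma> (x + 2 * L) = \<Gamma> x" for x
  proof -
    have ord: "\<Gamma> (b + 2 * L) - \<Gamma> (a + 2 * L) = \<Gamma> b - \<Gamma> a" if "a \<le> b" for a b
    proof -
      have "(g has_integral (\<Gamma> (b + 2 * L) - \<Gamma> (a + 2 * L))) {a + 2 * L..b + 2 * L}"
        using that by (intro indefinite_integralD[OF \<Gamma>]) auto
      then have "((\<lambda>x. g (x + 2 * L)) has_integral (\<Gamma> (b + 2 * L) - \<Gamma> (a + 2 * L))) {a..b}"
        using has_integral_shift_real_ivl[of g _ "a + 2 * L" "b + 2 * L" "2 * L"] by simp
      then have "(g has_integral (\<Gamma> (b + 2 * L) - \<Gamma> (a + 2 * L))) {a..b}"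
        using g by (simp add: odd_symmetric_iff)
      then show ?thesis using indefinite_integralD[OF \<Gamma> that] has_integral_unique by blast
    qed
    have "\<Gamma> (- L + 2 * L) = \<Gamma> (- L)" using \<Gamma>_even[of L] by simp
    then show ?thesis using ord[of "- L" x] ord[of x "- L"] by (cases "- L \<le> x") auto
  qed
  obtain H0 where H00: "H0 0 = 0" and H0: "\<And>x. (H0 has_real_derivative \<Gamma> x) (at x)"
    using continuous_antiderivative[OF indefinite_integral_continuous[OF \<Gamma>]] by blast
  \<comment> \<open>Removing a linear part makes the double primitive vanish at \<open>L\<close>, hence periodic.\<close>
  define c where "c = H0 L / L"
  define H where "H x = H0 x - c * x" for x
  have H: "(H has_real_derivative \<Gamma> x - c) (at x)" for x
    unfolding H_def by (auto intro!: derivative_eq_intros H0)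
  have H_odd: "H (- x) = - H x" for x
  proof -
    have "((\<lambda>x. H x + H (- x)) has_real_derivative (\<Gamma> x - c) + (\<Gamma> (- x) - c) * (- 1)) (at x)" for x
      by (intro DERIV_add H DERIV_chain2[OF H]) (auto intro!: derivative_eq_intros)
    then have "H x + H (- x) = H 0 + H (- 0)"
      by (intro DERIV_isconst_all) (simp add: \<Gamma>_even)
    then show ?thesis by (simp add: H_def H00)
  qed
  have HL: "H L = 0" using L_pos by (simp add: H_def c_def)
  have H_per: "H (x + 2 * L) = H x" for x
  proof -
    have "((\<lambda>x. H (x + 2 * L) - H x) has_real_derivative (\<Gamma> (x + 2 * L) - c) * 1 - (\<Gamma> x - c)) (at x)" for x
      by (intro DERIV_diff H DERIV_chain2[OF H]) (auto intro!: derivative_eq_intros)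
    then have "H (x + 2 * L) - H x = H (- L + 2 * L) - H (- L)"
      by (intro DERIV_isconst_all) (simp add: \<Gamma>_per)
    then show ?thesis using HL H_odd[of L] by simp
  qed
  have contH: "continuous_on UNIV H"
    using H by (meson DERIV_isCont continuous_at_imp_continuous_on)
  have cont_cos: "continuous_on UNIV (\<lambda>x. cos (2 * x) * H x)"
    and cont_sin: "continuous_on UNIV (\<lambda>x. sin (2 * x) * H x)"
    by (intro continuous_intros contH)+
  obtain P where P: "\<And>x. (P has_real_derivative cos (2 * x) * H x) (at x)"
    using continuous_antiderivative[OF cont_cos] by blast
  obtain Q where Q0: "Q 0 = 0" and Q: "\<And>x. (Q has_real_derivative sin (2 * x) * H x) (at x)"
    using continuous_antiderivative[OF cont_sin] by blast
  \<comment> \<open>The homogeneous solution \<open>A * sin (2 x)\<close> is chosen so that \<open>R L = 0\<close>; this uses \<open>sin (2 L) \<noteq> 0\<close>.\<close>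
  define A where "A = 2 * (sin (2 * L) * P L - cos (2 * L) * Q L) / \<sigma>"
  define R where "R x = A * sin (2 * x) - 2 * (sin (2 * x) * P x - cos (2 * x) * Q x)" for x
  define R' where "R' x = 2 * A * cos (2 * x) - 4 * (cos (2 * x) * P x + sin (2 * x) * Q x)" for x
  have R: "(R has_real_derivative R' x) (at x)" for x
    unfolding R_def R'_def
    by (rule derivative_eq_intros P Q refl | simp add: algebra_simps)+
  have R': "(R' has_real_derivative - 4 * R x - 4 * H x) (at x)" for x
  proof -
    have "(R' has_real_derivative 2 * A * (- sin (2 * x) * 2) - 4 * ((- sin (2 * x) * 2 * P x + cos (2 * x) * (cos (2 * x) * H x))
        + (cos (2 * x) * 2 * Q x + sin (2 * x) * (sin (2 * x) * H x)))) (at x)"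
      unfolding R'_def by (rule derivative_eq_intros P Q refl | simp)+
    also have "2 * A * (- sin (2 * x) * 2) - 4 * ((- sin (2 * x) * 2 * P x + cos (2 * x) * (cos (2 * x) * H x))
        + (cos (2 * x) * 2 * Q x + sin (2 * x) * (sin (2 * x) * H x)))
        = - 4 * R x - 4 * (((cos (2 * x))\<^sup>2 + (sin (2 * x))\<^sup>2) * H x)"
      by (simp add: R_def algebra_simps power2_eq_square del: sin_cos_squared_add2 sin_cos_squared_add3)
    finally show ?thesis by simp
  qed
  have R0: "R 0 = 0" by (simp add: R_def Q0)
  have RL: "R L = 0" using sigma_pos by (simp add: R_def A_def \<sigma>_def)
  have R_odd: "R (- x) = - R x" for x
  proof -
    have "R x + R (- x) = 0"
    proof (rule oscillator_unique[where w = "\<lambda>x. R x + R (- x)" and w' = "\<lambda>x. R' x - R' (- x)" and a = 0])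
      fix x
      have "((\<lambda>x. R (- x)) has_real_derivative R' (- x) * (- 1)) (at x)"
        by (intro DERIV_chain2[OF R]) (auto intro!: derivative_eq_intros)
      from DERIV_add[OF R this] show "((\<lambda>x. R x + R (- x)) has_real_derivative R' x - R' (- x)) (at x)" by simp
      have "((\<lambda>x. R' (- x)) has_real_derivative (- 4 * R (- x) - 4 * H (- x)) * (- 1)) (at x)"
        by (intro DERIV_chain2[OF R']) (auto intro!: derivative_eq_intros)
      from DERIV_diff[OF R' this] show "((\<lambda>x. R' x - R' (- x)) has_real_derivative - 4 * (R x + R (- x))) (at x)"
        by (simp add: H_odd algebra_simps)
    qed (auto simp: R0)
    then show ?thesis by simp
  qed
  have R'_even: "R' (- x) = R' x" for x
  proof -
    have "((\<lambda>x. - R (- x)) has_real_derivative - (R' (- x) * (- 1))) (at x)"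
      by (intro DERIV_minus DERIV_chain2[OF R]) (auto intro!: derivative_eq_intros)
    then have "(R has_real_derivative R' (- x)) (at x)" by (simp add: R_odd)
    then show ?thesis using R DERIV_unique by blast
  qed
  have R_per: "R (x + 2 * L) = R x" for x
  proof -
    have "R (x + 2 * L) - R x = 0"
    proof (rule oscillator_unique[where w = "\<lambda>x. R (x + 2 * L) - R x" and w' = "\<lambda>x. R' (x + 2 * L) - R' x" and a = "- L"])
      fix x
      have "((\<lambda>x. R (x + 2 * L)) has_real_derivative R' (x + 2 * L) * 1) (at x)"
        by (intro DERIV_chain2[OF R]) (auto intro!: derivative_eq_intros)
      from DERIV_diff[OF this R] show "((\<lambda>x. R (x + 2 * L) - R x) has_real_derivative R' (x + 2 * L) - R' x) (at x)"
        by simp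
      have "((\<lambda>x. R' (x + 2 * L)) has_real_derivative (- 4 * R (x + 2 * L) - 4 * H (x + 2 * L)) * 1) (at x)"
        by (intro DERIV_chain2[OF R']) (auto intro!: derivative_eq_intros)
      from DERIV_diff[OF this R']
      show "((\<lambda>x. R' (x + 2 * L) - R' x) has_real_derivative - 4 * (R (x + 2 * L) - R x)) (at x)"
        unfolding H_per by (simp add: algebra_simps)
    qed (use RL R_odd[of L] R'_even[of L] in auto)
    then show ?thesis by simp
  qed
  define G where "G x = H x + R x" for x
  define D where "D x = (\<Gamma> x - c) + R' x" for x
  have "odd_symmetric m G"
    by (simp add: odd_symmetric_iff G_def H_odd R_odd H_per R_per)
  moreover have "(G has_real_derivative D x) (at x)" for x
    unfolding G_def D_def by (intro DERIV_add H R)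
  moreover have "((\<lambda>x. g x - 4 * G x) has_integral (D b - D a)) {a..b}" if "a \<le> b" for a b
  proof -
    have "((\<lambda>x. - 4 * R x - 4 * H x) has_integral (R' b - R' a)) {a..b}"
      by (rule indefinite_integralD[OF antiderivative_indefinite_integral[OF R'] that])
    from has_integral_add[OF indefinite_integralD[OF \<Gamma> that] this] show ?thesis
      by (simp add: G_def D_def algebra_simps)
  qed
  ultimately show ?thesis
    using int unfolding is_stream_def by blast
qed

definition stream_const :: real where "stream_const = (8 * L\<^sup>2 + 2 * L) / \<sigma> + 1"

lemma stream_const_nonneg: "0 \<le> stream_const"
  using L_pos sigma_pos by (simp add: stream_const_def)

lemma sum_of_angles: "sin (2 * x) * cos (2 * (L - x)) + cos (2 * x) * sin (2 * (L - x)) = \<sigma>"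
proof -
  have "2 * x + 2 * (L - x) = 2 * L" by (simp add: algebra_simps)
  then show ?thesis using sin_add[of "2 * x" "2 * (L - x)"] by (simp only: \<sigma>_def)
qed

text \<open>
  For \<open>y'' + 4 y = q\<close> the combinations \<open>E = sin (2x) y' - 2 cos (2x) y\<close> and
  \<open>F = sin (2(L-x)) y' + 2 cos (2(L-x)) y\<close> have derivatives \<open>sin (2x) q\<close> and \<open>sin (2(L-x)) q\<close>, and
  \<open>y\<close> and \<open>y'\<close> are recovered from \<open>E\<close> and \<open>F\<close> algebraically. Applied to the classical remainder
  \<open>y = G - H\<close> this bounds \<open>G'\<close> without differentiating \<open>g\<close>.
\<close>
lemma stream_lipschitz:
  assumes G: "is_stream m g G" and B: "integral {0..L} (\<lambda>x. \<bar>g x\<bar>) \<le> B"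
  shows "\<bar>G x - G y\<bar> \<le> stream_const * B * \<bar>x - y\<bar>"
proof -
  obtain D where sym: "odd_symmetric m G" and D: "\<And>x. (G has_real_derivative D x) (at x)"
    and weak: "indefinite_integral (\<lambda>x. g x - 4 * G x) D"
    using is_streamE[OF G] by metis
  have int: "\<And>a b. g absolutely_integrable_on {a..b}" using G by (simp add: is_stream_def)
  obtain \<Gamma> where \<Gamma>0: "\<Gamma> 0 = 0" and \<Gamma>: "indefinite_integral g \<Gamma>"
    using indefinite_integral_exists[of g] int absolutely_integrable_on_def by metis
  obtain H where H0: "H 0 = 0" and H: "\<And>x. (H has_real_derivative \<Gamma> x) (at x)"
    using continuous_antiderivative[OF indefinite_integral_continuous[OF \<Gamma>]] by blast
  have \<Gamma>_le: "\<bar>\<Gamma> x\<bar> \<le> B" if x: "x \<in> {0..L}" for x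
  proof -
    have abs_int: "(\<lambda>x. \<bar>g x\<bar>) integrable_on {a..b}" for a b
      using int[of a b] unfolding absolutely_integrable_on_def real_norm_def by blast
    have "\<bar>\<Gamma> x\<bar> = norm (integral {0..x} g)"
      using indefinite_integral_eq[OF \<Gamma>, of 0 x] \<Gamma>0 x by simp
    also have "\<dots> \<le> integral {0..x} (\<lambda>x. \<bar>g x\<bar>)"
      using int abs_int by (intro integral_norm_bound_integral) (auto simp: absolutely_integrable_on_def)
    also have "\<dots> \<le> integral {0..L} (\<lambda>x. \<bar>g x\<bar>)"
      using x abs_int by (intro integral_subset_le) auto
    finally show ?thesis using B by simp
  qed
  have B0: "0 \<le> B" using \<Gamma>_le[of 0] L_pos by auto
  have H_le: "\<bar>H x\<bar> \<le> L * B" if x: "x \<in> {0..L}" for x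
  proof -
    have "norm (H x - H 0) \<le> B * norm (x - 0)"
      by (rule field_differentiable_bound[of "{0..L}" H \<Gamma>])
        (use x L_pos \<Gamma>_le H in \<open>auto intro: has_field_derivative_at_within\<close>)
    also have "\<dots> \<le> B * L" using x B0 by (simp add: mult_left_mono)
    finally show ?thesis using H0 by (simp add: mult.commute)
  qed
  define R where "R x = G x - H x" for x
  define R' where "R' x = D x - \<Gamma> x" for x
  have R: "(R has_real_derivative R' x) (at x)" for x
    unfolding R_def R'_def by (intro DERIV_diff D H)
  have "indefinite_integral (\<lambda>x. - 4 * G x) R'"
    unfolding indefinite_integral_def
  proof (intro allI impI)
    fix a b :: real assume "a \<le> b"
    from has_integral_diff[OF indefinite_integralD[OF weak this] indefinite_integralD[OF \<Gamma> this]]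
    show "((\<lambda>x. - 4 * G x) has_integral (R' b - R' a)) {a..b}" by (simp add: R'_def algebra_simps)
  qed
  moreover have "continuous_on UNIV G"
    using D by (meson DERIV_isCont continuous_at_imp_continuous_on)
  ultimately have "(R' has_real_derivative - 4 * G x) (at x)" for x
    by (intro indefinite_integral_deriv[of _ _ UNIV]) (auto intro!: continuous_intros)
  then have R': "(R' has_real_derivative - 4 * R x - 4 * H x) (at x)" for x by (simp add: R_def)
  define E where "E x = sin (2 * x) * R' x - 2 * cos (2 * x) * R x" for x
  define F where "F x = sin (2 * (L - x)) * R' x + 2 * cos (2 * (L - x)) * R x" for x
  have E: "(E has_real_derivative sin (2 * x) * (- 4 * H x)) (at x)" for x
    unfolding E_def by (rule derivative_eq_intros R R' refl | simp add: algebra_simps)+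
  have F: "(F has_real_derivative sin (2 * (L - x)) * (- 4 * H x)) (at x)" for x
    unfolding F_def by (rule derivative_eq_intros R R' refl | simp add: algebra_simps)+
  have osc_bound: "\<bar>f a - f b\<bar> \<le> 4 * L\<^sup>2 * B"
    if f: "\<And>x. (f has_real_derivative s x * (- 4 * H x)) (at x)" and s: "\<And>x. \<bar>s x\<bar> \<le> 1"
      and ab: "a \<in> {0..L}" "b \<in> {0..L}" for f s a b
  proof -
    have "norm (f a - f b) \<le> 4 * (L * B) * norm (a - b)"
    proof (rule field_differentiable_bound[of "{0..L}" f "\<lambda>x. s x * (- 4 * H x)"])
      fix x assume x: "x \<in> {0..L}"
      have "\<bar>s x\<bar> * \<bar>4 * H x\<bar> \<le> 1 * (4 * (L * B))"
        using s H_le[OF x] by (intro mult_mono) auto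
      then show "norm (s x * (- 4 * H x)) \<le> 4 * (L * B)" by (simp add: abs_mult)
    qed (use f ab in \<open>auto intro: has_field_derivative_at_within\<close>)
    also have "\<dots> \<le> 4 * (L * B) * L" using ab L_pos B0 by (intro mult_left_mono) auto
    finally show ?thesis by (simp add: power2_eq_square mult_ac)
  qed
  have G_ends: "G 0 = 0" "G L = 0" using odd_symmetric_ends[OF sym] by auto
  have D_le: "\<bar>D x\<bar> \<le> stream_const * B" if x: "x \<in> {0..L}" for x
  proof -
    have L: "L \<in> {0..L}" "0 \<in> {0..L}" using L_pos by auto
    have "E 0 = 0" by (simp add: E_def R_def G_ends H0)
    then have E_le: "\<bar>E x\<bar> \<le> 4 * L\<^sup>2 * B"
      using osc_bound[OF E _ x L(2)] by simp
    have "F L = - 2 * H L" by (simp add: F_def R_def G_ends)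
    then have "\<bar>F L\<bar> \<le> 2 * (L * B)" using H_le[OF L(1)] by simp
    then have F_le: "\<bar>F x\<bar> \<le> 4 * L\<^sup>2 * B + 2 * (L * B)"
      using osc_bound[OF F _ x L(1)] by simp
    have "cos (2 * (L - x)) * E x + cos (2 * x) * F x
        = (sin (2 * x) * cos (2 * (L - x)) + cos (2 * x) * sin (2 * (L - x))) * R' x"
      by (simp add: E_def F_def algebra_simps)
    then have "\<sigma> * R' x = cos (2 * (L - x)) * E x + cos (2 * x) * F x"
      by (simp only: sum_of_angles)
    moreover have "\<bar>cos (2 * (L - x)) * E x + cos (2 * x) * F x\<bar> \<le> \<bar>E x\<bar> + \<bar>F x\<bar>"
    proof -
      have "\<bar>cos u * e\<bar> \<le> \<bar>e\<bar>" for u e :: real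
        using mult_right_mono[of "\<bar>cos u\<bar>" 1 "\<bar>e\<bar>"] by (simp add: abs_mult)
      then show ?thesis by (intro order_trans[OF abs_triangle_ineq add_mono])
    qed
    ultimately have "\<bar>\<sigma> * R' x\<bar> \<le> (8 * L\<^sup>2 + 2 * L) * B"
      using E_le F_le by (simp add: algebra_simps)
    then have "\<bar>R' x\<bar> \<le> (8 * L\<^sup>2 + 2 * L) / \<sigma> * B"
      using sigma_pos by (simp add: abs_mult field_simps)
    then show ?thesis
      using \<Gamma>_le[OF x] by (simp add: R'_def stream_const_def algebra_simps)
  qed
  have D_even: "D (- x) = D x" for x
  proof -
    have "((\<lambda>x. - G (- x)) has_real_derivative - (D (- x) * (- 1))) (at x)"
      by (intro DERIV_minus DERIV_chain2[OF D]) (auto intro!: derivative_eq_intros)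
    then have "(G has_real_derivative D (- x)) (at x)" by (simp add: odd_symmetric_minus[OF sym])
    then show ?thesis using D DERIV_unique by blast
  qed
  have D_per: "D (x + 2 * L * of_int k) = D x" for x k
  proof -
    have "((\<lambda>x. G (x + 2 * L * of_int k)) has_real_derivative D (x + 2 * L * of_int k) * 1) (at x)"
      by (intro DERIV_chain2[OF D]) (auto intro!: derivative_eq_intros)
    then have "(G has_real_derivative D (x + 2 * L * of_int k)) (at x)"
      by (simp add: odd_symmetric_shift[OF sym])
    then show ?thesis using D DERIV_unique by blast
  qed
  have D_refl: "D (2 * L * of_int k - x) = D x" for x k
    using D_per[of "- x" k] D_even[of x] by simp
  have "\<bar>D x\<bar> \<le> stream_const * B" for x
    by (cases x rule: fold_to_sector) (auto simp: D_per D_refl D_le)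
  then have "norm (G x - G y) \<le> stream_const * B * norm (x - y)"
    by (intro field_differentiable_bound[of UNIV G D]) (simp_all add: D)
  then show ?thesis by simp
qed

text \<open>
  The functions \<open>E\<close> and \<open>F\<close> of the preceding proof, now formed with \<open>G\<close>: as \<open>g\<close> is continuous inside the
  sector, \<open>G'\<close> is differentiable there.
\<close>
lemma green_representation:
  assumes G: "is_stream m g G" and cont: "continuous_on {0<..<L} g" and x: "x \<in> {0..L}"
  shows "((\<lambda>y. green x y * g y) has_integral - G x) {0..L}"
proof -
  obtain D where sym: "odd_symmetric m G" and D: "\<And>x. (G has_real_derivative D x) (at x)"
    and weak: "indefinite_integral (\<lambda>x. g x - 4 * G x) D"
    using is_streamE[OF G] by metis
  have contG: "continuous_on S G" for S
    using D by (meson DERIV_isCont continuous_at_imp_continuous_on)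
  note contD = indefinite_integral_continuous[OF weak]
  have D': "(D has_real_derivative g y - 4 * G y) (at y)" if "y \<in> {0<..<L}" for y
    using that cont contG by (intro indefinite_integral_deriv[OF weak, of "{0<..<L}"] continuous_intros) auto
  define E where "E x = sin (2 * x) * D x - 2 * cos (2 * x) * G x" for x
  define F where "F x = sin (2 * (L - x)) * D x + 2 * cos (2 * (L - x)) * G x" for x
  have E: "(E has_real_derivative sin (2 * y) * g y) (at y)" if "y \<in> {0<..<L}" for y
    unfolding E_def by (rule derivative_eq_intros D D'[OF that] refl | simp add: algebra_simps)+
  have F: "(F has_real_derivative sin (2 * (L - y)) * g y) (at y)" if "y \<in> {0<..<L}" for y
    unfolding F_def by (rule derivative_eq_intros D D'[OF that] refl | simp add: algebra_simps)+
  have contE: "continuous_on S E" and contF: "continuous_on S F" for S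
    unfolding E_def F_def by (intro continuous_intros contD contG)+
  have "((\<lambda>y. sin (2 * y) * g y) has_integral (E x - E 0)) {0..x}"
    using x E contE by (intro fundamental_theorem_of_calculus_interior)
      (auto simp: has_real_derivative_iff_has_vector_derivative[symmetric])
  from has_integral_mult_right[OF this, of "sin (2 * (L - x)) / (2 * \<sigma>)"]
  have left: "((\<lambda>y. green x y * g y) has_integral sin (2 * (L - x)) / (2 * \<sigma>) * (E x - E 0)) {0..x}"
    by (rule has_integral_eq[rotated]) (use x in \<open>auto simp: green_def min_def max_def\<close>)
  have "((\<lambda>y. sin (2 * (L - y)) * g y) has_integral (F L - F x)) {x..L}"
    using x F contF by (intro fundamental_theorem_of_calculus_interior)
      (auto simp: has_real_derivative_iff_has_vector_derivative[symmetric])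
  from has_integral_mult_right[OF this, of "sin (2 * x) / (2 * \<sigma>)"]
  have right: "((\<lambda>y. green x y * g y) has_integral sin (2 * x) / (2 * \<sigma>) * (F L - F x)) {x..L}"
    by (rule has_integral_eq[rotated]) (use x in \<open>auto simp: green_def min_def max_def\<close>)
  have "sin (2 * (L - x)) * E x - sin (2 * x) * F x
      = - 2 * (sin (2 * x) * cos (2 * (L - x)) + cos (2 * x) * sin (2 * (L - x))) * G x"
    by (simp add: E_def F_def algebra_simps)
  then have alg: "sin (2 * (L - x)) * E x - sin (2 * x) * F x = - 2 * \<sigma> * G x"
    by (simp only: sum_of_angles)
  have ends: "E 0 = 0" "F L = 0" using odd_symmetric_ends[OF sym] by (auto simp: E_def F_def)
  have "sin (2 * (L - x)) / (2 * \<sigma>) * (E x - E 0) + sin (2 * x) / (2 * \<sigma>) * (F L - F x)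
      = (sin (2 * (L - x)) * E x - sin (2 * x) * F x) / (2 * \<sigma>)"
    by (simp add: ends diff_divide_distrib)
  also have "\<dots> = - G x" unfolding alg using sigma_pos by simp
  finally show ?thesis
    using has_integral_combine[OF _ _ left right] x by simp
qed

lemma flow_map_inverse:
  assumes F: "flow_map C F"
  shows "flow_map C (inv_into {0..L} F)"
    and "\<And>y. y \<in> {0..L} \<Longrightarrow> inv_into {0..L} F y \<in> {0..L} \<and> F (inv_into {0..L} F y) = y"
    and "\<And>z. z \<in> {0..L} \<Longrightarrow> inv_into {0..L} F (F z) = z"
proof -
  let ?I = "inv_into {0..L} F"
  have inj: "inj_on F {0..L}"
    by (rule inj_onI) (metis flow_map_less_iff[OF F] less_irrefl linorder_less_linear)
  have ends: "F 0 = 0" "F L = L" using F by (auto simp: flow_map_def)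
  have img: "y \<in> F ` {0..L}" if "y \<in> {0..L}" for y
  proof -
    have "\<exists>z. 0 \<le> z \<and> z \<le> L \<and> F z = y"
      using that L_pos ends by (intro IVT' flow_map_continuous[OF F]) auto
    then show ?thesis by auto
  qed
  show I: "?I y \<in> {0..L} \<and> F (?I y) = y" if "y \<in> {0..L}" for y
    using inv_into_into[OF img[OF that]] f_inv_into_f[OF img[OF that]] by simp
  show I': "?I (F z) = z" if "z \<in> {0..L}" for z
    by (rule inv_into_f_f[OF inj that])
  show "flow_map C ?I"
    unfolding flow_map_def
  proof (intro conjI allI impI)
    show "?I 0 = 0" "?I L = L" using I'[of 0] I'[of L] ends L_pos by auto
    fix a b assume ab: "0 \<le> a \<and> a \<le> b \<and> b \<le> L"
    then have Ia: "?I a \<in> {0..L}" "F (?I a) = a" and Ib: "?I b \<in> {0..L}" "F (?I b) = b"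
      using I[of a] I[of b] by auto
    have "?I a \<le> ?I b"
      using flow_map_less_iff[OF F Ib(1) Ia(1)] Ia Ib ab by (simp add: not_less[symmetric])
    then have "?I b - ?I a \<le> C * (F (?I b) - F (?I a)) \<and> F (?I b) - F (?I a) \<le> C * (?I b - ?I a)"
      using F[unfolded flow_map_def, THEN conjunct2, THEN conjunct2, rule_format, of "?I a" "?I b"]
        Ia(1) Ib(1) by simp
    then show "b - a \<le> C * (?I b - ?I a)" "?I b - ?I a \<le> C * (b - a)"
      unfolding Ia(2) Ib(2) by auto
  qed
qed

text \<open>
  Layer-cake formula: \<open>\<phi> y powr (- \<alpha>)\<close> with \<open>\<phi> = F\<^sup>-\<^sup>1\<close> is \<open>L powr (- \<alpha>)\<close> plus the integral of \<open>wt\<close> over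
  the \<open>z\<close> with \<open>y < F z\<close>, and the order of integration is exchanged. This removes the inverse flow
  from the Biot-Savart law.
\<close>
lemma stream_eq_stream_of:
  assumes G: "is_stream m g G" and F: "flow_map C F"
    and g: "\<And>z. z \<in> {0<..<L} \<Longrightarrow> g (F z) = - (z powr (- \<alpha>))" and x: "x \<in> {0..L}"
  shows "G x = stream_of F x"
proof -
  define \<phi> where "\<phi> = inv_into {0..L} F"
  note inv = flow_map_inverse[OF F, folded \<phi>_def]
  have \<phi>_in: "\<phi> y \<in> {0<..<L}" if "y \<in> {0<..<L}" for y
    by (rule flow_map_interior[OF inv(1) that])
  have g_eq: "g y = - (\<phi> y powr (- \<alpha>))" if y: "y \<in> {0<..<L}" for y
    using g[OF \<phi>_in[OF y]] inv(2)[of y] y by auto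
  have "continuous_on {0<..<L} (\<lambda>y. - (\<phi> y powr (- \<alpha>)))"
    using \<phi>_in by (intro continuous_intros continuous_on_subset[OF flow_map_continuous[OF inv(1)]]) force+
  then have cont: "continuous_on {0<..<L} g"
    by (rule continuous_on_eq) (simp add: g_eq)
  have adm: "admissible C F" by (rule flow_map_admissible[OF F order_refl])
  let ?c = "L powr (- \<alpha>)"
  have mass: "(green x has_integral green_mass x L) {0..L}"
    unfolding green_mass_def by (rule integrable_integral[OF green_integrable])
  have int1: "((\<lambda>y. green x y * (- g y - ?c)) has_integral (G x - ?c * green_mass x L)) {0..L}"
    using has_integral_diff[OF has_integral_neg[OF green_representation[OF G cont x]]
        has_integral_mult_right[OF mass, of ?c]]
    by (simp add: algebra_simps)
  have int2: "((\<lambda>z. wt z * green_mass x (F z)) has_integral (stream_of F x - ?c * green_mass x L)) {0..L}"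
    unfolding stream_of_def using integrable_integral[OF stream_of_integrable'[OF adm x]] by simp
  have tail: "(wt has_integral (\<phi> y powr (- \<alpha>) - ?c)) {\<phi> y..L}" if y: "y \<in> {0<..<L}" for y
  proof -
    have "(wt has_integral (- (L powr (- \<alpha>)) - - (\<phi> y powr (- \<alpha>)))) {\<phi> y..L}"
    proof (rule fundamental_theorem_of_calculus)
      fix z assume z: "z \<in> {\<phi> y..L}"
      have "((\<lambda>z. - (z powr (- \<alpha>))) has_real_derivative wt z) (at z)"
        unfolding wt_def using z \<phi>_in[OF y] by (auto intro!: derivative_eq_intros)
      then show "((\<lambda>z. - (z powr (- \<alpha>))) has_vector_derivative wt z) (at z within {\<phi> y..L})"
        by (simp add: has_real_derivative_iff_has_vector_derivative has_vector_derivative_at_within)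
    qed (use \<phi>_in[OF y] in auto)
    then show ?thesis by simp
  qed
  have pos_g: "0 \<le> - g y - ?c" if y: "y \<in> {0<..<L}" for y
    using has_integral_nonneg[OF tail[OF y]] wt_nonneg g_eq[OF y] by simp
  have nonneg1: "0 \<le> green x y * (- g y - ?c)" if "y \<in> {0..L}" for y
  proof (cases "y = 0 \<or> y = L")
    case True
    then have "green x y = 0" using x by (auto simp: green_def)
    then show ?thesis by simp
  next
    case False
    then show ?thesis using that pos_g[of y] green_nonneg[OF x that] by auto
  qed
  have nonneg2: "0 \<le> wt z * green_mass x (F z)" if "z \<in> {0..L}" for z
    using admissibleD[OF adm that] x by (intro mult_nonneg_nonneg wt_nonneg green_mass_nonneg) auto
  define F' where "F' z = F (max 0 (min L z))" for z
  have F'[simp]: "F' z = F z" if "z \<in> {0..L}" for z using that by (auto simp: F'_def)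
  have contF': "continuous_on UNIV F'"
    unfolding F'_def using L_pos
    by (intro continuous_on_compose2[OF flow_map_continuous[OF F]] continuous_intros) auto
  \<comment> \<open>Tonelli for \<open>green x y * wt z\<close> on the region \<open>y < F z\<close>, which is \<open>\<phi> y < z\<close>. Clamping the argument of \<open>F\<close>
    makes this region open in the plane.\<close>
  let ?f = "\<lambda>y. ennreal (green x y) * indicator {0<..<L} y"
  let ?h = "\<lambda>z. ennreal (wt z) * indicator {0<..<L} z"
  let ?k = "\<lambda>y z. ?f y * ?h z * indicator {p. fst p < F' (snd p)} (y, z)"
  have "open {p :: real \<times> real. fst p < F' (snd p)}"
    by (intro open_Collect_less continuous_intros continuous_on_compose2[OF contF']) auto
  then have meas_set: "{p :: real \<times> real. fst p < F' (snd p)} \<in> sets (lborel \<Otimes>\<^sub>M lborel)"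
    by (simp only: lborel_prod sets_lborel borel_open)
  have meas_green[measurable]: "green x \<in> borel_measurable borel"
    by (simp add: borel_measurable_continuous_onI continuous_on_green)
  have meas_wt[measurable]: "wt \<in> borel_measurable borel"
    unfolding wt_def by measurable
  have meas: "case_prod ?k \<in> borel_measurable (lborel \<Otimes>\<^sub>M lborel)"
    using meas_green meas_wt meas_set by (simp add: case_prod_beta' measurable_split_conv) measurable
  have inner1: "(\<integral>\<^sup>+z. ?k y z \<partial>lborel) = ennreal (green x y * (- g y - ?c)) * indicator {0..L} y" for y
  proof (cases "y \<in> {0<..<L}")
    case y: True
    have "(\<integral>\<^sup>+z. ?k y z \<partial>lborel) = (\<integral>\<^sup>+z. ennreal (green x y) * (ennreal (wt z) * indicator {\<phi> y..L} z) \<partial>lborel)"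
    proof (rule nn_integral_cong_AE)
      have "AE z in lborel. z \<noteq> \<phi> y \<and> z \<noteq> L"
        by (intro AE_conjI AE_lborel_singleton)
      then show "AE z in lborel. ?k y z = ennreal (green x y) * (ennreal (wt z) * indicator {\<phi> y..L} z)"
      proof eventually_elim
        case (elim z)
        have "y < F z \<longleftrightarrow> \<phi> y < z" if "z \<in> {0..L}"
          using flow_map_less_iff[OF F, of "\<phi> y" z] inv(2)[of y] y that by auto
        then show ?case
          using y elim \<phi>_in[OF y] by (auto simp: indicator_def)
      qed
    qed
    also have "\<dots> = ennreal (green x y) * (\<integral>\<^sup>+z. ennreal (wt z) * indicator {\<phi> y..L} z \<partial>lborel)"
      by (rule nn_integral_cmult) (auto intro!: borel_measurable_times_ennreal borel_measurable_indicator)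
    also have "(\<integral>\<^sup>+z. ennreal (wt z) * indicator {\<phi> y..L} z \<partial>lborel) = ennreal (\<phi> y powr (- \<alpha>) - ?c)"
      by (rule nn_integral_has_integral_lebesgue'[OF wt_nonneg tail[OF y]])
    also have "ennreal (green x y) * ennreal (\<phi> y powr (- \<alpha>) - ?c)
        = ennreal (green x y * (\<phi> y powr (- \<alpha>) - ?c))"
      using green_nonneg[OF x, of y] y by (intro ennreal_mult'[symmetric]) auto
    finally show ?thesis using y g_eq[OF y] by simp
  next
    case y: False
    then have "green x y = 0" if "y \<in> {0..L}" using that x by (cases "y = 0") (auto simp: green_def)
    then show ?thesis using y by (auto simp: indicator_def)
  qed
  have inner2: "(\<integral>\<^sup>+y. ?k y z \<partial>lborel) = ennreal (wt z * green_mass x (F z)) * indicator {0<..<L} z" for z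
  proof (cases "z \<in> {0<..<L}")
    case z: True
    have Fz: "F z \<in> {0<..<L}" by (rule flow_map_interior[OF F z])
    have "(\<integral>\<^sup>+y. ?k y z \<partial>lborel) = (\<integral>\<^sup>+y. ennreal (wt z) * (ennreal (green x y) * indicator {0..F z} y) \<partial>lborel)"
    proof (rule nn_integral_cong_AE)
      have "AE y in lborel. y \<noteq> 0 \<and> y \<noteq> F z"
        by (intro AE_conjI AE_lborel_singleton)
      then show "AE y in lborel. ?k y z = ennreal (wt z) * (ennreal (green x y) * indicator {0..F z} y)"
        by eventually_elim (use z Fz in \<open>auto simp: indicator_def mult.commute\<close>)
    qed
    also have "\<dots> = ennreal (wt z) * (\<integral>\<^sup>+y. ennreal (green x y) * indicator {0..F z} y \<partial>lborel)"
      by (rule nn_integral_cmult) (auto intro!: borel_measurable_times_ennreal borel_measurable_indicator)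
    also have "(\<integral>\<^sup>+y. ennreal (green x y) * indicator {0..F z} y \<partial>lborel) = ennreal (green_mass x (F z))"
      unfolding green_mass_def using Fz green_nonneg[OF x]
      by (intro nn_integral_has_integral_lebesgue' integrable_integral green_integrable) auto
    also have "ennreal (wt z) * ennreal (green_mass x (F z)) = ennreal (wt z * green_mass x (F z))"
      by (intro ennreal_mult'[symmetric] wt_nonneg)
    finally show ?thesis using z by simp
  qed (auto simp: indicator_def)
  have "ennreal (G x - ?c * green_mass x L) = (\<integral>\<^sup>+y. (\<integral>\<^sup>+z. ?k y z \<partial>lborel) \<partial>lborel)"
    unfolding inner1 using nn_integral_has_integral_lebesgue'[OF nonneg1 int1] by simp
  also have "\<dots> = (\<integral>\<^sup>+z. (\<integral>\<^sup>+y. ?k y z \<partial>lborel) \<partial>lborel)"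
    by (rule lborel_pair.Fubini'[OF meas, symmetric])
  also have "\<dots> = (\<integral>\<^sup>+z. ennreal (wt z * green_mass x (F z)) * indicator {0..L} z \<partial>lborel)"
    unfolding inner2
  proof (rule nn_integral_cong_AE)
    have "AE z in lborel. z \<noteq> 0 \<and> z \<noteq> L" by (intro AE_conjI AE_lborel_singleton)
    then show "AE z in lborel. ennreal (wt z * green_mass x (F z)) * indicator {0<..<L} z
        = ennreal (wt z * green_mass x (F z)) * indicator {0..L} z"
      by eventually_elim (auto simp: indicator_def)
  qed
  also have "\<dots> = ennreal (stream_of F x - ?c * green_mass x L)"
    by (rule nn_integral_has_integral_lebesgue'[OF nonneg2 int2])
  finally have "ennreal (G x - ?c * green_mass x L) = ennreal (stream_of F x - ?c * green_mass x L)" .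
  moreover have "0 \<le> G x - ?c * green_mass x L" using has_integral_nonneg[OF int1 nonneg1] .
  moreover have "0 \<le> stream_of F x - ?c * green_mass x L" using has_integral_nonneg[OF int2 nonneg2] .
  ultimately show ?thesis by simp
qed

end

section \<open>Eulerian solutions and Lagrangian flows\<close>

lemma periodic_integrable:
  fixes f :: "real \<Rightarrow> real"
  assumes per: "\<And>x. f (x + p) = f x" and p: "0 < p" and int: "f integrable_on {c..c + p}"
  shows "f integrable_on {a..b}"
proof -
  have right: "f integrable_on {c + of_nat n * p..c + of_nat (Suc n) * p}" for n
  proof (induction n)
    case (Suc n)
    have "(f has_integral integral {c + of_nat n * p..c + of_nat (Suc n) * p} f) {c + of_nat n * p..c + of_nat (Suc n) * p}"
      using Suc by (rule integrable_integral)
    from has_integral_shift_real_ivl[OF this, of "- p"]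
    have "(\<lambda>x. f (x - p)) integrable_on {c + of_nat (Suc n) * p..c + of_nat (Suc (Suc n)) * p}"
      by (auto simp: algebra_simps integrable_on_def)
    moreover have "f (x - p) = f x" for x using per[of "x - p"] by simp
    ultimately show ?case by simp
  qed (use int in simp)
  have left: "f integrable_on {c - of_nat n * p..c + p - of_nat n * p}" for n
  proof (induction n)
    case (Suc n)
    have "(f has_integral integral {c - of_nat n * p..c + p - of_nat n * p} f) {c - of_nat n * p..c + p - of_nat n * p}"
      using Suc by (rule integrable_integral)
    from has_integral_shift_real_ivl[OF this, of p]
    have "(\<lambda>x. f (x + p)) integrable_on {c - of_nat (Suc n) * p..c + p - of_nat (Suc n) * p}"
      by (auto simp: algebra_simps integrable_on_def)
    then show ?case by (simp add: per)
  qed (use int in simp)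
  have wide: "f integrable_on {c - of_nat n * p..c + of_nat (Suc n) * p}" for n
  proof (induction n)
    case (Suc n)
    have "f integrable_on {c - of_nat (Suc n) * p..c - of_nat n * p}"
      using left[of "Suc n"] by (simp add: algebra_simps)
    from Henstock_Kurzweil_Integration.integrable_combine[OF _ _ this Suc]
    have "f integrable_on {c - of_nat (Suc n) * p..c + of_nat (Suc n) * p}"
      using p by (simp add: algebra_simps add_nonneg_nonneg)
    from Henstock_Kurzweil_Integration.integrable_combine[OF _ _ this right[of "Suc n"]]
    show ?case using p by (simp add: algebra_simps add_nonneg_nonneg)
  qed (use int in simp)
  obtain n :: nat where n: "(\<bar>a\<bar> + \<bar>b\<bar> + \<bar>c\<bar>) / p < of_nat n" using reals_Archimedean2 by blast
  then have "\<bar>a\<bar> + \<bar>b\<bar> + \<bar>c\<bar> < of_nat n * p" using p by (simp add: field_simps)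
  then have "{a..b} \<subseteq> {c - of_nat n * p..c + of_nat (Suc n) * p}" using p by (auto simp: algebra_simps)
  then show ?thesis by (rule integrable_on_subinterval[OF wide])
qed

lemma absolutely_integrable_imp_lebesgue_measurable:
  fixes f :: "real \<Rightarrow> real"
  assumes "\<And>a b. f absolutely_integrable_on {a..b}"
  shows "f \<in> borel_measurable lebesgue"
proof (rule borel_measurable_LIMSEQ_real)
  fix n :: nat
  have "f integrable_on {- real n..real n}" using assms by (auto simp: absolutely_integrable_on_def)
  then have "f \<in> borel_measurable (lebesgue_on {- real n..real n})" by (rule integrable_imp_measurable)
  then show "(\<lambda>x. if x \<in> {- real n..real n} then f x else 0) \<in> borel_measurable lebesgue"
    by (rule borel_measurable_if_I) simp
next
  fix x :: real
  obtain N :: nat where N: "\<bar>x\<bar> < real N" using reals_Archimedean2 by blast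
  have "eventually (\<lambda>n. (if x \<in> {- real n..real n} then f x else 0) = f x) sequentially"
    using eventually_ge_at_top[of N] by eventually_elim (use N in auto)
  then show "(\<lambda>n. if x \<in> {- real n..real n} then f x else 0) \<longlonglongrightarrow> f x"
    by (rule tendsto_eventually)
qed

context symmetric_sector
begin

lemma m_pos: "0 < m"
  using L_pos L_eq by (cases "m = 0") auto

lemma odd_symmetric_ext_sector: "x \<in> {0<..<L} \<Longrightarrow> odd_symmetric_ext m f x = f x"
  using odd_symmetric_ext_eq[of x m f] by (simp add: L_eq)

lemma odd_symmetric_ext_sym: "odd_symmetric m (odd_symmetric_ext m f)"
  by (rule odd_symmetric_ext[OF m_pos])

lemma powr_has_integral: "((\<lambda>y. y powr (- \<alpha>)) has_integral L powr (1 - \<alpha>) / (1 - \<alpha>)) {0..L}"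
  using has_integral_powr_from_0[of "- \<alpha>" L] alpha_less L_pos by (simp add: add.commute)

lemma odd_symmetric_absolutely_integrable:
  assumes f: "odd_symmetric m f" and cont: "continuous_on {0<..<L} f"
    and bound: "\<And>y. y \<in> {0<..<L} \<Longrightarrow> \<bar>f y\<bar> \<le> C * y powr (- \<alpha>)"
  shows "f absolutely_integrable_on {a..b}"
proof -
  have neg: "negligible {z. z \<in> {0..L} - {0<..<L} \<and> h z \<noteq> 0}"
    "negligible {z. z \<in> {0<..<L} - {0..L} \<and> h z \<noteq> 0}" for h :: "real \<Rightarrow> real"
    by (rule negligible_subset[of "{0, L}"]; auto)+
  have "f absolutely_integrable_on {0<..<L}"
  proof (rule measurable_bounded_by_integrable_imp_absolutely_integrable)
    show "f \<in> borel_measurable (lebesgue_on {0<..<L})"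
      by (intro continuous_imp_measurable_on_sets_lebesgue cont) auto
    have "(\<lambda>y. C * y powr (- \<alpha>)) integrable_on {0..L}"
      using powr_has_integral by (intro integrable_on_mult_right) blast
    then show "(\<lambda>y. C * y powr (- \<alpha>)) integrable_on {0<..<L}"
      using neg by (rule integrable_spike_set)
  qed (use bound in auto)
  then have right: "f absolutely_integrable_on {0..L}"
    by (rule absolutely_integrable_spike_set[OF _ neg(2) neg(1)])
  then have "(\<lambda>x. f (- x)) absolutely_integrable_on {- L..- 0}"
    by (subst absolutely_integrable_reflect_real)
  then have left: "f absolutely_integrable_on {- L..0}"
    by (simp add: odd_symmetric_minus[OF f] absolutely_integrable_on_def integrable_neg_iff)
  have whole: "h integrable_on {a..b}"
    if "h integrable_on {- L..0}" "h integrable_on {0..L}" "\<And>x. h (x + 2 * L) = h x" for h :: "real \<Rightarrow> real"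
  proof (rule periodic_integrable[where f = h and p = "2 * L" and c = "- L"])
    show "h integrable_on {- L..- L + 2 * L}"
      using Henstock_Kurzweil_Integration.integrable_combine[OF _ _ that(1,2)] L_pos by simp
  qed (use L_pos that(3) in auto)
  have "f integrable_on {a..b}"
    by (rule whole) (use left right f in \<open>auto simp: absolutely_integrable_on_def odd_symmetric_iff\<close>)
  moreover have "(\<lambda>x. norm (f x)) integrable_on {a..b}"
    by (rule whole) (use left right f in \<open>auto simp: absolutely_integrable_on_def odd_symmetric_iff\<close>)
  ultimately show ?thesis by (simp add: absolutely_integrable_on_def)
qed

abbreviation initial_datum :: "real \<Rightarrow> real" where
  "initial_datum \<equiv> odd_symmetric_ext m (\<lambda>\<theta>. - (\<theta> powr (- \<alpha>)))"

definition carries :: "(real \<Rightarrow> real) \<Rightarrow> (real \<Rightarrow> real) \<Rightarrow> bool" where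
  "carries F g \<longleftrightarrow> (\<forall>z\<in>{0<..<L}. g (F z) = - (z powr (- \<alpha>)))"

lemma carries_unique:
  assumes F: "flow_map C F" and g: "odd_symmetric m g" "carries F g" and h: "odd_symmetric m h" "carries F h"
  shows "g = h"
proof (rule odd_symmetric_eqI[OF g(1) h(1)])
  fix y assume y: "y \<in> {0<..<L}"
  have "inv_into {0..L} F y \<in> {0<..<L}" by (rule flow_map_interior[OF flow_map_inverse(1)[OF F] y])
  then have "g (F (inv_into {0..L} F y)) = h (F (inv_into {0..L} F y))"
    using g(2) h(2) by (simp add: carries_def)
  then show "g y = h y" using flow_map_inverse(2)[OF F, of y] y by auto
qed

lemma AE_bound_integral:
  assumes int: "g absolutely_integrable_on {0..L}"
    and bound: "AE \<theta> in lebesgue. 0 < \<theta> \<and> \<theta> < L \<longrightarrow> \<bar>\<theta> powr \<alpha> * g \<theta>\<bar> \<le> C"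
  shows "integral {0..L} (\<lambda>x. \<bar>g x\<bar>) \<le> \<bar>C\<bar> * (L powr (1 - \<alpha>) / (1 - \<alpha>))"
proof -
  obtain N where N: "N \<in> null_sets lebesgue"
    and out: "{\<theta>. \<not> (0 < \<theta> \<and> \<theta> < L \<longrightarrow> \<bar>\<theta> powr \<alpha> * g \<theta>\<bar> \<le> C)} \<subseteq> N"
    using bound unfolding eventually_ae_filter by auto
  define S where "S = N \<union> {0, L}"
  have S: "negligible S"
    using N unfolding S_def negligible_iff_null_sets[symmetric] by (auto intro: negligible_Un)
  let ?g = "\<lambda>x. if x \<in> S then 0 else \<bar>g x\<bar>"
  have abs_int: "(\<lambda>x. \<bar>g x\<bar>) integrable_on {0..L}"
    using int unfolding absolutely_integrable_on_def real_norm_def by blast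
  have "integral {0..L} (\<lambda>x. \<bar>g x\<bar>) = integral {0..L} ?g"
    by (rule integral_spike[OF S]) auto
  also have "\<dots> \<le> integral {0..L} (\<lambda>y. \<bar>C\<bar> * y powr (- \<alpha>))"
  proof (rule integral_le)
    show "?g integrable_on {0..L}" by (rule integrable_spike[OF abs_int S]) auto
    show "(\<lambda>y. \<bar>C\<bar> * y powr (- \<alpha>)) integrable_on {0..L}"
      using powr_has_integral by (intro integrable_on_mult_right) blast
    fix x assume x: "x \<in> {0..L}"
    show "?g x \<le> \<bar>C\<bar> * x powr (- \<alpha>)"
    proof (cases "x \<in> S")
      case False
      then have x0: "0 < x" "x < L" and "x \<notin> N" using x by (auto simp: S_def)
      then have "\<bar>x powr \<alpha> * g x\<bar> \<le> C" using out by blast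
      then have "x powr \<alpha> * \<bar>g x\<bar> \<le> \<bar>C\<bar>" by (simp add: abs_mult)
      then have "\<bar>g x\<bar> \<le> \<bar>C\<bar> / x powr \<alpha>" using x0 by (simp add: field_simps)
      then show ?thesis using False by (simp add: powr_minus divide_inverse)
    qed simp
  qed
  also have "\<dots> = \<bar>C\<bar> * (L powr (1 - \<alpha>) / (1 - \<alpha>))"
    by (intro integral_unique has_integral_mult_right powr_has_integral)
  finally show ?thesis .
qed

text \<open>
  The bound on \<open>\<theta> powr \<alpha> * h t \<theta>\<close> makes \<open>G t\<close> Lipschitz uniformly on compact time intervals. Gronwall's
  inequality then confines the flow to the sector and makes it bi-Lipschitz, so that the layer-cake formula
  applies.
\<close>
theorem solution_lagrangian:
  assumes sol: "is_solution m \<alpha> initial_datum J h"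
  shows "\<exists>\<Phi>. lagrangian J \<Phi> \<and> (\<forall>t\<in>J. carries (\<Phi> t) (h t))"
proof -
  have J: "is_interval J" "0 \<in> J" using sol by (auto simp: is_solution_def)
  have bounded: "\<exists>C. \<forall>t\<in>K. AE \<theta> in lebesgue. 0 < \<theta> \<and> \<theta> < L \<longrightarrow> \<bar>\<theta> powr \<alpha> * h t \<theta>\<bar> \<le> C"
    if "compact K" "K \<subseteq> J" for K
    using sol that unfolding is_solution_def L_eq by blast
  have "\<exists>G \<Phi>. (\<forall>t\<in>J. is_stream m (h t) (G t)) \<and> (\<forall>\<theta>. \<Phi> 0 \<theta> = \<theta>) \<and>
      (\<forall>\<theta>. \<forall>t\<in>J. ((\<lambda>s. \<Phi> s \<theta>) has_real_derivative 2 * G t (\<Phi> t \<theta>)) (at t within J)) \<and>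
      (\<forall>\<theta>. \<forall>t\<in>J. h t (\<Phi> t \<theta>) = initial_datum \<theta>)"
    using sol unfolding is_solution_def by (elim conjE)
  then obtain G \<Phi> where G: "\<And>t. t \<in> J \<Longrightarrow> is_stream m (h t) (G t)" and \<Phi>0: "\<And>\<theta>. \<Phi> 0 \<theta> = \<theta>"
    and \<Phi>: "\<And>\<theta> t. t \<in> J \<Longrightarrow> ((\<lambda>s. \<Phi> s \<theta>) has_real_derivative 2 * G t (\<Phi> t \<theta>)) (at t within J)"
    and carried: "\<And>\<theta> t. t \<in> J \<Longrightarrow> h t (\<Phi> t \<theta>) = initial_datum \<theta>"
    by metis
  have carries: "carries (\<Phi> t) (h t)" if "t \<in> J" for t
    unfolding carries_def using carried[OF that] odd_symmetric_ext_sector by simp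
  have flow: "\<exists>C. \<forall>s\<in>closed_segment 0 t. flow_map C (\<Phi> s)" if t: "t \<in> J" for t
  proof -
    note sub = closed_segment_0_subset_interval[OF J t]
    obtain C where C: "\<And>s. s \<in> closed_segment 0 t \<Longrightarrow>
        AE \<theta> in lebesgue. 0 < \<theta> \<and> \<theta> < L \<longrightarrow> \<bar>\<theta> powr \<alpha> * h s \<theta>\<bar> \<le> C"
      using bounded[OF compact_segment sub] by blast
    define K where "K = 2 * (stream_const * (\<bar>C\<bar> * (L powr (1 - \<alpha>) / (1 - \<alpha>))))"
    have K: "0 \<le> K" using stream_const_nonneg alpha_less by (simp add: K_def)
    have lip: "\<bar>2 * G s x - 2 * G s y\<bar> \<le> K * \<bar>x - y\<bar>" if s: "s \<in> closed_segment 0 t" for s x y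
    proof -
      have sJ: "s \<in> J" using s sub by auto
      have "h s absolutely_integrable_on {0..L}" using G[OF sJ] by (simp add: is_stream_def)
      from AE_bound_integral[OF this C[OF s]]
      have "\<bar>G s x - G s y\<bar> \<le> stream_const * (\<bar>C\<bar> * (L powr (1 - \<alpha>) / (1 - \<alpha>))) * \<bar>x - y\<bar>"
        by (rule stream_lipschitz[OF G[OF sJ]])
      then have "2 * \<bar>G s x - G s y\<bar> \<le> K * \<bar>x - y\<bar>"
        unfolding K_def mult.assoc by (rule mult_left_mono) simp
      moreover have "\<bar>2 * p - 2 * q\<bar> = 2 * \<bar>p - q\<bar>" for p q :: real by (auto simp: abs_if)
      ultimately show ?thesis by (simp only:)
    qed
    have deriv: "((\<lambda>s. \<Phi> s \<theta>) has_real_derivative 2 * G s (\<Phi> s \<theta>)) (at s within closed_segment 0 t)"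
      if "s \<in> closed_segment 0 t" for s \<theta>
      using \<Phi>[of s] that sub by (blast intro: DERIV_subset)
    have fixed: "\<Phi> s e = e" if s: "s \<in> closed_segment 0 t" and e: "e = 0 \<or> e = L" for s e
    proof -
      note sub_s = closed_segment_0_subset[OF s]
      have "\<Phi> s e - e = 0"
      proof (rule gronwall_zero[where w = "\<lambda>s. \<Phi> s e - e" and t = s and C = K])
        fix r assume "r \<in> closed_segment 0 s"
        then have r: "r \<in> closed_segment 0 t" "r \<in> J" using sub_s sub by auto
        have "((\<lambda>s. \<Phi> s e) has_real_derivative 2 * G r (\<Phi> r e)) (at r within closed_segment 0 s)"
          by (rule DERIV_subset[OF deriv[OF r(1)] sub_s])
        then show "((\<lambda>s. \<Phi> s e - e) has_real_derivative 2 * G r (\<Phi> r e)) (at r within closed_segment 0 s)"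
          by (auto intro!: derivative_eq_intros)
        have "odd_symmetric m (G r)" using G[OF r(2)] by (simp add: is_stream_def)
        then have "G r e = 0" using e odd_symmetric_ends by auto
        then show "\<bar>2 * G r (\<Phi> r e)\<bar> \<le> K * \<bar>\<Phi> r e - e\<bar>" using lip[OF r(1), of "\<Phi> r e" e] by simp
      qed (simp add: \<Phi>0)
      then show ?thesis by simp
    qed
    have "flow_map (exp (K * \<bar>t\<bar>)) (\<Phi> s)" if s: "s \<in> closed_segment 0 t" for s
      by (rule flow_map_of_trajectories[OF deriv lip]) (use s K fixed \<Phi>0 in auto)
    then show ?thesis by blast
  qed
  have "2 * G t (\<Phi> t z) = 2 * stream_of (\<Phi> t) (\<Phi> t z)" if t: "t \<in> J" and z: "z \<in> {0..L}" for t z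
  proof -
    obtain C where C: "flow_map C (\<Phi> t)" using flow[OF t] by auto
    have "\<Phi> t z \<in> {0..L}" using admissibleD(1)[OF flow_map_admissible[OF C order_refl] z] .
    then show ?thesis
      using stream_eq_stream_of[OF G[OF t] C] carries[OF t] by (simp add: carries_def)
  qed
  then have "lagrangian J \<Phi>"
    unfolding lagrangian_def using J flow \<Phi>0 \<Phi> by metis
  then show ?thesis using carries by blast
qed

text \<open>
  The vorticity is transported from the sector by the flow and extended by symmetry. Its stream function
  exists by \<open>stream_exists\<close> and agrees with \<open>stream_of\<close> by the layer-cake formula.
\<close>
theorem lagrangian_solution:
  assumes \<Phi>: "lagrangian J \<Phi>"
  shows "\<exists>h. is_solution m \<alpha> initial_datum J h \<and> (\<forall>t\<in>J. odd_symmetric m (h t) \<and> carries (\<Phi> t) (h t))"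
proof -
  have J: "is_interval J" "0 \<in> J" and \<Phi>0: "\<And>z. z \<in> {0..L} \<Longrightarrow> \<Phi> 0 z = z"
    and \<Phi>': "\<And>z t. z \<in> {0..L} \<Longrightarrow> t \<in> J \<Longrightarrow>
      ((\<lambda>s. \<Phi> s z) has_real_derivative 2 * stream_of (\<Phi> t) (\<Phi> t z)) (at t within J)"
    and segs: "\<And>t. t \<in> J \<Longrightarrow> \<exists>C. \<forall>s\<in>closed_segment 0 t. flow_map C (\<Phi> s)"
    using \<Phi> by (auto simp: lagrangian_def)
  have flow: "\<exists>C. flow_map C (\<Phi> t)" if "t \<in> J" for t using segs[OF that] by auto
  define \<phi> where "\<phi> t = inv_into {0..L} (\<Phi> t)" for t
  define h where "h t = odd_symmetric_ext m (\<lambda>y. - (\<phi> t y powr (- \<alpha>)))" for t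
  have h_eq: "h t y = - (\<phi> t y powr (- \<alpha>))" if "y \<in> {0<..<L}" for t y
    unfolding h_def by (rule odd_symmetric_ext_sector[OF that])
  have h_sym: "odd_symmetric m (h t)" for t unfolding h_def by (rule odd_symmetric_ext_sym)
  have carries: "carries (\<Phi> t) (h t)" if t: "t \<in> J" for t
    unfolding carries_def
  proof
    fix z assume z: "z \<in> {0<..<L}"
    obtain C where C: "flow_map C (\<Phi> t)" using flow[OF t] by blast
    have "\<phi> t (\<Phi> t z) = z" using flow_map_inverse(3)[OF C, of z] z by (simp add: \<phi>_def)
    then show "h t (\<Phi> t z) = - (z powr (- \<alpha>))" using h_eq[OF flow_map_interior[OF C z], of t] by simp
  qed
  have bound: "\<bar>h t y\<bar> \<le> C powr \<alpha> * y powr (- \<alpha>)" if C: "flow_map C (\<Phi> t)" and y: "y \<in> {0<..<L}" for t y C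
  proof -
    note I = flow_map_inverse(1)[OF C, folded \<phi>_def]
    have "0 < \<phi> t y" using flow_map_interior[OF I y] by simp
    moreover have "y \<le> C * \<phi> t y"
    proof -
      have "y - 0 \<le> C * (\<phi> t y - \<phi> t 0) \<and> \<phi> t 0 = 0"
        using I y unfolding flow_map_def by (metis greaterThanLessThan_iff less_imp_le order_refl)
      then show ?thesis by (metis diff_zero)
    qed
    moreover have "0 < C" using flow_map_const_ge_1[OF C] by simp
    ultimately have "y / C \<le> \<phi> t y" by (simp add: field_simps)
    then have "\<phi> t y powr (- \<alpha>) \<le> (y / C) powr (- \<alpha>)"
      using y \<open>0 < C\<close> alpha_pos by (intro powr_mono2') auto
    also have "\<dots> = C powr \<alpha> * y powr (- \<alpha>)"
      using y \<open>0 < C\<close> by (simp add: powr_divide powr_minus field_simps)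
    finally show ?thesis using h_eq[OF y] by simp
  qed
  have int: "h t absolutely_integrable_on {a..b}" if t: "t \<in> J" for t a b
  proof -
    obtain C where C: "flow_map C (\<Phi> t)" using flow[OF t] by blast
    note I = flow_map_inverse(1)[OF C, folded \<phi>_def]
    have "continuous_on {0<..<L} (\<lambda>y. - (\<phi> t y powr (- \<alpha>)))"
      using flow_map_interior[OF I]
      by (intro continuous_intros continuous_on_subset[OF flow_map_continuous[OF I]]) force+
    then have "continuous_on {0<..<L} (h t)" by (rule continuous_on_eq) (simp add: h_eq)
    then show ?thesis by (rule odd_symmetric_absolutely_integrable[OF h_sym _ bound[OF C]])
  qed
  obtain G where G: "\<And>t. t \<in> J \<Longrightarrow> is_stream m (h t) (G t)"
    using stream_exists[OF h_sym int] by metis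
  have G_sym: "odd_symmetric m (G t)" if "t \<in> J" for t using G[OF that] by (simp add: is_stream_def)
  have G_eq: "G t (\<Phi> t z) = stream_of (\<Phi> t) (\<Phi> t z)" if t: "t \<in> J" and z: "z \<in> {0..L}" for t z
  proof -
    obtain C where C: "flow_map C (\<Phi> t)" using flow[OF t] by blast
    have "\<Phi> t z \<in> {0..L}" using admissibleD(1)[OF flow_map_admissible[OF C order_refl] z] .
    then show ?thesis
      using stream_eq_stream_of[OF G[OF t] C] carries[OF t] by (simp add: carries_def)
  qed
  \<comment> \<open>The flow commutes with the symmetries, so its displacement extends to an odd periodic function.\<close>
  define d where "d t = odd_symmetric_ext m (\<lambda>z. \<Phi> t z - z)" for t
  define \<Psi> where "\<Psi> t \<theta> = \<theta> + d t \<theta>" for t \<theta>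
  have d_sym: "odd_symmetric m (d t)" for t unfolding d_def by (rule odd_symmetric_ext_sym)
  have d_eq: "d t r = \<Phi> t r - r" if t: "t \<in> J" and r: "r \<in> {0..L}" for t r
  proof (cases "r = 0 \<or> r = L")
    case True
    then show ?thesis
      using odd_symmetric_ends[OF d_sym[of t]] flow[OF t] by (auto simp: flow_map_def)
  next
    case False
    then show ?thesis using r unfolding d_def by (intro odd_symmetric_ext_sector) auto
  qed
  have \<Psi>_shift: "\<Psi> t (r + 2 * L * of_int k) = \<Phi> t r + 2 * L * of_int k"
    and \<Psi>_reflect: "\<Psi> t (2 * L * of_int k - r) = 2 * L * of_int k - \<Phi> t r"
    if "t \<in> J" "r \<in> {0..L}" for t r k
    using d_eq[OF that] by (auto simp: \<Psi>_def odd_symmetric_shift[OF d_sym] odd_symmetric_reflect[OF d_sym])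
  have transported: "h t (\<Phi> t r) = initial_datum r" if t: "t \<in> J" and r: "r \<in> {0..L}" for t r
  proof (cases "r = 0 \<or> r = L")
    case True
    then have "\<Phi> t r = r" using flow[OF t] by (auto simp: flow_map_def)
    then show ?thesis
      using True odd_symmetric_ends[OF h_sym[of t]] odd_symmetric_ends[OF odd_symmetric_ext_sym] by auto
  next
    case False
    then have "r \<in> {0<..<L}" using r by auto
    then show ?thesis using carries[OF t] odd_symmetric_ext_sector by (simp add: carries_def)
  qed
  have measurable: "h t \<in> borel_measurable lebesgue" if "t \<in> J" for t
    by (rule absolutely_integrable_imp_lebesgue_measurable[OF int[OF that]])
  have \<Psi>0: "\<Psi> 0 \<theta> = \<theta>" for \<theta>
  proof -
    have "d 0 = (\<lambda>_. 0)"
      using d_eq[OF J(2)] \<Phi>0 by (intro odd_symmetric_eqI[OF d_sym]) (auto simp: odd_symmetric_iff)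
    then show ?thesis by (simp add: \<Psi>_def)
  qed
  have locally_bounded: "\<exists>C. \<forall>t\<in>K. AE \<theta> in lebesgue. 0 < \<theta> \<and> \<theta> < pi / real m \<longrightarrow> \<bar>\<theta> powr \<alpha> * h t \<theta>\<bar> \<le> C"
    if K: "compact K" "K \<subseteq> J" for K
  proof (cases "K = {}")
    case False
    obtain a b where ab: "a \<in> K" "b \<in> K" "\<And>t. t \<in> K \<Longrightarrow> a \<le> t \<and> t \<le> b"
      using compact_attains_inf[OF K(1) False] compact_attains_sup[OF K(1) False] by metis
    obtain Ca where Ca: "\<And>s. s \<in> closed_segment 0 a \<Longrightarrow> flow_map Ca (\<Phi> s)"
      using segs[of a] ab K by blast
    obtain Cb where Cb: "\<And>s. s \<in> closed_segment 0 b \<Longrightarrow> flow_map Cb (\<Phi> s)"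
      using segs[of b] ab K by blast
    have "\<bar>\<theta> powr \<alpha> * h t \<theta>\<bar> \<le> max (Ca powr \<alpha>) (Cb powr \<alpha>)" if t: "t \<in> K" and \<theta>: "0 < \<theta>" "\<theta> < L" for t \<theta>
    proof -
      have *: "\<bar>\<theta> powr \<alpha> * h t \<theta>\<bar> \<le> C powr \<alpha>" if "flow_map C (\<Phi> t)" for C
      proof -
        have "\<theta> powr \<alpha> * \<bar>h t \<theta>\<bar> \<le> \<theta> powr \<alpha> * (C powr \<alpha> * \<theta> powr (- \<alpha>))"
          using bound[OF that, of \<theta>] \<theta> by (intro mult_left_mono) auto
        also have "\<dots> = C powr \<alpha>" using \<theta> by (simp add: powr_minus)
        finally show ?thesis by (simp add: abs_mult)
      qed
      show ?thesis
      proof (cases "0 \<le> t")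
        case True
        then have "t \<in> closed_segment 0 b" using ab(3)[OF t] by (simp add: closed_segment_eq_real_ivl)
        from *[OF Cb[OF this]] show ?thesis by simp
      next
        case False
        then have "t \<in> closed_segment 0 a" using ab(3)[OF t] by (simp add: closed_segment_eq_real_ivl)
        from *[OF Ca[OF this]] show ?thesis by simp
      qed
    qed
    then show ?thesis
      unfolding L_eq by (intro exI[of _ "max (Ca powr \<alpha>) (Cb powr \<alpha>)"]) simp
  qed simp
  have \<Psi>_transports: "h t (\<Psi> t \<theta>) = initial_datum \<theta>" if t: "t \<in> J" for t \<theta>
    by (cases \<theta> rule: fold_to_sector)
      (auto simp: \<Psi>_shift[OF t] \<Psi>_reflect[OF t] odd_symmetric_shift[OF h_sym] odd_symmetric_reflect[OF h_sym]
        odd_symmetric_shift[OF odd_symmetric_ext_sym] odd_symmetric_reflect[OF odd_symmetric_ext_sym] transported[OF t])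
  have \<Psi>_deriv: "((\<lambda>s. \<Psi> s \<theta>) has_real_derivative 2 * G t (\<Psi> t \<theta>)) (at t within J)"
    if t: "t \<in> J" for t \<theta>
  proof (cases \<theta> rule: fold_to_sector)
    case (1 r k)
    have "((\<lambda>s. \<Phi> s r + 2 * L * of_int k) has_real_derivative 2 * G t (\<Psi> t \<theta>)) (at t within J)"
      using \<Phi>'[OF 1(1) t] G_eq[OF t 1(1)] \<Psi>_shift[OF t 1(1)]
      by (auto intro!: derivative_eq_intros simp: 1(2) odd_symmetric_shift[OF G_sym[OF t]])
    then show ?thesis
      by (rule has_field_derivative_transform_within[where d = 1]) (use t 1 \<Psi>_shift in auto)
  next
    case (2 r k)
    have "((\<lambda>s. 2 * L * of_int k - \<Phi> s r) has_real_derivative 2 * G t (\<Psi> t \<theta>)) (at t within J)"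
      using \<Phi>'[OF 2(1) t] G_eq[OF t 2(1)] \<Psi>_reflect[OF t 2(1)]
      by (auto intro!: derivative_eq_intros simp: 2(2) odd_symmetric_reflect[OF G_sym[OF t]])
    then show ?thesis
      by (rule has_field_derivative_transform_within[where d = 1]) (use t 2 \<Psi>_reflect in auto)
  qed
  have "is_solution m \<alpha> initial_datum J h"
    unfolding is_solution_def
  proof (intro conjI)
    show "\<forall>t\<in>J. odd_symmetric m (h t) \<and> h t \<in> borel_measurable lebesgue"
      using h_sym measurable by blast
    show "\<forall>K. compact K \<and> K \<subseteq> J \<longrightarrow> (\<exists>C. \<forall>t\<in>K. AE \<theta> in lebesgue.
        0 < \<theta> \<and> \<theta> < pi / real m \<longrightarrow> \<bar>\<theta> powr \<alpha> * h t \<theta>\<bar> \<le> C)"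
      using locally_bounded by blast
    show "\<exists>G \<Phi>. (\<forall>t\<in>J. is_stream m (h t) (G t)) \<and> (\<forall>\<theta>. \<Phi> 0 \<theta> = \<theta>) \<and>
        (\<forall>\<theta>. \<forall>t\<in>J. ((\<lambda>s. \<Phi> s \<theta>) has_real_derivative 2 * G t (\<Phi> t \<theta>)) (at t within J)) \<and>
        (\<forall>\<theta>. \<forall>t\<in>J. h t (\<Phi> t \<theta>) = initial_datum \<theta>)"
      by (rule exI[of _ G], rule exI[of _ \<Psi>]) (simp add: G \<Psi>0 \<Psi>_deriv \<Psi>_transports)
  qed (use J in auto)
  then show ?thesis using h_sym carries by blast
qed

theorem maximal_solution_exists: "\<exists>T g. is_maximal_solution m \<alpha> initial_datum {..<T} g"
proof -
  obtain T \<Phi> where \<Phi>: "lagrangian {..<T} \<Phi>"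
    and maximal: "\<And>J \<Psi>. lagrangian J \<Psi> \<Longrightarrow> J \<subseteq> {..<T}"
    using maximal_lagrangian_exists by blast
  obtain g where g: "is_solution m \<alpha> initial_datum {..<T} g"
    and g_sym: "\<And>t. t < T \<Longrightarrow> odd_symmetric m (g t)"
    and g_carries: "\<And>t. t < T \<Longrightarrow> carries (\<Phi> t) (g t)"
    using lagrangian_solution[OF \<Phi>] by auto
  have "J \<subseteq> {..<T} \<and> (\<forall>t\<in>J. h t = g t)" if h: "is_solution m \<alpha> initial_datum J h" for J h
  proof -
    obtain \<Psi> where \<Psi>: "lagrangian J \<Psi>" and h_carries: "\<And>t. t \<in> J \<Longrightarrow> carries (\<Psi> t) (h t)"
      using solution_lagrangian[OF h] by blast
    have sub: "J \<subseteq> {..<T}" by (rule maximal[OF \<Psi>])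
    have "h t = g t" if t: "t \<in> J" for t
    proof -
      have tT: "t < T" using t sub by auto
      obtain C where C: "flow_map C (\<Phi> t)" using \<Phi> tT unfolding lagrangian_def by blast
      have "\<Psi> t z = \<Phi> t z" if "z \<in> {0..L}" for z
        using tT by (intro lagrangian_unique[OF \<Psi> \<Phi> t _ that]) simp
      then have "carries (\<Phi> t) (h t)" using h_carries[OF t] by (simp add: carries_def)
      moreover have "odd_symmetric m (h t)" using h t by (simp add: is_solution_def)
      ultimately show ?thesis
        by (intro carries_unique[OF C _ _ g_sym[OF tT] g_carries[OF tT]])
    qed
    then show ?thesis using sub by blast
  qed
  then show ?thesis using g unfolding is_maximal_solution_def by blast
qed

end

theorem theorem1p4:
  fixes m :: nat and \<alpha> :: real
  assumes "m \<ge> 3" and "0 < \<alpha>" and "\<alpha> < 1"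
  shows "\<exists>T g. is_maximal_solution m \<alpha>
           (odd_symmetric_ext m (\<lambda>\<theta>. - (\<theta> powr (- \<alpha>)))) {..<T} g"
proof -
  have "pi / real m \<le> pi / 3" using assms by (intro divide_left_mono) auto
  then have "symmetric_sector (pi / real m) \<alpha> m"
    using assms by unfold_locales (auto simp: field_simps)
  then show ?thesis by (rule symmetric_sector.maximal_solution_exists)
qed

end
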